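(* Let $R$ and $S$ be Artin algebras, let $(S\text{-}\mathrm{mod},R\text{-}\mathrm{mod},\mathrm{i},\mathrm{e},\mathrm{l})$ be a cleft extension with induced endofunctor $\mathrm{F}:S\text{-}\mathrm{mod}\to S\text{-}\mathrm{mod}$, and let $j$ be a non-negative integer. If $\mathrm{e}$ preserves projectives, $\mathrm{l}$ is exact and $\mathrm{F}^{n}=0$ for some $n\geq 1$, then $$\mathrm{ext.dim}(\Omega^{j}(S\text{-}\mathrm{mod}))\leq \mathrm{ext.dim}(\Omega^{j}(R\text{-}\mathrm{mod}))\leq n\cdot\mathrm{ext.dim}(\Omega^{j}(S\text{-}\mathrm{mod}))+(n-1).$$
   Context: All rings are Artin $k$-algebras with unit, where $k$ is a fixed commutative Artin ring, and all modules are finitely generated left modules. For an Artin algebra $A$, $A\text{-}\mathrm{mod}$ is the category of finitely generated left $A$-modules; subcategories of $A\text{-}\mathrm{mod}$ are full, additive and closed under isomorphisms. Extension dimension. For a subcategory (or class of objects) $\mathcal{U}$ of $A\text{-}\mathrm{mod}$, $\mathrm{add}(\mathcal{U})$ is the smallest full subcategory of $A\text{-}\mathrm{mod}$ containing $\mathcal{U}$ and closed under finite direct sums and direct summands. For subcategories $\mathcal{U},\mathcal{V}$, $\mathcal{U}\ast\mathcal{V}$ is the full subcategory of modules $X$ fitting into a short exact sequence $0\to U\to X\to V\to 0$ with $U\in\mathcal{U}$, $V\in\mathcal{V}$. Put $[\mathcal{U}]_0$ = the zero modules, $[\mathcal{U}]_1=\mathrm{add}(\mathcal{U})$, and $[\mathcal{U}]_n=\mathrm{add}([\mathcal{U}]_{n-1}\ast[\mathcal{U}]_1)$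 for $n\geq 2$; write $[M]_n=[\{M\}]_n$ for a module $M$. The extension dimension is $\mathrm{ext.dim}(\mathcal{U})=\inf\{n\geq 0\mid \mathcal{U}\subseteq [N]_{n+1}\text{ for some }N\in A\text{-}\mathrm{mod}\}$, or $\infty$ if no such $n$ exists. Syzygies. For $n\geq 1$ and $M\in A\text{-}\mathrm{mod}$, a module $K$ is an $n$-th syzygy module of $M$ if there is an exact sequence $\cdots\to P_n\to P_{n-1}\to\cdots\to P_0\to M\to 0$ in $A\text{-}\mathrm{mod}$ with all $P_i$ projective and $K\cong\mathrm{Im}(P_n\to P_{n-1})$; the $0$-th syzygy of $M$ is $M$ (up to isomorphism). $\Omega^n(A\text{-}\mathrm{mod})$ is the full subcategory of $A\text{-}\mathrm{mod}$ of all $n$-th syzygy modules, and $\Omega^0(A\text{-}\mathrm{mod})=A\text{-}\mathrm{mod}$. Cleft extension. A cleft extension $(S\text{-}\mathrm{mod},R\text{-}\mathrm{mod},\mathrm{i},\mathrm{e},\mathrm{l})$ of $S\text{-}\mathrm{mod}$ consists of functors $\mathrm{i}:S\text{-}\mathrm{mod}\to R\text{-}\mathrm{mod}$, $\mathrm{e}:R\text{-}\mathrm{mod}\to S\text{-}\mathrm{mod}$, $\mathrm{l}:S\text{-}\mathrm{mod}\to R\text{-}\mathrm{mod}$ such that (1) $\mathrm{e}$ is faithful and exact; (2) $(\mathrm{l},\mathrm{e})$ is an adjoint pair ($\mathrm{l}$ left adjoint to $\mathrm{e}$); (3) there is a natural isomorphism $\mathrm{e}\mathrm{i}\cong\mathrm{Id}_{S\text{-}\mathrm{mod}}$.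 Let $\mu:\mathrm{l}\mathrm{e}\to\mathrm{Id}_{R\text{-}\mathrm{mod}}$ be the counit of the adjunction (each $\mu_X$ is an epimorphism), and let $\mathrm{G}(X)=\mathrm{Ker}(\mu_X)$ for $X\in R\text{-}\mathrm{mod}$. The induced endofunctor $\mathrm{F}$ of $S\text{-}\mathrm{mod}$ is $\mathrm{F}(N)=\mathrm{e}(\mathrm{G}(\mathrm{i}(N)))$. $\mathrm{F}^n$ denotes the $n$-fold composite. *)

theory Defs
  imports "HOL-Algebra.Module" "HOL-Algebra.Ideal" "HOL-Library.Extended_Nat"
begin

section \<open>Left modules over a (not necessarily commutative) ring\<close>

text \<open>
  The locale \<open>module\<close> of HOL-Algebra requires a commutative ring of scalars. The axioms below are
  the same, over an arbitrary ring. The record type \<open>module\<close> is reused; its fields \<open>mult\<close> and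
  \<open>one\<close> carry no information for a module (two modules that differ only there are isomorphic via
  the identity).
\<close>

locale left_module = R?: ring R + M?: abelian_group M
  for R :: "('a, 'x) ring_scheme" (structure) and M :: "('a, 'm) module" (structure) +
  assumes smult_closed:
      "\<lbrakk>a \<in> carrier R; x \<in> carrier M\<rbrakk> \<Longrightarrow> a \<odot>\<^bsub>M\<^esub> x \<in> carrier M"
    and smult_l_distr:
      "\<lbrakk>a \<in> carrier R; b \<in> carrier R; x \<in> carrier M\<rbrakk> \<Longrightarrow>
        (a \<oplus>\<^bsub>R\<^esub> b) \<odot>\<^bsub>M\<^esub> x = a \<odot>\<^bsub>M\<^esub> x \<oplus>\<^bsub>M\<^esub> b \<odot>\<^bsub>M\<^esub> x"
    and smult_r_distr:
      "\<lbrakk>a \<in> carrier R; x \<in> carrier M; y \<in> carrier M\<rbrakk> \<Longrightarrow>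
        a \<odot>\<^bsub>M\<^esub> (x \<oplus>\<^bsub>M\<^esub> y) = a \<odot>\<^bsub>M\<^esub> x \<oplus>\<^bsub>M\<^esub> a \<odot>\<^bsub>M\<^esub> y"
    and smult_assoc1:
      "\<lbrakk>a \<in> carrier R; b \<in> carrier R; x \<in> carrier M\<rbrakk> \<Longrightarrow>
        (a \<otimes>\<^bsub>R\<^esub> b) \<odot>\<^bsub>M\<^esub> x = a \<odot>\<^bsub>M\<^esub> (b \<odot>\<^bsub>M\<^esub> x)"
    and smult_one:
      "x \<in> carrier M \<Longrightarrow> \<one>\<^bsub>R\<^esub> \<odot>\<^bsub>M\<^esub> x = x"

definition fin_gen :: "('a, 'x) ring_scheme \<Rightarrow> ('a, 'm) module \<Rightarrow> bool" where
  "fin_gen A M \<longleftrightarrow> (\<exists>B. finite B \<and> B \<subseteq> carrier M \<and>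
     (\<forall>x\<in>carrier M. \<exists>a\<in>B \<rightarrow> carrier A. x = (\<Oplus>\<^bsub>M\<^esub>b\<in>B. a b \<odot>\<^bsub>M\<^esub> b)))"

definition fgmod :: "('a, 'x) ring_scheme \<Rightarrow> ('a, 'm) module set" where
  "fgmod A = {M. left_module A M \<and> fin_gen A M}"

text \<open>Morphisms are extensional functions, so that equality of morphisms is equality in HOL.\<close>

definition mhom :: "('a, 'x) ring_scheme \<Rightarrow> ('a, 'm) module \<Rightarrow> ('a, 'n) module \<Rightarrow> ('m \<Rightarrow> 'n) set" where
  "mhom A M N = {f \<in> carrier M \<rightarrow>\<^sub>E carrier N.
     (\<forall>x\<in>carrier M. \<forall>y\<in>carrier M. f (x \<oplus>\<^bsub>M\<^esub> y) = f x \<oplus>\<^bsub>N\<^esub> f y) \<and>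
     (\<forall>a\<in>carrier A. \<forall>x\<in>carrier M. f (a \<odot>\<^bsub>M\<^esub> x) = a \<odot>\<^bsub>N\<^esub> f x)}"

definition mid :: "('a, 'm) module \<Rightarrow> 'm \<Rightarrow> 'm" where
  "mid M = (\<lambda>x\<in>carrier M. x)"

definition miso :: "('a, 'x) ring_scheme \<Rightarrow> ('a, 'm) module \<Rightarrow> ('a, 'n) module \<Rightarrow> bool" where
  "miso A M N \<longleftrightarrow> (\<exists>f\<in>mhom A M N. bij_betw f (carrier M) (carrier N))"

definition zero_module :: "('a, 'm) module \<Rightarrow> bool" where
  "zero_module M \<longleftrightarrow> carrier M = {\<zero>\<^bsub>M\<^esub>}"

definition mker :: "('a, 'm) module \<Rightarrow> ('a, 'n) module \<Rightarrow> ('m \<Rightarrow> 'n) \<Rightarrow> ('a, 'm) module" where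
  "mker M N f = M\<lparr>carrier := {x \<in> carrier M. f x = \<zero>\<^bsub>N\<^esub>}\<rparr>"

definition mim :: "('a, 'm) module \<Rightarrow> ('a, 'n) module \<Rightarrow> ('m \<Rightarrow> 'n) \<Rightarrow> ('a, 'n) module" where
  "mim M N f = N\<lparr>carrier := f ` carrier M\<rparr>"

definition dsum :: "('a, 'm) module \<Rightarrow> ('a, 'n) module \<Rightarrow> ('a, 'm \<times> 'n) module" where
  "dsum M N = \<lparr>carrier = carrier M \<times> carrier N, mult = undefined, one = undefined,
     zero = (\<zero>\<^bsub>M\<^esub>, \<zero>\<^bsub>N\<^esub>),
     add = (\<lambda>(x, y) (x', y'). (x \<oplus>\<^bsub>M\<^esub> x', y \<oplus>\<^bsub>N\<^esub> y')),
     smult = (\<lambda>a (x, y). (a \<odot>\<^bsub>M\<^esub> x, a \<odot>\<^bsub>N\<^esub> y))\<rparr>"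

definition short_exact ::
  "('a, 'x) ring_scheme \<Rightarrow> ('a, 'm) module \<Rightarrow> ('m \<Rightarrow> 'n) \<Rightarrow> ('a, 'n) module \<Rightarrow> ('n \<Rightarrow> 'p) \<Rightarrow> ('a, 'p) module \<Rightarrow> bool"
  where
  "short_exact A U f X g V \<longleftrightarrow> f \<in> mhom A U X \<and> g \<in> mhom A X V \<and>
     inj_on f (carrier U) \<and> f ` carrier U = {x \<in> carrier X. g x = \<zero>\<^bsub>V\<^esub>} \<and>
     g ` carrier X = carrier V"


section \<open>Artin algebras and their module categories\<close>

definition artinian_ring :: "('k, 'x) ring_scheme \<Rightarrow> bool" where
  "artinian_ring k \<longleftrightarrow> ring k \<and>
     (\<forall>I :: nat \<Rightarrow> 'k set. (\<forall>n. ideal (I n) k) \<and> (\<forall>n. I (Suc n) \<subseteq> I n) \<longrightarrow>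
        (\<exists>m. \<forall>n\<ge>m. I n = I m))"

text \<open>
  An Artin \<open>k\<close>-algebra is given by its ring structure together with its \<open>k\<close>-module structure.
  Multiplication is not assumed commutative, so the locale \<open>algebra\<close> of HOL-Algebra does not apply.
  The zero ring is not excluded.
\<close>

definition artin_algebra :: "('k, 'x) ring_scheme \<Rightarrow> ('k, 'a) module \<Rightarrow> bool" where
  "artin_algebra k A \<longleftrightarrow> cring k \<and> artinian_ring k \<and> ring A \<and> Module.module k A \<and> fin_gen k A \<and>
     (\<forall>c\<in>carrier k. \<forall>x\<in>carrier A. \<forall>y\<in>carrier A.
        (c \<odot>\<^bsub>A\<^esub> x) \<otimes>\<^bsub>A\<^esub> y = c \<odot>\<^bsub>A\<^esub> (x \<otimes>\<^bsub>A\<^esub> y) \<and>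
        x \<otimes>\<^bsub>A\<^esub> (c \<odot>\<^bsub>A\<^esub> y) = c \<odot>\<^bsub>A\<^esub> (x \<otimes>\<^bsub>A\<^esub> y))"

text \<open>
  As objects of the category of finitely generated left modules over a ring with elements in \<open>'a\<close>
  we take those whose underlying set consists of lists over \<open>'a\<close>. Up to isomorphism this is no
  restriction (lemma \<open>fgmod_list_representative\<close> below): given generators \<open>b\<^sub>1, \<dots>, b\<^sub>n\<close>, an
  element is encoded by a list of coefficients.
\<close>

type_synonym 'a lmod = "('a, 'a list) module"

lemma miso_transport:
  fixes M :: "('a, 'm) module" and j :: "'m \<Rightarrow> 'n"
  assumes M: "M \<in> fgmod A" and inj: "inj_on j (carrier M)"
  shows "\<exists>N :: ('a, 'n) module. N \<in> fgmod A \<and> miso A M N"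
proof -
  interpret left_module A M using M by (simp add: fgmod_def)
  define g where "g = inv_into (carrier M) j"
  define N :: "('a, 'n) module" where
    "N = \<lparr>carrier = j ` carrier M, mult = undefined, one = undefined, zero = j \<zero>\<^bsub>M\<^esub>,
      add = (\<lambda>u v. j (g u \<oplus>\<^bsub>M\<^esub> g v)), smult = (\<lambda>a u. j (a \<odot>\<^bsub>M\<^esub> g u))\<rparr>"
  have gj [simp]: "g (j x) = x" if "x \<in> carrier M" for x
    using that inj by (simp add: g_def)
  have N_simps [simp]: "carrier N = j ` carrier M" "\<zero>\<^bsub>N\<^esub> = j \<zero>\<^bsub>M\<^esub>"
    "u \<oplus>\<^bsub>N\<^esub> v = j (g u \<oplus>\<^bsub>M\<^esub> g v)" "a \<odot>\<^bsub>N\<^esub> u = j (a \<odot>\<^bsub>M\<^esub> g u)" for u v a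
    by (simp_all add: N_def)
  have ab: "abelian_group N"
  proof (rule abelian_groupI)
    fix x assume "x \<in> carrier N"
    then obtain y where y: "y \<in> carrier M" "x = j y" by auto
    show "\<exists>z\<in>carrier N. z \<oplus>\<^bsub>N\<^esub> x = \<zero>\<^bsub>N\<^esub>"
      by (rule bexI[of _ "j (\<ominus>\<^bsub>M\<^esub> y)"]) (use y in \<open>auto simp: M.l_neg\<close>)
  qed (auto simp: M.a_ac)
  interpret N: abelian_group N by (rule ab)
  have lm: "left_module A N"
    by (intro left_module.intro left_module_axioms.intro ab R.ring_axioms)
       (auto simp: smult_closed smult_l_distr smult_r_distr smult_assoc1 smult_one)
  obtain B where B: "finite B" "B \<subseteq> carrier M"
    "\<forall>x\<in>carrier M. \<exists>a\<in>B \<rightarrow> carrier A. x = (\<Oplus>\<^bsub>M\<^esub>b\<in>B. a b \<odot>\<^bsub>M\<^esub> b)"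
    using M by (auto simp: fgmod_def fin_gen_def)
  have fs: "j (\<Oplus>\<^bsub>M\<^esub>b\<in>C. f b) = (\<Oplus>\<^bsub>N\<^esub>b\<in>C. j (f b))"
    if "finite C" "f \<in> C \<rightarrow> carrier M" for C :: "'m set" and f
    using that
  proof (induction C rule: finite_induct)
    case (insert x F)
    then have f: "f x \<in> carrier M" "f \<in> F \<rightarrow> carrier M" by auto
    have "(\<Oplus>\<^bsub>N\<^esub>b\<in>insert x F. j (f b)) = j (f x) \<oplus>\<^bsub>N\<^esub> (\<Oplus>\<^bsub>N\<^esub>b\<in>F. j (f b))"
      by (rule N.finsum_insert) (use insert f in auto)
    also have "\<dots> = j (f x) \<oplus>\<^bsub>N\<^esub> j (\<Oplus>\<^bsub>M\<^esub>b\<in>F. f b)"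
      using insert.IH f by simp
    also have "\<dots> = j (\<Oplus>\<^bsub>M\<^esub>b\<in>insert x F. f b)"
      using insert.hyps f by (simp add: M.finsum_insert M.finsum_closed)
    finally show ?case by simp
  qed simp
  have "fin_gen A N"
    unfolding fin_gen_def
  proof (intro exI[of _ "j ` B"] conjI ballI)
    fix x assume "x \<in> carrier N"
    then obtain y where y: "y \<in> carrier M" "x = j y" by auto
    then obtain a where a: "a \<in> B \<rightarrow> carrier A" "y = (\<Oplus>\<^bsub>M\<^esub>b\<in>B. a b \<odot>\<^bsub>M\<^esub> b)"
      using B(3) by blast
    have cl: "(\<lambda>b. a b \<odot>\<^bsub>M\<^esub> b) \<in> B \<rightarrow> carrier M"
      using a(1) B(2) by (auto intro!: smult_closed)
    have injB: "inj_on j B" using inj B(2) by (rule inj_on_subset)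
    have gB: "g (j b) = b" if "b \<in> B" for b using that B(2) by auto
    have "x = (\<Oplus>\<^bsub>N\<^esub>b\<in>B. j (a b \<odot>\<^bsub>M\<^esub> b))"
      using y a fs[OF B(1) cl] by simp
    also have "\<dots> = (\<Oplus>\<^bsub>N\<^esub>b\<in>B. a (g (j b)) \<odot>\<^bsub>N\<^esub> j b)"
      by (rule N.finsum_cong') (use cl gB in auto)
    also have "\<dots> = (\<Oplus>\<^bsub>N\<^esub>b\<in>j ` B. a (g b) \<odot>\<^bsub>N\<^esub> b)"
      by (rule N.finsum_reindex[symmetric]) (use cl gB injB in \<open>auto simp: Pi_iff\<close>)
    finally show "\<exists>a\<in>j ` B \<rightarrow> carrier A. x = (\<Oplus>\<^bsub>N\<^esub>b\<in>j ` B. a b \<odot>\<^bsub>N\<^esub> b)"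
      by (rule_tac x = "\<lambda>b. a (g b)" in bexI) (use a gB in auto)
  qed (use B in auto)
  moreover have "miso A M N"
    unfolding miso_def
  proof (intro bexI[of _ "restrict j (carrier M)"])
    show "bij_betw (restrict j (carrier M)) (carrier M) (carrier N)"
      using inj by (simp add: bij_betw_def)
    show "restrict j (carrier M) \<in> mhom A M N"
      by (auto simp: mhom_def smult_closed)
  qed
  ultimately show ?thesis using lm by (auto simp: fgmod_def)
qed

lemma fgmod_list_representative:
  fixes M :: "('a, 'm) module"
  assumes M: "M \<in> fgmod A"
  shows "\<exists>N :: 'a lmod. N \<in> fgmod A \<and> miso A M N"
proof -
  interpret left_module A M using M by (simp add: fgmod_def)
  obtain B where B: "finite B" "B \<subseteq> carrier M"
    "\<forall>x\<in>carrier M. \<exists>a\<in>B \<rightarrow> carrier A. x = (\<Oplus>\<^bsub>M\<^esub>b\<in>B. a b \<odot>\<^bsub>M\<^esub> b)"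
    using M by (auto simp: fgmod_def fin_gen_def)
  obtain bs where bs: "set bs = B" using finite_list[OF B(1)] by blast
  obtain c where c: "\<And>x. x \<in> carrier M \<Longrightarrow> c x \<in> B \<rightarrow> carrier A"
    "\<And>x. x \<in> carrier M \<Longrightarrow> x = (\<Oplus>\<^bsub>M\<^esub>b\<in>B. c x b \<odot>\<^bsub>M\<^esub> b)"
    using bchoice[of "carrier M" "\<lambda>x a. a \<in> B \<rightarrow> carrier A \<and> x = (\<Oplus>\<^bsub>M\<^esub>b\<in>B. a b \<odot>\<^bsub>M\<^esub> b)"] B(3)
    by blast
  have "inj_on (\<lambda>x. map (c x) bs) (carrier M)"
  proof (rule inj_onI)
    fix x y assume xy: "x \<in> carrier M" "y \<in> carrier M" "map (c x) bs = map (c y) bs"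
    then have eq: "c x b = c y b" if "b \<in> B" for b using that bs by auto
    have "(\<Oplus>\<^bsub>M\<^esub>b\<in>B. c x b \<odot>\<^bsub>M\<^esub> b) = (\<Oplus>\<^bsub>M\<^esub>b\<in>B. c y b \<odot>\<^bsub>M\<^esub> b)"
      by (rule M.finsum_cong') (use eq c(1)[OF xy(2)] B(2) in \<open>auto intro!: smult_closed\<close>)
    then show "x = y" using c(2) xy by metis
  qed
  from miso_transport[OF M this] show ?thesis .
qed

definition projective :: "('a, 'x) ring_scheme \<Rightarrow> 'a lmod \<Rightarrow> bool" where
  "projective A P \<longleftrightarrow> P \<in> fgmod A \<and>
     (\<forall>M\<in>(fgmod A :: 'a lmod set). \<forall>N\<in>(fgmod A :: 'a lmod set).
      \<forall>p\<in>mhom A M N. \<forall>f\<in>mhom A P N.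
        p ` carrier M = carrier N \<longrightarrow> (\<exists>h\<in>mhom A P M. f = compose (carrier P) p h))"


section \<open>Extension dimension\<close>

inductive_set add_closure :: "('a, 'x) ring_scheme \<Rightarrow> 'a lmod set \<Rightarrow> 'a lmod set"
  for A :: "('a, 'x) ring_scheme" and U :: "'a lmod set" where
  base: "\<lbrakk>X \<in> U; X \<in> fgmod A\<rbrakk> \<Longrightarrow> X \<in> add_closure A U"
| empty_sum: "\<lbrakk>X \<in> fgmod A; zero_module X\<rbrakk> \<Longrightarrow> X \<in> add_closure A U"
| direct_sum: "\<lbrakk>X \<in> add_closure A U; Y \<in> add_closure A U; Z \<in> fgmod A; miso A Z (dsum X Y)\<rbrakk>
    \<Longrightarrow> Z \<in> add_closure A U"
| summand: "\<lbrakk>Z \<in> add_closure A U; X \<in> fgmod A; (Y :: 'a lmod) \<in> fgmod A; miso A Z (dsum X Y)\<rbrakk>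
    \<Longrightarrow> X \<in> add_closure A U"

definition ext_prod :: "('a, 'x) ring_scheme \<Rightarrow> 'a lmod set \<Rightarrow> 'a lmod set \<Rightarrow> 'a lmod set" where
  "ext_prod A \<U> \<V> = {X \<in> fgmod A. \<exists>U\<in>\<U>. \<exists>V\<in>\<V>. \<exists>f g. short_exact A U f X g V}"

fun ext_layer :: "('a, 'x) ring_scheme \<Rightarrow> 'a lmod set \<Rightarrow> nat \<Rightarrow> 'a lmod set" where
  "ext_layer A U 0 = {X \<in> fgmod A. zero_module X}"
| "ext_layer A U (Suc 0) = add_closure A U"
| "ext_layer A U (Suc (Suc n)) = add_closure A (ext_prod A (ext_layer A U (Suc n)) (ext_layer A U (Suc 0)))"

text \<open>In \<^typ>\<open>enat\<close> the infimum of the empty set is \<open>\<infinity>\<close>.\<close>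

definition ext_dim :: "('a, 'x) ring_scheme \<Rightarrow> 'a lmod set \<Rightarrow> enat" where
  "ext_dim A U = Inf {enat n |n. \<exists>N\<in>fgmod A. U \<subseteq> ext_layer A {N} (n + 1)}"


section \<open>Syzygies\<close>

text \<open>\<open>d n : P (n + 1) \<rightarrow> P n\<close> and \<open>\<epsilon> : P 0 \<rightarrow> M\<close>.\<close>

definition proj_resolution ::
  "('a, 'x) ring_scheme \<Rightarrow> 'a lmod \<Rightarrow> (nat \<Rightarrow> 'a lmod) \<Rightarrow> (nat \<Rightarrow> 'a list \<Rightarrow> 'a list) \<Rightarrow> ('a list \<Rightarrow> 'a list) \<Rightarrow> bool"
  where
  "proj_resolution A M P d \<epsilon> \<longleftrightarrow>
     (\<forall>n. projective A (P n)) \<and> (\<forall>n. d n \<in> mhom A (P (Suc n)) (P n)) \<and> \<epsilon> \<in> mhom A (P 0) M \<and>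
     \<epsilon> ` carrier (P 0) = carrier M \<and>
     d 0 ` carrier (P 1) = {x \<in> carrier (P 0). \<epsilon> x = \<zero>\<^bsub>M\<^esub>} \<and>
     (\<forall>n. d (Suc n) ` carrier (P (Suc (Suc n))) = {x \<in> carrier (P (Suc n)). d n x = \<zero>\<^bsub>P n\<^esub>})"

fun is_syzygy :: "('a, 'x) ring_scheme \<Rightarrow> nat \<Rightarrow> 'a lmod \<Rightarrow> 'a lmod \<Rightarrow> bool" where
  "is_syzygy A 0 M K \<longleftrightarrow> miso A K M"
| "is_syzygy A (Suc n) M K \<longleftrightarrow>
     (\<exists>P d \<epsilon>. proj_resolution A M P d \<epsilon> \<and> miso A K (mim (P (Suc n)) (P n) (d n)))"

definition Syz :: "('a, 'x) ring_scheme \<Rightarrow> nat \<Rightarrow> 'a lmod set" where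
  "Syz A n = {K \<in> fgmod A. \<exists>M\<in>fgmod A. is_syzygy A n M K}"


section \<open>Functors between module categories\<close>

text \<open>
  In \<open>arr F M N f\<close> the modules \<open>M\<close> and \<open>N\<close> are the source and the target of \<open>f\<close>. Functors are not
  assumed additive; an exact functor is automatically additive.
\<close>

record ('a, 'b) mfunctor =
  obj :: "'a lmod \<Rightarrow> 'b lmod"
  arr :: "'a lmod \<Rightarrow> 'a lmod \<Rightarrow> ('a list \<Rightarrow> 'a list) \<Rightarrow> ('b list \<Rightarrow> 'b list)"

definition is_functor ::
  "('a, 'x) ring_scheme \<Rightarrow> ('b, 'y) ring_scheme \<Rightarrow> ('a, 'b) mfunctor \<Rightarrow> bool" where
  "is_functor A B F \<longleftrightarrow>
     (\<forall>M\<in>fgmod A. obj F M \<in> fgmod B) \<and>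
     (\<forall>M\<in>fgmod A. \<forall>N\<in>fgmod A. \<forall>f\<in>mhom A M N. arr F M N f \<in> mhom B (obj F M) (obj F N)) \<and>
     (\<forall>M\<in>fgmod A. arr F M M (mid M) = mid (obj F M)) \<and>
     (\<forall>L\<in>fgmod A. \<forall>M\<in>fgmod A. \<forall>N\<in>fgmod A. \<forall>f\<in>mhom A L M. \<forall>g\<in>mhom A M N.
        arr F L N (compose (carrier L) g f) =
        compose (carrier (obj F L)) (arr F M N g) (arr F L M f))"

definition id_functor :: "('a, 'a) mfunctor" where
  "id_functor = \<lparr>obj = (\<lambda>M. M), arr = (\<lambda>M N f. f)\<rparr>"

definition comp_functor :: "('b, 'c) mfunctor \<Rightarrow> ('a, 'b) mfunctor \<Rightarrow> ('a, 'c) mfunctor" where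
  "comp_functor G F = \<lparr>obj = (\<lambda>M. obj G (obj F M)),
     arr = (\<lambda>M N f. arr G (obj F M) (obj F N) (arr F M N f))\<rparr>"

primrec functor_power :: "('a, 'a) mfunctor \<Rightarrow> nat \<Rightarrow> ('a, 'a) mfunctor" where
  "functor_power F 0 = id_functor"
| "functor_power F (Suc n) = comp_functor F (functor_power F n)"

definition zero_functor :: "('a, 'x) ring_scheme \<Rightarrow> ('a, 'b) mfunctor \<Rightarrow> bool" where
  "zero_functor A F \<longleftrightarrow> (\<forall>M\<in>fgmod A. zero_module (obj F M))"

definition faithful_functor :: "('a, 'x) ring_scheme \<Rightarrow> ('a, 'b) mfunctor \<Rightarrow> bool" where
  "faithful_functor A F \<longleftrightarrow> (\<forall>M\<in>fgmod A. \<forall>N\<in>fgmod A. inj_on (arr F M N) (mhom A M N))"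

definition exact_functor ::
  "('a, 'x) ring_scheme \<Rightarrow> ('b, 'y) ring_scheme \<Rightarrow> ('a, 'b) mfunctor \<Rightarrow> bool" where
  "exact_functor A B F \<longleftrightarrow>
     (\<forall>U\<in>fgmod A. \<forall>X\<in>fgmod A. \<forall>V\<in>fgmod A. \<forall>f g. short_exact A U f X g V \<longrightarrow>
        short_exact B (obj F U) (arr F U X f) (obj F X) (arr F X V g) (obj F V))"

definition preserves_projectives ::
  "('a, 'x) ring_scheme \<Rightarrow> ('b, 'y) ring_scheme \<Rightarrow> ('a, 'b) mfunctor \<Rightarrow> bool" where
  "preserves_projectives A B F \<longleftrightarrow> (\<forall>P. projective A P \<longrightarrow> projective B (obj F P))"

definition nat_transf ::
  "('a, 'x) ring_scheme \<Rightarrow> ('b, 'y) ring_scheme \<Rightarrow> ('a, 'b) mfunctor \<Rightarrow> ('a, 'b) mfunctor \<Rightarrow>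
    ('a lmod \<Rightarrow> 'b list \<Rightarrow> 'b list) \<Rightarrow> bool" where
  "nat_transf A B F G \<tau> \<longleftrightarrow>
     (\<forall>M\<in>fgmod A. \<tau> M \<in> mhom B (obj F M) (obj G M)) \<and>
     (\<forall>M\<in>fgmod A. \<forall>N\<in>fgmod A. \<forall>f\<in>mhom A M N.
        compose (carrier (obj F M)) (\<tau> N) (arr F M N f) =
        compose (carrier (obj F M)) (arr G M N f) (\<tau> M))"

definition nat_isomorphic ::
  "('a, 'x) ring_scheme \<Rightarrow> ('b, 'y) ring_scheme \<Rightarrow> ('a, 'b) mfunctor \<Rightarrow> ('a, 'b) mfunctor \<Rightarrow> bool"
  where
  "nat_isomorphic A B F G \<longleftrightarrow>
     (\<exists>\<tau>. nat_transf A B F G \<tau> \<and> (\<forall>M\<in>fgmod A. bij_betw (\<tau> M) (carrier (obj F M)) (carrier (obj G M))))"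

text \<open>\<open>L\<close> from \<open>A\<close>-modules to \<open>B\<close>-modules is left adjoint to \<open>E\<close>, with unit \<open>\<eta>\<close> and counit \<open>\<mu>\<close>.\<close>

definition adjoint_pair ::
  "('a, 'x) ring_scheme \<Rightarrow> ('b, 'y) ring_scheme \<Rightarrow> ('a, 'b) mfunctor \<Rightarrow> ('b, 'a) mfunctor \<Rightarrow>
    ('a lmod \<Rightarrow> 'a list \<Rightarrow> 'a list) \<Rightarrow> ('b lmod \<Rightarrow> 'b list \<Rightarrow> 'b list) \<Rightarrow> bool" where
  "adjoint_pair A B L E \<eta> \<mu> \<longleftrightarrow>
     nat_transf A A id_functor (comp_functor E L) \<eta> \<and>
     nat_transf B B (comp_functor L E) id_functor \<mu> \<and>
     (\<forall>N\<in>fgmod A. compose (carrier (obj L N)) (\<mu> (obj L N)) (arr L N (obj E (obj L N)) (\<eta> N)) =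
        mid (obj L N)) \<and>
     (\<forall>X\<in>fgmod B. compose (carrier (obj E X)) (arr E (obj L (obj E X)) X (\<mu> X)) (\<eta> (obj E X)) =
        mid (obj E X))"


section \<open>Cleft extensions\<close>

text \<open>
  The adjunction data \<open>\<eta>\<close>, \<open>\<mu>\<close> are part of the parameters, because the endofunctor induced by a
  cleft extension refers to the counit \<open>\<mu>\<close>.
\<close>

definition cleft_extension ::
  "('s, 'x) ring_scheme \<Rightarrow> ('r, 'y) ring_scheme \<Rightarrow> ('s, 'r) mfunctor \<Rightarrow> ('r, 's) mfunctor \<Rightarrow>
    ('s, 'r) mfunctor \<Rightarrow> ('s lmod \<Rightarrow> 's list \<Rightarrow> 's list) \<Rightarrow> ('r lmod \<Rightarrow> 'r list \<Rightarrow> 'r list) \<Rightarrow> bool" where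
  "cleft_extension S R i e l \<eta> \<mu> \<longleftrightarrow>
     is_functor S R i \<and> is_functor R S e \<and> is_functor S R l \<and>
     faithful_functor R e \<and> exact_functor R S e \<and>
     adjoint_pair S R l e \<eta> \<mu> \<and>
     nat_isomorphic S S (comp_functor e i) id_functor"

definition counit_kernel ::
  "('r, 's) mfunctor \<Rightarrow> ('s, 'r) mfunctor \<Rightarrow> ('r lmod \<Rightarrow> 'r list \<Rightarrow> 'r list) \<Rightarrow> ('r, 'r) mfunctor" where
  "counit_kernel e l \<mu> =
     (let G = (\<lambda>X. mker (obj l (obj e X)) X (\<mu> X))
      in \<lparr>obj = G, arr = (\<lambda>X Y f. restrict (arr (comp_functor l e) X Y f) (carrier (G X)))\<rparr>)"

definition induced_endofunctor ::
  "('s, 'r) mfunctor \<Rightarrow> ('r, 's) mfunctor \<Rightarrow> ('s, 'r) mfunctor \<Rightarrow> ('r lmod \<Rightarrow> 'r list \<Rightarrow> 'r list) \<Rightarrow>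
    ('s, 's) mfunctor" where
  "induced_endofunctor i e l \<mu> = comp_functor e (comp_functor (counit_kernel e l \<mu>) i)"

end

theory Submission
  imports Defs
begin

text \<open>
  Write \<open>[N]\<^sub>n\<close> for the \<open>n\<close>-th layer of extensions of \<open>N\<close>. Two facts about layers carry both
  inequalities: an exact functor \<open>E\<close> sends \<open>[N]\<^sub>n\<close> into \<open>[E N]\<^sub>n\<close> (\<open>obj_ext_layer\<close>), and an extension
  of a module in \<open>[N]\<^sub>b\<close> by one in \<open>[N]\<^sub>a\<close> lies in \<open>[N]\<close> with index \<open>a + b\<close> (\<open>ext_layer_add\<close>). Moreover
  \<open>e\<close> and \<open>l\<close> are exact and preserve projectives (for \<open>l\<close>, because its right adjoint \<open>e\<close> is exact),
  hence they preserve \<open>j\<close>-th syzygies.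

  The first inequality follows because every \<open>S\<close>-module \<open>X\<close> is a direct summand of \<open>e (l X)\<close>: after
  replacing \<open>X\<close> by \<open>e (i X)\<close>, the unit of the adjunction splits \<open>e\<close> applied to the counit.

  For the second inequality let \<open>X\<close> be a \<open>j\<close>-th syzygy over \<open>R\<close>, and let \<open>G X\<close> be the kernel of the
  counit \<open>l (e X) \<rightarrow> X\<close>. Both \<open>e X\<close> and \<open>e (G X)\<close> lie in the additive closure of the \<open>j\<close>-th syzygies over
  \<open>S\<close>, say in \<open>[N]\<close> with index \<open>d + 1\<close>, and \<open>e (G X)\<close> is isomorphic to \<open>F (e X)\<close>, so that iterating \<open>G\<close>
  ends at \<open>0\<close> after \<open>n\<close> steps. The sequence \<open>0 \<rightarrow> G X \<rightarrow> l (e X) \<rightarrow> X \<rightarrow> 0\<close> presents \<open>X\<close> as a quotient,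
  whereas layers are about extensions, and the kernel has to be moved to the other side. This is done by
  coinduction. The functor \<open>e\<close> has the right adjoint \<open>Hom (e R, -)\<close>, where \<open>R\<close> acts by right multiplication
  on \<open>e R\<close>. Put \<open>T A = Hom (e R, e A)\<close>. The canonical map \<open>\<nu> : A \<rightarrow> T A\<close> is injective as \<open>e\<close> is faithful, and
  \<open>T\<close> is exact as \<open>e R\<close> is projective; hence the cokernel \<open>H A\<close> of \<open>\<nu>\<close> is an exact functor of \<open>A\<close>. The
  sequence above splits after applying \<open>e\<close>, so \<open>\<nu> : G X \<rightarrow> T (G X)\<close> extends to \<open>l (e X)\<close>, and pushing out
  gives an exact sequence \<open>0 \<rightarrow> l (e X) \<rightarrow> X \<oplus> T (G X) \<rightarrow> H (G X) \<rightarrow> 0\<close> (\<open>shift_exact\<close>). By induction \<open>G X\<close>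
  has \<open>(n - 1) (d + 1)\<close> layers, the exact functor \<open>H\<close> keeps their number, and \<open>l (e X)\<close> contributes \<open>d + 1\<close>
  more. So \<open>X\<close> has \<open>n (d + 1)\<close> layers of a module that depends on \<open>n\<close> and \<open>N\<close> only (\<open>layer_bound\<close>).

  What remains is finiteness. Artinian commutative rings are noetherian (\<open>artinian_imp_noetherian\<close>), so
  submodules of finitely generated modules over an Artin algebra are finitely generated. The module
  \<open>T A\<close> is finitely generated as well (\<open>T_fg\<close>). This uses the nilpotency of \<open>F\<close>: as \<open>e\<close> need not be
  \<open>k\<close>-linear, \<open>k\<close> may act on \<open>e X\<close> in two different ways, through \<open>R\<close> and through \<open>S\<close>. On modules
  of the form \<open>e (i Y)\<close> the first action can be shifted from the source to the target of a homomorphism,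
  and nilpotency reduces the general case to such modules.
\<close>


section \<open>Submodules, homomorphisms and quotients\<close>

lemma (in abelian_group) minus_eq_zero_iff:
  assumes "x \<in> carrier G" "y \<in> carrier G" shows "x \<ominus> y = \<zero> \<longleftrightarrow> x = y"
  using assms by (metis a_inv_closed minus_eq minus_equality minus_minus r_neg)

lemma (in abelian_group) add_self_eq_self:
  assumes "x \<in> carrier G" "x \<oplus> x = x" shows "x = \<zero>"
  using assms r_neg1[of x x] l_neg[of x] by simp

lemma (in abelian_group) minus_add_cancel [simp]:
  assumes "x \<in> carrier G" "y \<in> carrier G" shows "x \<ominus> y \<oplus> y = x"
  using assms by (simp add: minus_eq a_assoc l_neg)

lemma (in abelian_group) add_minus_cancel [simp]:
  assumes "x \<in> carrier G" "y \<in> carrier G" shows "x \<oplus> y \<ominus> y = x"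
  using assms by (simp add: minus_eq a_assoc r_neg)

lemma (in abelian_group) minus_zero_right [simp]:
  assumes "x \<in> carrier G" shows "x \<ominus> \<zero> = x"
  using assms add_minus_cancel[of x \<zero>] by simp

lemma (in abelian_group) minus_self [simp]:
  assumes "x \<in> carrier G" shows "x \<ominus> x = \<zero>"
  using assms by (simp add: minus_eq r_neg)

context left_module
begin

lemma smult_zero_left [simp]:
  assumes "x \<in> carrier M" shows "\<zero>\<^bsub>R\<^esub> \<odot>\<^bsub>M\<^esub> x = \<zero>\<^bsub>M\<^esub>"
proof -
  have "\<zero>\<^bsub>R\<^esub> \<odot>\<^bsub>M\<^esub> x \<oplus>\<^bsub>M\<^esub> \<zero>\<^bsub>R\<^esub> \<odot>\<^bsub>M\<^esub> x = \<zero>\<^bsub>R\<^esub> \<odot>\<^bsub>M\<^esub> x"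
    using smult_l_distr[of "\<zero>\<^bsub>R\<^esub>" "\<zero>\<^bsub>R\<^esub>" x] assms by (simp add: smult_closed)
  then show ?thesis
    using assms by (intro M.add_self_eq_self) (auto simp: smult_closed)
qed

lemma smult_zero_right [simp]:
  assumes "a \<in> carrier R" shows "a \<odot>\<^bsub>M\<^esub> \<zero>\<^bsub>M\<^esub> = \<zero>\<^bsub>M\<^esub>"
proof -
  have "a \<odot>\<^bsub>M\<^esub> \<zero>\<^bsub>M\<^esub> \<oplus>\<^bsub>M\<^esub> a \<odot>\<^bsub>M\<^esub> \<zero>\<^bsub>M\<^esub> = a \<odot>\<^bsub>M\<^esub> \<zero>\<^bsub>M\<^esub>"
    using smult_r_distr[of a "\<zero>\<^bsub>M\<^esub>" "\<zero>\<^bsub>M\<^esub>"] assms by (simp add: smult_closed)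
  then show ?thesis
    using assms by (intro M.add_self_eq_self) (auto simp: smult_closed)
qed

lemma smult_minus_one:
  assumes "x \<in> carrier M" shows "(\<ominus>\<^bsub>R\<^esub> \<one>\<^bsub>R\<^esub>) \<odot>\<^bsub>M\<^esub> x = \<ominus>\<^bsub>M\<^esub> x"
proof -
  have "(\<ominus>\<^bsub>R\<^esub> \<one>\<^bsub>R\<^esub>) \<odot>\<^bsub>M\<^esub> x \<oplus>\<^bsub>M\<^esub> x = (\<ominus>\<^bsub>R\<^esub> \<one>\<^bsub>R\<^esub> \<oplus>\<^bsub>R\<^esub> \<one>\<^bsub>R\<^esub>) \<odot>\<^bsub>M\<^esub> x"
    using assms by (simp add: smult_l_distr smult_one)
  also have "\<dots> = \<zero>\<^bsub>M\<^esub>" using assms by (simp add: R.l_neg)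
  finally show ?thesis
    using assms M.minus_equality[of "(\<ominus>\<^bsub>R\<^esub> \<one>\<^bsub>R\<^esub>) \<odot>\<^bsub>M\<^esub> x" x] by (simp add: smult_closed)
qed

end

definition msub :: "('a, 'x) ring_scheme \<Rightarrow> ('a, 'm) module \<Rightarrow> 'm set \<Rightarrow> bool" where
  "msub A M N \<longleftrightarrow> N \<subseteq> carrier M \<and> \<zero>\<^bsub>M\<^esub> \<in> N \<and> (\<forall>x\<in>N. \<forall>y\<in>N. x \<oplus>\<^bsub>M\<^esub> y \<in> N) \<and>
     (\<forall>a\<in>carrier A. \<forall>x\<in>N. a \<odot>\<^bsub>M\<^esub> x \<in> N)"

definition mspan :: "('a, 'x) ring_scheme \<Rightarrow> ('a, 'm) module \<Rightarrow> 'm set \<Rightarrow> 'm set" where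
  "mspan A M B = \<Inter>{N. msub A M N \<and> B \<subseteq> N}"

text \<open>The record type carries no subobject relation, so a submodule is the same record with a
  smaller carrier; this is the form in which kernels and images occur.\<close>

abbreviation submod :: "('a, 'm) module \<Rightarrow> 'm set \<Rightarrow> ('a, 'm) module" where
  "submod M N \<equiv> M\<lparr>carrier := N\<rparr>"

lemma msubD:
  assumes "msub A M N"
  shows "N \<subseteq> carrier M" "\<zero>\<^bsub>M\<^esub> \<in> N" "\<And>x y. x \<in> N \<Longrightarrow> y \<in> N \<Longrightarrow> x \<oplus>\<^bsub>M\<^esub> y \<in> N"
    "\<And>a x. a \<in> carrier A \<Longrightarrow> x \<in> N \<Longrightarrow> a \<odot>\<^bsub>M\<^esub> x \<in> N" "\<And>x. x \<in> N \<Longrightarrow> x \<in> carrier M"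
  using assms by (auto simp: msub_def)

lemma msub_neg:
  assumes "left_module A M" "msub A M N" "x \<in> N" shows "\<ominus>\<^bsub>M\<^esub> x \<in> N"
proof -
  interpret left_module A M by fact
  show ?thesis using smult_minus_one[of x] msubD[OF assms(2)] assms(3)
    by (metis R.add.inv_closed R.one_closed)
qed

lemma msub_minus:
  assumes "left_module A M" "msub A M N" "x \<in> N" "y \<in> N" shows "x \<ominus>\<^bsub>M\<^esub> y \<in> N"
  using assms msub_neg[OF assms(1,2)] by (simp add: a_minus_def msubD)

lemma left_module_submod:
  assumes M: "left_module A M" and N: "msub A M N"
  shows "left_module A (submod M N)"
proof -
  interpret left_module A M by fact
  note d = msubD[OF N]
  have "abelian_group (submod M N)"
  proof (rule abelian_groupI)
    fix x assume "x \<in> carrier (submod M N)"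
    then show "\<exists>y\<in>carrier (submod M N). y \<oplus>\<^bsub>submod M N\<^esub> x = \<zero>\<^bsub>submod M N\<^esub>"
      by (intro bexI[of _ "\<ominus>\<^bsub>M\<^esub> x"]) (use d msub_neg[OF M N] in \<open>auto simp: M.l_neg\<close>)
  qed (use d in \<open>auto intro: M.a_assoc M.a_comm\<close>)
  then show ?thesis
    by (intro left_module.intro left_module_axioms.intro R.ring_axioms)
       (use d in \<open>auto simp: smult_l_distr smult_r_distr smult_assoc1 smult_one\<close>)
qed

lemma msub_submod_iff:
  assumes "msub A M N"
  shows "msub A (submod M N) L \<longleftrightarrow> msub A M L \<and> L \<subseteq> N"
  using assms by (auto simp: msub_def)

lemma msub_carrier: "left_module A M \<Longrightarrow> msub A M (carrier M)"
proof -
  assume "left_module A M"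
  then interpret left_module A M .
  show ?thesis by (auto simp: msub_def smult_closed)
qed

lemma msub_Int: "msub A M N \<Longrightarrow> msub A M L \<Longrightarrow> msub A M (N \<inter> L)"
  by (auto simp: msub_def)

lemma mspan_superset: "B \<subseteq> mspan A M B"
  by (auto simp: mspan_def)

lemma mspan_least: "msub A M N \<Longrightarrow> B \<subseteq> N \<Longrightarrow> mspan A M B \<subseteq> N"
  by (auto simp: mspan_def)

lemma mspan_mono: "B \<subseteq> C \<Longrightarrow> mspan A M B \<subseteq> mspan A M C"
  by (auto simp: mspan_def)

lemma msub_mspan:
  assumes "left_module A M" "B \<subseteq> carrier M" shows "msub A M (mspan A M B)"
proof -
  have "mspan A M B \<subseteq> carrier M" using assms by (intro mspan_least msub_carrier)
  then show ?thesis by (auto simp: mspan_def msub_def)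
qed

lemma mspan_submod:
  assumes "left_module A M" "msub A M N" "B \<subseteq> N"
  shows "mspan A (submod M N) B = mspan A M B"
proof
  have B: "B \<subseteq> carrier M" using assms msubD by blast
  show "mspan A (submod M N) B \<subseteq> mspan A M B"
    using mspan_least[OF assms(2,3)] msub_mspan[OF assms(1) B] assms(3)
    by (intro mspan_least) (auto simp: msub_submod_iff[OF assms(2)] mspan_superset)
  show "mspan A M B \<subseteq> mspan A (submod M N) B"
    using msub_mspan[OF left_module_submod[OF assms(1,2)], of B] assms(3)
    by (intro mspan_least) (auto simp: msub_submod_iff[OF assms(2)] mspan_superset)
qed

text \<open>The submodules of linear combinations and the intersections of submodules agree. The latter make
  spans easy to handle, so finite generation is used in this form from here on.\<close>

lemma fin_gen_iff_mspan:
  assumes "left_module A M"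
  shows "fin_gen A M \<longleftrightarrow> (\<exists>B. finite B \<and> B \<subseteq> carrier M \<and> mspan A M B = carrier M)"
proof -
  interpret left_module A M by fact
  have sums: "{(\<Oplus>\<^bsub>M\<^esub>b\<in>B. a b \<odot>\<^bsub>M\<^esub> b) | a. a \<in> B \<rightarrow> carrier A} = mspan A M B" (is "?L = _")
    if B: "finite B" "B \<subseteq> carrier M" for B
  proof
    have cl: "(\<lambda>b. a b \<odot>\<^bsub>M\<^esub> b) \<in> C \<rightarrow> carrier M" if "a \<in> B \<rightarrow> carrier A" "C \<subseteq> B" for a C
      using that B by (auto intro!: smult_closed)
    show "?L \<subseteq> mspan A M B"
    proof clarify
      fix a assume a: "a \<in> B \<rightarrow> carrier A"
      have "C \<subseteq> B \<Longrightarrow> (\<Oplus>\<^bsub>M\<^esub>b\<in>C. a b \<odot>\<^bsub>M\<^esub> b) \<in> mspan A M B" if "finite C" for C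
        using that
      proof (induction C rule: finite_induct)
        case empty
        then show ?case using msubD[OF msub_mspan[OF assms B(2)]] by simp
      next
        case (insert x F)
        have "(\<Oplus>\<^bsub>M\<^esub>b\<in>insert x F. a b \<odot>\<^bsub>M\<^esub> b) = a x \<odot>\<^bsub>M\<^esub> x \<oplus>\<^bsub>M\<^esub> (\<Oplus>\<^bsub>M\<^esub>b\<in>F. a b \<odot>\<^bsub>M\<^esub> b)"
          using insert cl[OF a, of "insert x F"] by (intro M.finsum_insert) auto
        moreover have "a x \<odot>\<^bsub>M\<^esub> x \<in> mspan A M B"
          using insert a mspan_superset[of B A M] msubD(4)[OF msub_mspan[OF assms B(2)]] by blast
        ultimately show ?case using insert msubD(3)[OF msub_mspan[OF assms B(2)]] by auto
      qed
      from this[OF B(1)] show "(\<Oplus>\<^bsub>M\<^esub>b\<in>B. a b \<odot>\<^bsub>M\<^esub> b) \<in> mspan A M B" by simp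
    qed
    have "msub A M ?L"
      unfolding msub_def
    proof (intro conjI ballI)
      show "?L \<subseteq> carrier M" using cl by (auto intro!: M.finsum_closed)
      have "(\<Oplus>\<^bsub>M\<^esub>b\<in>B. \<zero>\<^bsub>A\<^esub> \<odot>\<^bsub>M\<^esub> b) = (\<Oplus>\<^bsub>M\<^esub>b\<in>B. \<zero>\<^bsub>M\<^esub>)"
        using B by (intro M.finsum_cong') auto
      then show "\<zero>\<^bsub>M\<^esub> \<in> ?L" by (auto intro!: exI[of _ "\<lambda>b. \<zero>\<^bsub>A\<^esub>"])
    next
      fix x y assume "x \<in> ?L" "y \<in> ?L"
      then obtain a c where a: "a \<in> B \<rightarrow> carrier A" "x = (\<Oplus>\<^bsub>M\<^esub>b\<in>B. a b \<odot>\<^bsub>M\<^esub> b)"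
        and c: "c \<in> B \<rightarrow> carrier A" "y = (\<Oplus>\<^bsub>M\<^esub>b\<in>B. c b \<odot>\<^bsub>M\<^esub> b)" by blast
      have "x \<oplus>\<^bsub>M\<^esub> y = (\<Oplus>\<^bsub>M\<^esub>b\<in>B. a b \<odot>\<^bsub>M\<^esub> b \<oplus>\<^bsub>M\<^esub> c b \<odot>\<^bsub>M\<^esub> b)"
        using cl[OF a(1)] cl[OF c(1)] by (simp add: a c M.finsum_addf)
      also have "\<dots> = (\<Oplus>\<^bsub>M\<^esub>b\<in>B. (a b \<oplus>\<^bsub>A\<^esub> c b) \<odot>\<^bsub>M\<^esub> b)"
        using a c B by (intro M.finsum_cong') (auto simp: smult_l_distr Pi_iff subset_iff smult_closed)
      finally show "x \<oplus>\<^bsub>M\<^esub> y \<in> ?L"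
        using a c by (auto intro!: exI[of _ "\<lambda>b. a b \<oplus>\<^bsub>A\<^esub> c b"] simp: Pi_iff)
    next
      fix r x assume r: "r \<in> carrier A" and "x \<in> ?L"
      then obtain a where a: "a \<in> B \<rightarrow> carrier A" "x = (\<Oplus>\<^bsub>M\<^esub>b\<in>B. a b \<odot>\<^bsub>M\<^esub> b)" by blast
      have "C \<subseteq> B \<Longrightarrow> r \<odot>\<^bsub>M\<^esub> (\<Oplus>\<^bsub>M\<^esub>b\<in>C. a b \<odot>\<^bsub>M\<^esub> b) = (\<Oplus>\<^bsub>M\<^esub>b\<in>C. (r \<otimes>\<^bsub>A\<^esub> a b) \<odot>\<^bsub>M\<^esub> b)"
        if "finite C" for C using that
      proof (induction C rule: finite_induct)
        case (insert x F)
        have ra: "(\<lambda>b. r \<otimes>\<^bsub>A\<^esub> a b) \<in> B \<rightarrow> carrier A" using a r by auto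
        have cx: "a x \<odot>\<^bsub>M\<^esub> x \<in> carrier M" "(\<Oplus>\<^bsub>M\<^esub>b\<in>F. a b \<odot>\<^bsub>M\<^esub> b) \<in> carrier M"
          using insert cl[OF a(1), of F] a B by (auto intro!: M.finsum_closed smult_closed)
        show ?case using insert cl[OF a(1), of "insert x F"] cl[OF ra, of "insert x F"] r a B cx
          by (auto simp: M.finsum_insert smult_r_distr smult_assoc1 Pi_iff subset_iff)
      qed (use r in simp)
      from this[OF B(1)] show "r \<odot>\<^bsub>M\<^esub> x \<in> ?L"
        using a r by (auto intro!: exI[of _ "\<lambda>b. r \<otimes>\<^bsub>A\<^esub> a b"])
    qed
    moreover have "B \<subseteq> ?L"
    proof
      fix x assume x: "x \<in> B"
      let ?a = "\<lambda>b. if b = x then \<one>\<^bsub>A\<^esub> else \<zero>\<^bsub>A\<^esub>"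
      have "(\<Oplus>\<^bsub>M\<^esub>b\<in>B. ?a b \<odot>\<^bsub>M\<^esub> b) = (\<Oplus>\<^bsub>M\<^esub>b\<in>B. if x = b then (\<lambda>b. b) b else \<zero>\<^bsub>M\<^esub>)"
        using B by (intro M.finsum_cong') (auto simp: smult_one)
      also have "\<dots> = x" using B x by (intro M.finsum_singleton) auto
      finally show "x \<in> ?L" by (intro CollectI exI[of _ ?a]) auto
    qed
    ultimately show "mspan A M B \<subseteq> ?L" by (rule mspan_least)
  qed
  have eq: "(\<forall>x\<in>carrier M. \<exists>a\<in>B \<rightarrow> carrier A. x = (\<Oplus>\<^bsub>M\<^esub>b\<in>B. a b \<odot>\<^bsub>M\<^esub> b)) \<longleftrightarrow>
      mspan A M B = carrier M" if B: "finite B" "B \<subseteq> carrier M" for B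
  proof -
    have "mspan A M B \<subseteq> carrier M" using B msubD(1)[OF msub_mspan[OF assms]] by blast
    then show ?thesis using sums[OF B] by blast
  qed
  show ?thesis unfolding fin_gen_def by (intro ex_cong1 conj_cong refl eq)
qed

lemma mhomD:
  assumes "f \<in> mhom A M N"
  shows "\<And>x. x \<in> carrier M \<Longrightarrow> f x \<in> carrier N"
    "\<And>x y. x \<in> carrier M \<Longrightarrow> y \<in> carrier M \<Longrightarrow> f (x \<oplus>\<^bsub>M\<^esub> y) = f x \<oplus>\<^bsub>N\<^esub> f y"
    "\<And>a x. a \<in> carrier A \<Longrightarrow> x \<in> carrier M \<Longrightarrow> f (a \<odot>\<^bsub>M\<^esub> x) = a \<odot>\<^bsub>N\<^esub> f x"
    "f \<in> extensional (carrier M)"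
  using assms by (auto simp: mhom_def PiE_def)

lemma mhomI:
  assumes "\<And>x. x \<in> carrier M \<Longrightarrow> f x \<in> carrier N"
    "\<And>x y. x \<in> carrier M \<Longrightarrow> y \<in> carrier M \<Longrightarrow> f (x \<oplus>\<^bsub>M\<^esub> y) = f x \<oplus>\<^bsub>N\<^esub> f y"
    "\<And>a x. a \<in> carrier A \<Longrightarrow> x \<in> carrier M \<Longrightarrow> f (a \<odot>\<^bsub>M\<^esub> x) = a \<odot>\<^bsub>N\<^esub> f x"
    "f \<in> extensional (carrier M)"
  shows "f \<in> mhom A M N"
  using assms by (auto simp: mhom_def PiE_def)

lemma mhom_restrictI:
  assumes "left_module A M" "\<And>x. x \<in> carrier M \<Longrightarrow> f x \<in> carrier N"
    "\<And>x y. x \<in> carrier M \<Longrightarrow> y \<in> carrier M \<Longrightarrow> f (x \<oplus>\<^bsub>M\<^esub> y) = f x \<oplus>\<^bsub>N\<^esub> f y"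
    "\<And>a x. a \<in> carrier A \<Longrightarrow> x \<in> carrier M \<Longrightarrow> f (a \<odot>\<^bsub>M\<^esub> x) = a \<odot>\<^bsub>N\<^esub> f x"
  shows "restrict f (carrier M) \<in> mhom A M N"
proof -
  interpret left_module A M by fact
  show ?thesis by (rule mhomI) (auto simp: assms smult_closed)
qed

lemma mhom_eqI:
  assumes "f \<in> mhom A M N" "g \<in> mhom A M L" "\<And>x. x \<in> carrier M \<Longrightarrow> f x = g x"
  shows "f = g"
  using assms mhomD(4) by (blast intro: extensionalityI)

lemma mhom_zero:
  assumes "left_module A M" "left_module A N" "f \<in> mhom A M N" shows "f \<zero>\<^bsub>M\<^esub> = \<zero>\<^bsub>N\<^esub>"
proof -
  interpret M: left_module A M by fact
  interpret N: left_module A N by fact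
  have "f (\<zero>\<^bsub>A\<^esub> \<odot>\<^bsub>M\<^esub> \<zero>\<^bsub>M\<^esub>) = \<zero>\<^bsub>A\<^esub> \<odot>\<^bsub>N\<^esub> f \<zero>\<^bsub>M\<^esub>"
    by (rule mhomD(3)[OF assms(3)]) auto
  then show ?thesis using mhomD(1)[OF assms(3)] by simp
qed

lemma mhom_neg:
  assumes "left_module A M" "left_module A N" "f \<in> mhom A M N" "x \<in> carrier M"
  shows "f (\<ominus>\<^bsub>M\<^esub> x) = \<ominus>\<^bsub>N\<^esub> f x"
proof -
  interpret M: left_module A M by fact
  interpret N: left_module A N by fact
  show ?thesis
    using mhomD(3)[OF assms(3), of "\<ominus>\<^bsub>A\<^esub> \<one>\<^bsub>A\<^esub>" x] mhomD(1)[OF assms(3)] assms(4)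
    by (simp add: M.smult_minus_one N.smult_minus_one)
qed

lemma mhom_minus:
  assumes "left_module A M" "left_module A N" "f \<in> mhom A M N" "x \<in> carrier M" "y \<in> carrier M"
  shows "f (x \<ominus>\<^bsub>M\<^esub> y) = f x \<ominus>\<^bsub>N\<^esub> f y"
proof -
  interpret M: left_module A M by fact
  show ?thesis using assms by (simp add: a_minus_def mhomD mhom_neg)
qed

lemma mhom_comp:
  assumes "left_module A L" "f \<in> mhom A L M" "g \<in> mhom A M N"
  shows "compose (carrier L) g f \<in> mhom A L N"
  unfolding compose_def
  by (rule mhom_restrictI[OF assms(1)]) (auto simp: mhomD[OF assms(2)] mhomD[OF assms(3)])

lemma mhom_zero_map:
  assumes "left_module A M" "left_module A N"
  shows "(\<lambda>x\<in>carrier M. \<zero>\<^bsub>N\<^esub>) \<in> mhom A M N"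
proof -
  interpret N: left_module A N by fact
  show ?thesis by (rule mhom_restrictI[OF assms(1)]) auto
qed

lemma mid_mhom: "left_module A M \<Longrightarrow> mid M \<in> mhom A M M"
  unfolding mid_def by (rule mhom_restrictI) auto

lemma mid_apply [simp]: "x \<in> carrier M \<Longrightarrow> mid M x = x"
  by (simp add: mid_def)

lemma msub_kernel:
  assumes "left_module A M" "left_module A N" "f \<in> mhom A M N"
  shows "msub A M {x \<in> carrier M. f x = \<zero>\<^bsub>N\<^esub>}"
proof -
  interpret M: left_module A M by fact
  interpret N: left_module A N by fact
  show ?thesis
    using mhom_zero[OF assms] by (auto simp: msub_def M.smult_closed mhomD[OF assms(3)])
qed

lemma msub_vimage:
  assumes "left_module A M" "left_module A N" "f \<in> mhom A M N" "msub A N L"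
  shows "msub A M {x \<in> carrier M. f x \<in> L}"
proof -
  interpret M: left_module A M by fact
  show ?thesis
    using mhom_zero[OF assms(1-3)] msubD[OF assms(4)] 
    by (auto simp: msub_def M.smult_closed mhomD[OF assms(3)])
qed

lemma msub_image:
  assumes "left_module A M" "left_module A N" "f \<in> mhom A M N" "msub A M L"
  shows "msub A N (f ` L)"
  unfolding msub_def
proof (intro conjI ballI)
  note d = msubD[OF assms(4)] note h = mhomD[OF assms(3)]
  show "f ` L \<subseteq> carrier N" using d(1) h(1) by blast
  show "\<zero>\<^bsub>N\<^esub> \<in> f ` L" using mhom_zero[OF assms(1-3)] d(2) by (metis imageI)
  fix x assume "x \<in> f ` L"
  then obtain u where u: "u \<in> L" "x = f u" by blast
  { fix y assume "y \<in> f ` L"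
    then obtain v where v: "v \<in> L" "y = f v" by blast
    have "x \<oplus>\<^bsub>N\<^esub> y = f (u \<oplus>\<^bsub>M\<^esub> v)" using u v d(5) h(2) by simp
    then show "x \<oplus>\<^bsub>N\<^esub> y \<in> f ` L" using u v d(3) by blast }
  { fix a assume a: "a \<in> carrier A"
    have "a \<odot>\<^bsub>N\<^esub> x = f (a \<odot>\<^bsub>M\<^esub> u)" using u a d(5) h(3) by simp
    then show "a \<odot>\<^bsub>N\<^esub> x \<in> f ` L" using u a d(4) by blast }
qed

lemma mhom_inj_iff:
  assumes "left_module A M" "left_module A N" "f \<in> mhom A M N"
  shows "inj_on f (carrier M) \<longleftrightarrow> (\<forall>x\<in>carrier M. f x = \<zero>\<^bsub>N\<^esub> \<longrightarrow> x = \<zero>\<^bsub>M\<^esub>)"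
proof -
  interpret M: left_module A M by fact
  interpret N: left_module A N by fact
  have "x = y" if "\<forall>x\<in>carrier M. f x = \<zero>\<^bsub>N\<^esub> \<longrightarrow> x = \<zero>\<^bsub>M\<^esub>" "x \<in> carrier M" "y \<in> carrier M" "f x = f y" for x y
  proof -
    have "f (x \<ominus>\<^bsub>M\<^esub> y) = \<zero>\<^bsub>N\<^esub>" using mhom_minus[OF assms that(2,3)] that mhomD(1)[OF assms(3)]
      by simp
    then have "x \<ominus>\<^bsub>M\<^esub> y = \<zero>\<^bsub>M\<^esub>" using that by simp
    then show ?thesis using that(2,3) by (simp add: M.M.minus_eq_zero_iff)
  qed
  moreover have "x = \<zero>\<^bsub>M\<^esub>" if "inj_on f (carrier M)" "x \<in> carrier M" "f x = \<zero>\<^bsub>N\<^esub>" for x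
    using inj_onD[OF that(1), of x "\<zero>\<^bsub>M\<^esub>"] that mhom_zero[OF assms] by simp
  ultimately show ?thesis by (meson inj_onI)
qed

lemma mhom_span_subset:
  assumes "left_module A M" "left_module A N" "f \<in> mhom A M N" "B \<subseteq> carrier M"
  shows "f ` mspan A M B = mspan A N (f ` B)"
proof
  have fB: "f ` B \<subseteq> carrier N" using assms mhomD(1)[OF assms(3)] by blast
  show "mspan A N (f ` B) \<subseteq> f ` mspan A M B"
    by (intro mspan_least msub_image[OF assms(1-3)] msub_mspan[OF assms(1,4)] image_mono mspan_superset)
  have "mspan A M B \<subseteq> {x \<in> carrier M. f x \<in> mspan A N (f ` B)}"
    using assms mspan_superset[of "f ` B" A N]
    by (intro mspan_least msub_vimage[OF assms(1-3)] msub_mspan[OF assms(2) fB]) auto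
  then show "f ` mspan A M B \<subseteq> mspan A N (f ` B)" by blast
qed

lemma mhom_zero_on_generators:
  assumes "left_module A M" "left_module A N" "f \<in> mhom A M N" "B \<subseteq> carrier M"
    "\<And>b. b \<in> B \<Longrightarrow> f b = \<zero>\<^bsub>N\<^esub>" "x \<in> mspan A M B"
  shows "f x = \<zero>\<^bsub>N\<^esub>"
proof -
  have "mspan A M B \<subseteq> {x \<in> carrier M. f x = \<zero>\<^bsub>N\<^esub>}"
    using assms by (intro mspan_least msub_kernel) auto
  then show ?thesis using assms by blast
qed

lemma fgmod_lm: "M \<in> fgmod A \<Longrightarrow> left_module A M"
  by (simp add: fgmod_def)

lemma fgmod_mspan: "M \<in> fgmod A \<longleftrightarrow> left_module A M \<and> (\<exists>B. finite B \<and> B \<subseteq> carrier M \<and> mspan A M B = carrier M)"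
  unfolding fgmod_def using fin_gen_iff_mspan by blast

lemma fgmod_submod_iff:
  assumes "left_module A M" "msub A M N"
  shows "submod M N \<in> fgmod A \<longleftrightarrow> (\<exists>B. finite B \<and> B \<subseteq> N \<and> mspan A M B = N)"
proof -
  have "mspan A (submod M N) B = mspan A M B" if "B \<subseteq> N" for B
    by (rule mspan_submod[OF assms that])
  then show ?thesis
    unfolding fgmod_mspan using left_module_submod[OF assms] by (simp cong: conj_cong)
qed

lemma fgmod_image:
  assumes "M \<in> fgmod A" "left_module A N" "f \<in> mhom A M N" "f ` carrier M = carrier N"
  shows "N \<in> fgmod A"
proof -
  obtain B where B: "finite B" "B \<subseteq> carrier M" "mspan A M B = carrier M"
    using assms(1) by (auto simp: fgmod_mspan)
  have "mspan A N (f ` B) = carrier N"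
    using mhom_span_subset[OF fgmod_lm[OF assms(1)] assms(2,3) B(2)] B assms by simp
  then show ?thesis using B assms unfolding fgmod_mspan
    using mhomD(1)[OF assms(3)] by (intro conjI exI[of _ "f ` B"]) auto
qed

lemma list_representative:
  fixes M :: "('a, 'm) module"
  assumes "M \<in> fgmod A"
  obtains N :: "'a lmod" and f where "N \<in> fgmod A" "f \<in> mhom A M N" "bij_betw f (carrier M) (carrier N)"
  using fgmod_list_representative[OF assms] unfolding miso_def by blast

lemma left_module_image:
  assumes M: "left_module A M" and im: "p ` carrier M = carrier N"
    and add: "\<And>x y. x \<in> carrier M \<Longrightarrow> y \<in> carrier M \<Longrightarrow> p (x \<oplus>\<^bsub>M\<^esub> y) = p x \<oplus>\<^bsub>N\<^esub> p y"
    and smult: "\<And>a x. a \<in> carrier A \<Longrightarrow> x \<in> carrier M \<Longrightarrow> p (a \<odot>\<^bsub>M\<^esub> x) = a \<odot>\<^bsub>N\<^esub> p x"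
    and zero: "p \<zero>\<^bsub>M\<^esub> = \<zero>\<^bsub>N\<^esub>"
  shows "left_module A N"
proof -
  interpret M: left_module A M by fact
  have ex: "\<exists>u\<in>carrier M. x = p u" if "x \<in> carrier N" for x using that im by blast
  have cl: "p u \<in> carrier N" if "u \<in> carrier M" for u using that im by blast
  note r = add[symmetric] smult[symmetric] zero[symmetric]
  have "abelian_group N"
  proof (rule abelian_groupI)
    fix x y assume "x \<in> carrier N" "y \<in> carrier N"
    then obtain u v where u: "u \<in> carrier M" "x = p u" and v: "v \<in> carrier M" "y = p v" using ex by blast
    show "x \<oplus>\<^bsub>N\<^esub> y \<in> carrier N" using u v cl[of "u \<oplus>\<^bsub>M\<^esub> v"] add by simp
    show "x \<oplus>\<^bsub>N\<^esub> y = y \<oplus>\<^bsub>N\<^esub> x" using u v M.M.a_comm[of u v] r by simp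
    fix z assume "z \<in> carrier N"
    then obtain w where w: "w \<in> carrier M" "z = p w" using ex by blast
    show "x \<oplus>\<^bsub>N\<^esub> y \<oplus>\<^bsub>N\<^esub> z = x \<oplus>\<^bsub>N\<^esub> (y \<oplus>\<^bsub>N\<^esub> z)" using u v w M.M.a_assoc[of u v w] r by simp
  next
    fix x assume "x \<in> carrier N"
    then obtain u where u: "u \<in> carrier M" "x = p u" using ex by blast
    show "\<zero>\<^bsub>N\<^esub> \<oplus>\<^bsub>N\<^esub> x = x" using u add[of "\<zero>\<^bsub>M\<^esub>" u] zero by simp
    have "p (\<ominus>\<^bsub>M\<^esub> u) \<oplus>\<^bsub>N\<^esub> x = \<zero>\<^bsub>N\<^esub>" using u add[of "\<ominus>\<^bsub>M\<^esub> u" u] zero by (simp add: M.M.l_neg)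
    then show "\<exists>y\<in>carrier N. y \<oplus>\<^bsub>N\<^esub> x = \<zero>\<^bsub>N\<^esub>" using cl[of "\<ominus>\<^bsub>M\<^esub> u"] u by blast
  next
    show "\<zero>\<^bsub>N\<^esub> \<in> carrier N" using cl[of "\<zero>\<^bsub>M\<^esub>"] zero by simp
  qed
  moreover have "left_module_axioms A N"
  proof (rule left_module_axioms.intro)
    fix a x assume a: "a \<in> carrier A" and "x \<in> carrier N"
    then obtain u where u: "u \<in> carrier M" "x = p u" using ex by blast
    show "a \<odot>\<^bsub>N\<^esub> x \<in> carrier N" using u a cl[of "a \<odot>\<^bsub>M\<^esub> u"] smult by (simp add: M.smult_closed)
    fix b assume b: "b \<in> carrier A"
    have "p ((a \<oplus>\<^bsub>A\<^esub> b) \<odot>\<^bsub>M\<^esub> u) = p (a \<odot>\<^bsub>M\<^esub> u \<oplus>\<^bsub>M\<^esub> b \<odot>\<^bsub>M\<^esub> u)" using a b u by (simp add: M.smult_l_distr)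
    then show "(a \<oplus>\<^bsub>A\<^esub> b) \<odot>\<^bsub>N\<^esub> x = a \<odot>\<^bsub>N\<^esub> x \<oplus>\<^bsub>N\<^esub> b \<odot>\<^bsub>N\<^esub> x"
      using a b u by (simp add: smult add M.smult_closed)
    have "p ((a \<otimes>\<^bsub>A\<^esub> b) \<odot>\<^bsub>M\<^esub> u) = p (a \<odot>\<^bsub>M\<^esub> (b \<odot>\<^bsub>M\<^esub> u))" using a b u by (simp add: M.smult_assoc1)
    then show "(a \<otimes>\<^bsub>A\<^esub> b) \<odot>\<^bsub>N\<^esub> x = a \<odot>\<^bsub>N\<^esub> (b \<odot>\<^bsub>N\<^esub> x)"
      using a b u by (simp add: smult M.smult_closed)
  next
    fix a x y assume a: "a \<in> carrier A" and "x \<in> carrier N" "y \<in> carrier N"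
    then obtain u v where u: "u \<in> carrier M" "x = p u" and v: "v \<in> carrier M" "y = p v" using ex by blast
    have "p (a \<odot>\<^bsub>M\<^esub> (u \<oplus>\<^bsub>M\<^esub> v)) = p (a \<odot>\<^bsub>M\<^esub> u \<oplus>\<^bsub>M\<^esub> a \<odot>\<^bsub>M\<^esub> v)" using a u v by (simp add: M.smult_r_distr)
    then show "a \<odot>\<^bsub>N\<^esub> (x \<oplus>\<^bsub>N\<^esub> y) = a \<odot>\<^bsub>N\<^esub> x \<oplus>\<^bsub>N\<^esub> a \<odot>\<^bsub>N\<^esub> y"
      using a u v by (simp add: smult add M.smult_closed)
  next
    fix x assume "x \<in> carrier N"
    then obtain u where u: "u \<in> carrier M" "x = p u" using ex by blast
    show "\<one>\<^bsub>A\<^esub> \<odot>\<^bsub>N\<^esub> x = x" using u smult[of "\<one>\<^bsub>A\<^esub>" u] by (simp add: M.smult_one)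
  qed
  ultimately show ?thesis by (intro left_module.intro M.R.ring_axioms)
qed

lemma quotient_exists:
  fixes M :: "('a, 'm) module"
  assumes M: "M \<in> fgmod A" and N: "msub A M N"
  obtains Q :: "'a lmod" and p where "Q \<in> fgmod A" "p \<in> mhom A M Q" "p ` carrier M = carrier Q"
    "{x \<in> carrier M. p x = \<zero>\<^bsub>Q\<^esub>} = N"
proof -
  note lm = fgmod_lm[OF M] and d = msubD[OF N]
  interpret M: left_module A M by (rule lm)
  (* p picks a representative of every coset, so that the quotient first lives on the type of M *)
  define c where "c x = {y \<in> carrier M. y \<ominus>\<^bsub>M\<^esub> x \<in> N}" for x
  define r where "r X = (SOME y. y \<in> X)" for X :: "'m set"
  define p where "p x = r (c x)" for x
  have p: "p x \<in> carrier M" "p x \<ominus>\<^bsub>M\<^esub> x \<in> N" if "x \<in> carrier M" for x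
  proof -
    have "x \<in> c x" using that d(2) by (simp add: c_def)
    then have "p x \<in> c x" unfolding p_def r_def by (rule someI)
    then show "p x \<in> carrier M" "p x \<ominus>\<^bsub>M\<^esub> x \<in> N" by (simp_all add: c_def)
  qed
  have trans: "x \<ominus>\<^bsub>M\<^esub> z \<in> N" if "x \<ominus>\<^bsub>M\<^esub> y \<in> N" "y \<ominus>\<^bsub>M\<^esub> z \<in> N" "x \<in> carrier M" "y \<in> carrier M" "z \<in> carrier M" for x y z
  proof -
    have "x \<ominus>\<^bsub>M\<^esub> z = (x \<ominus>\<^bsub>M\<^esub> y) \<oplus>\<^bsub>M\<^esub> (y \<ominus>\<^bsub>M\<^esub> z)"
      using that(3-5) by (simp add: M.M.minus_eq M.M.a_assoc M.M.r_neg1)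
    then show ?thesis using d(3)[OF that(1,2)] by simp
  qed
  have sym: "y \<ominus>\<^bsub>M\<^esub> x \<in> N" if "x \<ominus>\<^bsub>M\<^esub> y \<in> N" "x \<in> carrier M" "y \<in> carrier M" for x y
  proof -
    have "y \<ominus>\<^bsub>M\<^esub> x = \<ominus>\<^bsub>M\<^esub> (x \<ominus>\<^bsub>M\<^esub> y)"
      using that(2,3) by (simp add: M.M.minus_eq M.M.minus_add M.M.a_comm)
    then show ?thesis using msub_neg[OF lm N that(1)] by simp
  qed
  have p_eq: "p x = p y \<longleftrightarrow> x \<ominus>\<^bsub>M\<^esub> y \<in> N" if x: "x \<in> carrier M" and y: "y \<in> carrier M" for x y
  proof
    assume "p x = p y"
    then show "x \<ominus>\<^bsub>M\<^esub> y \<in> N" using trans[of x "p x" y] p(2)[OF y] sym[OF p(2)[OF x] p(1)[OF x] x] p(1)[OF x] x y by simp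
  next
    assume xy: "x \<ominus>\<^bsub>M\<^esub> y \<in> N"
    have "c x = c y"
      unfolding c_def using trans xy sym[OF xy x y] x y by (intro Collect_cong) blast
    then show "p x = p y" by (simp add: p_def)
  qed
  have add: "(u \<oplus>\<^bsub>M\<^esub> v) \<ominus>\<^bsub>M\<^esub> (x \<oplus>\<^bsub>M\<^esub> y) \<in> N"
    if "u \<ominus>\<^bsub>M\<^esub> x \<in> N" "v \<ominus>\<^bsub>M\<^esub> y \<in> N" "u \<in> carrier M" "v \<in> carrier M" "x \<in> carrier M" "y \<in> carrier M" for u v x y
  proof -
    have "(u \<oplus>\<^bsub>M\<^esub> v) \<ominus>\<^bsub>M\<^esub> (x \<oplus>\<^bsub>M\<^esub> y) = (u \<ominus>\<^bsub>M\<^esub> x) \<oplus>\<^bsub>M\<^esub> (v \<ominus>\<^bsub>M\<^esub> y)"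
      using that(3-6) by (simp add: M.M.minus_eq M.M.minus_add M.M.a_ac)
    then show ?thesis using d(3)[OF that(1,2)] by simp
  qed
  have smult: "a \<odot>\<^bsub>M\<^esub> u \<ominus>\<^bsub>M\<^esub> a \<odot>\<^bsub>M\<^esub> x \<in> N"
    if "u \<ominus>\<^bsub>M\<^esub> x \<in> N" "u \<in> carrier M" "x \<in> carrier M" "a \<in> carrier A" for a u x
  proof -
    have "a \<odot>\<^bsub>M\<^esub> (u \<ominus>\<^bsub>M\<^esub> x) \<oplus>\<^bsub>M\<^esub> a \<odot>\<^bsub>M\<^esub> x = a \<odot>\<^bsub>M\<^esub> u"
      using that by (simp add: M.smult_r_distr[symmetric])
    then have "a \<odot>\<^bsub>M\<^esub> u \<ominus>\<^bsub>M\<^esub> a \<odot>\<^bsub>M\<^esub> x = a \<odot>\<^bsub>M\<^esub> (u \<ominus>\<^bsub>M\<^esub> x)"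
      using that M.M.add_minus_cancel[of "a \<odot>\<^bsub>M\<^esub> (u \<ominus>\<^bsub>M\<^esub> x)" "a \<odot>\<^bsub>M\<^esub> x"] by (simp add: M.smult_closed)
    then show ?thesis using d(4)[OF that(4,1)] by simp
  qed
  define Q0 :: "('a, 'm) module" where
    "Q0 = \<lparr>carrier = p ` carrier M, mult = undefined, one = undefined, zero = p \<zero>\<^bsub>M\<^esub>,
      add = (\<lambda>u v. p (u \<oplus>\<^bsub>M\<^esub> v)), smult = (\<lambda>a u. p (a \<odot>\<^bsub>M\<^esub> u))\<rparr>"
  have Q0 [simp]: "carrier Q0 = p ` carrier M" "\<zero>\<^bsub>Q0\<^esub> = p \<zero>\<^bsub>M\<^esub>"
    "u \<oplus>\<^bsub>Q0\<^esub> v = p (u \<oplus>\<^bsub>M\<^esub> v)" "a \<odot>\<^bsub>Q0\<^esub> u = p (a \<odot>\<^bsub>M\<^esub> u)" for u v a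
    by (simp_all add: Q0_def)
  have pa: "p (x \<oplus>\<^bsub>M\<^esub> y) = p x \<oplus>\<^bsub>Q0\<^esub> p y" if "x \<in> carrier M" "y \<in> carrier M" for x y
    using that p add[OF sym sym, of "p x" x "p y" y] by (simp add: p_eq)
  have ps: "p (a \<odot>\<^bsub>M\<^esub> x) = a \<odot>\<^bsub>Q0\<^esub> p x" if "a \<in> carrier A" "x \<in> carrier M" for a x
    using that p smult[OF sym, of "p x" x a] by (simp add: p_eq M.smult_closed)
  have Q0lm: "left_module A Q0"
    by (rule left_module_image[OF lm, of p]) (use pa ps in auto)
  have ph: "restrict p (carrier M) \<in> mhom A M Q0"
    by (rule mhom_restrictI[OF lm]) (use pa ps in auto)
  have "Q0 \<in> fgmod A" by (rule fgmod_image[OF M Q0lm ph]) simp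
  then obtain Q :: "'a lmod" and f where Q: "Q \<in> fgmod A" "f \<in> mhom A Q0 Q" "bij_betw f (carrier Q0) (carrier Q)"
    by (rule list_representative)
  let ?p = "compose (carrier M) f (restrict p (carrier M))"
  have "?p \<in> mhom A M Q" by (rule mhom_comp[OF lm ph Q(2)])
  moreover have "?p ` carrier M = carrier Q"
    using Q(3) by (simp add: compose_def bij_betw_def image_image cong: image_cong)
  moreover have "{x \<in> carrier M. ?p x = \<zero>\<^bsub>Q\<^esub>} = N"
  proof -
    have "?p x = \<zero>\<^bsub>Q\<^esub> \<longleftrightarrow> x \<in> N" if x: "x \<in> carrier M" for x
    proof -
      have "?p x = \<zero>\<^bsub>Q\<^esub> \<longleftrightarrow> f (p x) = f (p \<zero>\<^bsub>M\<^esub>)"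
        using x mhom_zero[OF Q0lm fgmod_lm[OF Q(1)] Q(2)] by (simp add: compose_def)
      also have "\<dots> \<longleftrightarrow> p x = p \<zero>\<^bsub>M\<^esub>"
        using Q(3) x by (auto simp: bij_betw_def dest: inj_onD)
      also have "\<dots> \<longleftrightarrow> x \<in> N" using x p_eq[OF x M.M.zero_closed] by simp
      finally show ?thesis .
    qed
    then show ?thesis using d(1) by blast
  qed
  ultimately show ?thesis using Q(1) that by blast
qed



section \<open>Noetherian modules and the theorem of Hopkins\<close>

text \<open>Relative to a subset \<open>I\<close>, so that a kernel or an image counts as noetherian without
  becoming a module record of its own.\<close>

definition noeth_on :: "('a, 'x) ring_scheme \<Rightarrow> ('a, 'm) module \<Rightarrow> 'm set \<Rightarrow> bool" where
  "noeth_on A M I \<longleftrightarrow> (\<forall>N. msub A M N \<and> N \<subseteq> I \<longrightarrow> (\<exists>B. finite B \<and> B \<subseteq> N \<and> mspan A M B = N))"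

abbreviation noeth_mod :: "('a, 'x) ring_scheme \<Rightarrow> ('a, 'm) module \<Rightarrow> bool" where
  "noeth_mod A M \<equiv> noeth_on A M (carrier M)"

definition regular :: "('a, 'x) ring_scheme \<Rightarrow> ('a, 'a) module" where
  "regular A = \<lparr>carrier = carrier A, mult = undefined, one = undefined, zero = \<zero>\<^bsub>A\<^esub>,
     add = (\<lambda>x y. x \<oplus>\<^bsub>A\<^esub> y), smult = (\<lambda>a x. a \<otimes>\<^bsub>A\<^esub> x)\<rparr>"

definition left_noetherian :: "('a, 'x) ring_scheme \<Rightarrow> bool" where
  "left_noetherian A \<longleftrightarrow> ring A \<and> noeth_mod A (regular A)"

lemma noeth_on_subset: "noeth_on A M I \<Longrightarrow> J \<subseteq> I \<Longrightarrow> noeth_on A M J"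
  unfolding noeth_on_def by blast

lemma noeth_onD:
  assumes "noeth_on A M I" "msub A M N" "N \<subseteq> I"
  obtains B where "finite B" "B \<subseteq> N" "mspan A M B = N"
  using assms unfolding noeth_on_def by blast

lemma noeth_on_image:
  assumes "left_module A M" "left_module A N" "f \<in> mhom A M N" "msub A M I" "noeth_on A M I"
  shows "noeth_on A N (f ` I)"
  unfolding noeth_on_def
proof (intro allI impI, elim conjE)
  fix L assume L: "msub A N L" "L \<subseteq> f ` I"
  let ?L = "{x \<in> carrier M. f x \<in> L} \<inter> I"
  have "msub A M ?L" by (intro msub_Int msub_vimage[OF assms(1-3)] L assms)
  then obtain B where B: "finite B" "B \<subseteq> ?L" "mspan A M B = ?L"
    by (rule noeth_onD[OF assms(5)]) auto
  have "f ` ?L = L"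
  proof
    show "L \<subseteq> f ` ?L" using L(2) msubD(1)[OF assms(4)] by blast
  qed blast
  moreover have "f ` ?L = mspan A N (f ` B)"
    using mhom_span_subset[OF assms(1-3), of B] B by auto
  ultimately show "\<exists>B. finite B \<and> B \<subseteq> L \<and> mspan A N B = L"
    using B by (intro exI[of _ "f ` B"]) auto
qed

text \<open>A submodule is generated by generators of its intersection with the kernel together with
  preimages of generators of its image.\<close>

lemma noeth_on_extension:
  assumes M: "left_module A M" and N: "left_module A N" and f: "f \<in> mhom A M N"
    and ker: "noeth_on A M {x \<in> I. f x = \<zero>\<^bsub>N\<^esub>}" and im: "noeth_on A N (f ` I)"
  shows "noeth_on A M I"
  unfolding noeth_on_def
proof (intro allI impI, elim conjE)
  interpret M: left_module A M by fact
  interpret N: left_module A N by fact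
  fix L assume L: "msub A M L" "L \<subseteq> I"
  have "msub A M (L \<inter> {x \<in> carrier M. f x = \<zero>\<^bsub>N\<^esub>})" by (intro msub_Int L msub_kernel[OF M N f])
  then obtain B where B: "finite B" "B \<subseteq> L" "mspan A M B = L \<inter> {x \<in> carrier M. f x = \<zero>\<^bsub>N\<^esub>}"
    by (rule noeth_onD[OF ker]) (use L in auto)
  have "msub A N (f ` L)" by (rule msub_image[OF M N f L(1)])
  then obtain C' where C': "finite C'" "C' \<subseteq> f ` L" "mspan A N C' = f ` L"
    by (rule noeth_onD[OF im]) (use L in auto)
  then obtain C where C: "C \<subseteq> L" "C' = f ` C" "finite C" by (metis finite_subset_image)
  have BC: "B \<union> C \<subseteq> carrier M" "C \<subseteq> carrier M" using B C msubD[OF L(1)] by blast+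
  have "L \<subseteq> mspan A M (B \<union> C)"
  proof
    fix x assume x: "x \<in> L"
    have "f x \<in> f ` mspan A M C" using mhom_span_subset[OF M N f BC(2)] C C' x by auto
    then obtain y where y: "y \<in> mspan A M C" "f x = f y" by auto
    have yL: "y \<in> L" using y mspan_least[OF L(1) C(1)] by blast
    have c: "x \<in> carrier M" "y \<in> carrier M" using x yL msubD[OF L(1)] by auto
    have "f (x \<ominus>\<^bsub>M\<^esub> y) = \<zero>\<^bsub>N\<^esub>"
      using mhom_minus[OF M N f c] y(2) mhomD(1)[OF f c(2)] by simp
    then have "x \<ominus>\<^bsub>M\<^esub> y \<in> mspan A M B"
      using B(3) msub_minus[OF M L(1) x yL] c by simp
    then have "x \<ominus>\<^bsub>M\<^esub> y \<oplus>\<^bsub>M\<^esub> y \<in> mspan A M (B \<union> C)"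
      using y mspan_mono[of B "B \<union> C" A M] mspan_mono[of C "B \<union> C" A M]
      by (intro msubD(3)[OF msub_mspan[OF M BC(1)]]) blast+
    moreover have "x \<ominus>\<^bsub>M\<^esub> y \<oplus>\<^bsub>M\<^esub> y = x" using c by (simp add: M.M.minus_eq M.M.a_assoc M.M.l_neg)
    ultimately show "x \<in> mspan A M (B \<union> C)" by simp
  qed
  moreover have "mspan A M (B \<union> C) \<subseteq> L" using B C by (intro mspan_least L) auto
  ultimately show "\<exists>B. finite B \<and> B \<subseteq> L \<and> mspan A M B = L" using B C
    by (intro exI[of _ "B \<union> C"]) auto
qed

lemma noeth_on_zero: "noeth_on A M {\<zero>\<^bsub>M\<^esub>}"
  unfolding noeth_on_def
proof (intro allI impI, elim conjE)
  fix N assume "msub A M N" "N \<subseteq> {\<zero>\<^bsub>M\<^esub>}"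
  moreover from this have "N = {\<zero>\<^bsub>M\<^esub>}" using msubD(2)[of A M N] by auto
  ultimately have N: "N = {\<zero>\<^bsub>M\<^esub>}" "msub A M {\<zero>\<^bsub>M\<^esub>}" by simp_all
  then have "mspan A M {\<zero>\<^bsub>M\<^esub>} = N" using mspan_superset[of "{\<zero>\<^bsub>M\<^esub>}" A M] mspan_least[of A M N "{\<zero>\<^bsub>M\<^esub>}"] by auto
  then show "\<exists>B. finite B \<and> B \<subseteq> N \<and> mspan A M B = N" using N by blast
qed

text \<open>The finitely many maps \<open>f b\<close> together embed \<open>M\<close> into a finite direct sum of noetherian
  modules.\<close>

lemma noeth_mod_jointly_injective:
  assumes M: "left_module A M" and fin: "finite B"
    and Q: "\<And>b. b \<in> B \<Longrightarrow> left_module A Q" "\<And>b. b \<in> B \<Longrightarrow> noeth_mod A Q"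
    and f: "\<And>b. b \<in> B \<Longrightarrow> f b \<in> mhom A M Q"
    and inj: "\<And>x. x \<in> carrier M \<Longrightarrow> (\<And>b. b \<in> B \<Longrightarrow> f b x = \<zero>\<^bsub>Q\<^esub>) \<Longrightarrow> x = \<zero>\<^bsub>M\<^esub>"
  shows "noeth_mod A M"
proof -
  interpret M: left_module A M by fact
  have "C \<subseteq> B \<Longrightarrow> noeth_on A M {x \<in> carrier M. \<forall>b\<in>B - C. f b x = \<zero>\<^bsub>Q\<^esub>}" if "finite C" for C
    using that
  proof (induction C rule: finite_induct)
    case empty
    have "{x \<in> carrier M. \<forall>b\<in>B - {}. f b x = \<zero>\<^bsub>Q\<^esub>} \<subseteq> {\<zero>\<^bsub>M\<^esub>}" using inj by auto
    then show ?case by (rule noeth_on_subset[OF noeth_on_zero])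
  next
    case (insert c C)
    show ?case
    proof (rule noeth_on_extension[OF M Q(1) f, of c])
      show "noeth_on A M {x \<in> {x \<in> carrier M. \<forall>b\<in>B - insert c C. f b x = \<zero>\<^bsub>Q\<^esub>}. f c x = \<zero>\<^bsub>Q\<^esub>}"
        by (rule noeth_on_subset[OF insert.IH]) (use insert in auto)
      show "noeth_on A Q (f c ` {x \<in> carrier M. \<forall>b\<in>B - insert c C. f b x = \<zero>\<^bsub>Q\<^esub>})"
        by (rule noeth_on_subset[OF Q(2)]) (use insert mhomD(1)[OF f[of c]] in auto)
    qed (use insert in auto)
  qed
  from this[OF fin] show ?thesis by simp
qed

lemma noeth_mod_injective:
  assumes "left_module A M" "left_module A Q" "noeth_mod A Q" "f \<in> mhom A M Q"
    "inj_on f (carrier M)"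
  shows "noeth_mod A M"
  by (rule noeth_mod_jointly_injective[of A M "{()}" Q "\<lambda>_. f"])
     (use assms mhom_inj_iff[OF assms(1,2,4)] in auto)

lemma regular_simps [simp]:
  "carrier (regular A) = carrier A" "\<zero>\<^bsub>regular A\<^esub> = \<zero>\<^bsub>A\<^esub>" "x \<oplus>\<^bsub>regular A\<^esub> y = x \<oplus>\<^bsub>A\<^esub> y"
  "a \<odot>\<^bsub>regular A\<^esub> x = a \<otimes>\<^bsub>A\<^esub> x"
  by (simp_all add: regular_def)

lemma left_module_regular:
  assumes "ring A" shows "left_module A (regular A)"
proof -
  interpret ring A by fact
  have "abelian_group (regular A)"
  proof (rule abelian_groupI)
    fix x assume "x \<in> carrier (regular A)"
    then show "\<exists>y\<in>carrier (regular A). y \<oplus>\<^bsub>regular A\<^esub> x = \<zero>\<^bsub>regular A\<^esub>"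
      by (intro bexI[of _ "\<ominus>\<^bsub>A\<^esub> x"]) (auto simp: l_neg)
  qed (auto simp: a_ac)
  then show ?thesis
    by (intro left_module.intro left_module_axioms.intro assms) (auto simp: l_distr r_distr m_assoc)
qed

text \<open>Modulo the span of \<open>B\<close> the larger span is cyclic, hence an image of the regular module.\<close>

lemma noeth_on_insert:
  assumes A: "left_noetherian A" and M: "M \<in> fgmod A" and b: "b \<in> carrier M" and B: "B \<subseteq> carrier M"
    and noeth: "noeth_on A M (mspan A M B)"
  shows "noeth_on A M (mspan A M (insert b B))"
proof -
  note lM = fgmod_lm[OF M]
  have reg: "left_module A (regular A)" "noeth_mod A (regular A)"
    using A left_module_regular by (auto simp: left_noetherian_def)
  obtain Q :: "'a lmod" and p where Q: "Q \<in> fgmod A" "p \<in> mhom A M Q" "p ` carrier M = carrier Q"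
    "{x \<in> carrier M. p x = \<zero>\<^bsub>Q\<^esub>} = mspan A M B"
    by (rule quotient_exists[OF M msub_mspan[OF lM B]])
  note lQ = fgmod_lm[OF Q(1)]
  interpret Q: left_module A Q by (rule lQ)
  have pb: "p b \<in> carrier Q" by (rule mhomD(1)[OF Q(2) b])
  define g where "g = (\<lambda>a\<in>carrier (regular A). a \<odot>\<^bsub>Q\<^esub> p b)"
  have g: "g \<in> mhom A (regular A) Q"
    unfolding g_def by (rule mhom_restrictI[OF reg(1)]) (use pb in \<open>auto simp: Q.smult_closed Q.smult_l_distr Q.smult_assoc1\<close>)
  have im: "msub A Q (g ` carrier (regular A))" by (rule msub_image[OF reg(1) lQ g msub_carrier[OF reg(1)]])
  have insert: "insert b B \<subseteq> carrier M" using b B by blast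
  show ?thesis
  proof (rule noeth_on_extension[OF lM lQ Q(2)])
    have "mspan A M (insert b B) \<subseteq> carrier M" by (rule msubD(1)[OF msub_mspan[OF lM insert]])
    then have "{x \<in> mspan A M (insert b B). p x = \<zero>\<^bsub>Q\<^esub>} \<subseteq> mspan A M B" unfolding Q(4)[symmetric] by blast
    then show "noeth_on A M {x \<in> mspan A M (insert b B). p x = \<zero>\<^bsub>Q\<^esub>}" by (rule noeth_on_subset[OF noeth])
    have "p x \<in> g ` carrier (regular A)" if x: "x \<in> insert b B" for x
    proof (cases "x = b")
      case True
      have "g \<one>\<^bsub>A\<^esub> = p b" using pb by (simp add: g_def Q.smult_one)
      then show ?thesis using True by (metis Q.R.one_closed imageI regular_simps(1))
    next
      case False
      then have "p x = \<zero>\<^bsub>Q\<^esub>" using x mspan_superset[of B A M] Q(4) by blast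
      then show ?thesis using msubD(2)[OF im] by simp
    qed
    then have "p ` insert b B \<subseteq> g ` carrier (regular A)" by (rule image_subsetI)
    then have "p ` mspan A M (insert b B) \<subseteq> g ` carrier (regular A)"
      unfolding mhom_span_subset[OF lM lQ Q(2) insert] by (rule mspan_least[OF im])
    then show "noeth_on A Q (p ` mspan A M (insert b B))"
      by (rule noeth_on_subset[OF noeth_on_image[OF reg(1) lQ g msub_carrier[OF reg(1)] reg(2)]])
  qed
qed

lemma noeth_mod_fgmod:
  assumes A: "left_noetherian A" and M: "M \<in> fgmod A" shows "noeth_mod A M"
proof -
  interpret M: left_module A M by (rule fgmod_lm[OF M])
  obtain B where B: "finite B" "B \<subseteq> carrier M" "mspan A M B = carrier M"
    using M by (auto simp: fgmod_mspan)
  have "C \<subseteq> carrier M \<Longrightarrow> noeth_on A M (mspan A M C)" if "finite C" for C using that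
  proof (induction C rule: finite_induct)
    case empty
    have "mspan A M {} \<subseteq> {\<zero>\<^bsub>M\<^esub>}" by (rule mspan_least) (auto simp: msub_def)
    then show ?case by (rule noeth_on_subset[OF noeth_on_zero])
  next
    case (insert b C)
    then show ?case by (intro noeth_on_insert[OF A M]) auto
  qed
  from this[OF B(1,2)] show ?thesis unfolding B(3) .
qed

lemma fgmod_submod:
  assumes "left_noetherian A" "M \<in> fgmod A" "msub A M N"
  shows "submod M N \<in> fgmod A"
proof -
  obtain B where "finite B" "B \<subseteq> N" "mspan A M B = N"
    by (rule noeth_onD[OF noeth_mod_fgmod[OF assms(1,2)] assms(3) msubD(1)[OF assms(3)]])
  then show ?thesis using fgmod_submod_iff[OF fgmod_lm[OF assms(2)] assms(3)] by blast
qed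


lemma regular_minus [simp]: "x \<ominus>\<^bsub>regular A\<^esub> y = x \<ominus>\<^bsub>A\<^esub> y"
  by (simp add: a_minus_def a_inv_def m_inv_def)

lemma (in cring) ideal_iff_msub: "ideal I R \<longleftrightarrow> msub R (regular R) I"
proof
  assume "ideal I R"
  then interpret ideal I R .
  show "msub R (regular R) I"
    by (auto simp: msub_def a_subset[THEN subsetD] I_l_closed)
next
  assume I: "msub R (regular R) I"
  note d = msubD[OF I, simplified]
  have "\<ominus> x \<in> I" if "x \<in> I" for x
    using d(4)[of "\<ominus> \<one>" x] that d(1) by (auto simp: l_minus)
  then show "ideal I R"
  proof (intro idealI ring_axioms add.subgroupI)
    fix a x assume "a \<in> I" "x \<in> carrier R"
    then show "x \<otimes> a \<in> I" "a \<otimes> x \<in> I" using d(4)[of x a] m_comm[of a x] d(1) by auto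
  qed (use d \<open>\<And>x. x \<in> I \<Longrightarrow> \<ominus> x \<in> I\<close> in \<open>auto simp: a_inv_def\<close>)
qed

lemma artinian_minimal:
  assumes art: "artinian_ring k" and ne: "Q I" "\<And>I. Q I \<Longrightarrow> ideal I k"
  obtains J where "Q J" "\<And>L. Q L \<Longrightarrow> L \<subseteq> J \<Longrightarrow> L = J"
proof (rule ccontr)
  assume *: "\<not> thesis"
  note minimal = that
  have "\<exists>L. Q L \<and> L \<subset> J" if "Q J" for J
    using minimal[OF that] * by blast
  then have "\<exists>s. \<forall>n. Q (s n) \<and> s (Suc n) \<subset> s n"
    by (intro dependent_nat_choice[of "\<lambda>_. Q" "\<lambda>_ J L. L \<subset> J"]) (use ne(1) in blast)+
  then obtain s where s: "\<And>n. Q (s n)" "\<And>n :: nat. s (Suc n) \<subset> s n" by blast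
  have "\<forall>n. ideal (s n) k" "\<forall>n. s (Suc n) \<subseteq> s n" using s ne(2) by blast+
  then obtain m where m: "\<forall>n\<ge>m. s n = s m"
    using spec[OF conjunct2[OF art[unfolded artinian_ring_def]], of s] by auto
  have "s (Suc m) = s m" by (rule m[rule_format]) simp
  then show False using s(2)[of m] by simp
qed

text \<open>Take an ideal \<open>I\<close> minimal among those that are not noetherian. Multiplication by a scalar \<open>a\<close>
  either is onto \<open>I\<close> or has a noetherian image; in the second case its kernel is not noetherian, hence
  equal to \<open>I\<close>. So every scalar annihilates \<open>I\<close> or, by the descending chain condition on its powers,
  acts invertibly: \<open>I\<close> is a vector space. Any vector outside a hyperplane \<open>L\<close> then spans \<open>I\<close> together with
  \<open>L\<close>, and \<open>L\<close> is noetherian by minimality, which makes \<open>I\<close> noetherian.\<close>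

lemma artinian_imp_noetherian:
  assumes k: "cring k" and art: "artinian_ring k"
  shows "left_noetherian k"
proof (rule ccontr)
  assume "\<not> left_noetherian k"
  interpret cring k by fact
  let ?K = "regular k"
  have lmK: "left_module k ?K" by (rule left_module_regular[OF ring_axioms])
  let ?Q = "\<lambda>I. ideal I k \<and> \<not> noeth_on k ?K I"
  have "?Q (carrier k)"
    using \<open>\<not> left_noetherian k\<close> by (simp add: left_noetherian_def ring_axioms oneideal)
  then obtain I where I: "?Q I" and min: "\<And>L. ?Q L \<Longrightarrow> L \<subseteq> I \<Longrightarrow> L = I"
    by (rule artinian_minimal[OF art]) auto
  have subI: "msub k ?K I" using I ideal_iff_msub by blast
  note Id = msubD[OF subI, simplified]
  have mult: "restrict (\<lambda>x. a \<otimes>\<^bsub>k\<^esub> x) (carrier ?K) \<in> mhom k ?K ?K" (is "?m a \<in> _") if "a \<in> carrier k" for a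
    by (rule mhom_restrictI[OF lmK]) (use that in \<open>auto simp: r_distr m_lcomm\<close>)
  have im: "?m a ` I = (\<lambda>x. a \<otimes>\<^bsub>k\<^esub> x) ` I" if "a \<in> carrier k" for a
    using Id(1) by (intro image_cong) auto
  have dichotomy: "(\<lambda>x. a \<otimes>\<^bsub>k\<^esub> x) ` I = I" if a: "a \<in> carrier k" and ne: "\<exists>x\<in>I. a \<otimes>\<^bsub>k\<^esub> x \<noteq> \<zero>\<^bsub>k\<^esub>" for a
  proof (rule ccontr)
    assume n: "(\<lambda>x. a \<otimes>\<^bsub>k\<^esub> x) ` I \<noteq> I"
    have sub: "msub k ?K (?m a ` I)" by (rule msub_image[OF lmK lmK mult[OF a] subI])
    have "?m a ` I \<subseteq> I" unfolding im[OF a] using Id(4) a by blast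
    then have N: "noeth_on k ?K (?m a ` I)"
      using min sub n im[OF a] ideal_iff_msub by metis
    let ?Z = "{x \<in> carrier ?K. ?m a x = \<zero>\<^bsub>?K\<^esub>}"
    have "msub k ?K (I \<inter> ?Z)" by (intro msub_Int subI msub_kernel lmK mult a)
    moreover have "\<not> noeth_on k ?K (I \<inter> ?Z)"
    proof
      assume "noeth_on k ?K (I \<inter> ?Z)"
      moreover have "{x \<in> I. ?m a x = \<zero>\<^bsub>?K\<^esub>} \<subseteq> I \<inter> ?Z" using Id(1) by auto
      ultimately show False
        using noeth_on_extension[OF lmK lmK mult[OF a] noeth_on_subset N] I by blast
    qed
    ultimately have "I \<inter> ?Z = I" using min[of "I \<inter> ?Z"] ideal_iff_msub by blast
    then have z: "\<forall>x\<in>I. ?m a x = \<zero>\<^bsub>?K\<^esub>" by blast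
    have "a \<otimes>\<^bsub>k\<^esub> x = \<zero>\<^bsub>k\<^esub>" if x: "x \<in> I" for x
    proof -
      have "?m a x = \<zero>\<^bsub>k\<^esub>" using bspec[OF z x] by (simp only: regular_simps)
      moreover have "?m a x = a \<otimes>\<^bsub>k\<^esub> x" using Id(5)[OF x] by simp
      ultimately show ?thesis by (simp only:)
    qed
    then show False using ne by blast
  qed
  have inverse: "\<exists>b\<in>carrier k. \<forall>x\<in>I. b \<otimes>\<^bsub>k\<^esub> (a \<otimes>\<^bsub>k\<^esub> x) = x"
    if a: "a \<in> carrier k" and ne: "\<exists>x\<in>I. a \<otimes>\<^bsub>k\<^esub> x \<noteq> \<zero>\<^bsub>k\<^esub>" for a
  proof -
    have onto: "\<exists>y\<in>I. x = (a [^]\<^bsub>k\<^esub> n) \<otimes>\<^bsub>k\<^esub> y" if "x \<in> I" for x and n :: nat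
      using that
    proof (induction n arbitrary: x)
      case 0
      then show ?case using Id by auto
    next
      case (Suc n)
      then obtain y where y: "y \<in> I" "x = (a [^]\<^bsub>k\<^esub> n) \<otimes>\<^bsub>k\<^esub> y" by blast
      obtain z where "z \<in> I" "y = a \<otimes>\<^bsub>k\<^esub> z" using dichotomy[OF a ne] y(1) by blast
      then show ?case using y Id(1) a by (intro bexI[of _ z]) (auto simp: m_assoc subset_iff)
    qed
    define P where "P n = (\<lambda>c. c \<otimes>\<^bsub>k\<^esub> a [^]\<^bsub>k\<^esub> n) ` carrier k" for n :: nat
    have P: "P n = PIdl\<^bsub>k\<^esub> (a [^]\<^bsub>k\<^esub> n)" for n by (auto simp: P_def cgenideal_def)
    have "ideal (P n) k" for n unfolding P by (rule cgenideal_ideal) (simp add: a)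
    moreover have "P (Suc n) \<subseteq> P n" for n
    proof
      fix x assume "x \<in> P (Suc n)"
      then obtain c where c: "c \<in> carrier k" "x = c \<otimes>\<^bsub>k\<^esub> (a [^]\<^bsub>k\<^esub> n \<otimes>\<^bsub>k\<^esub> a)" by (auto simp: P_def)
      have "x = (c \<otimes>\<^bsub>k\<^esub> a) \<otimes>\<^bsub>k\<^esub> a [^]\<^bsub>k\<^esub> n" using c a by (simp add: m_ac)
      then show "x \<in> P n" unfolding P_def using c a by blast
    qed
    ultimately obtain m where m: "\<forall>n\<ge>m. P n = P m"
      using spec[OF conjunct2[OF art[unfolded artinian_ring_def]], of P] by auto
    have "P (Suc m) = P m" by (rule m[rule_format]) simp
    moreover have "a [^]\<^bsub>k\<^esub> m \<in> P m" unfolding P_def by (rule image_eqI[of _ _ "\<one>\<^bsub>k\<^esub>"]) (simp_all add: a)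
    ultimately obtain b where b: "b \<in> carrier k" "a [^]\<^bsub>k\<^esub> m = b \<otimes>\<^bsub>k\<^esub> a [^]\<^bsub>k\<^esub> Suc m"
      unfolding P_def by blast
    show ?thesis
    proof (intro bexI[OF _ b(1)] ballI)
      fix x assume x: "x \<in> I"
      then obtain y where y: "y \<in> I" "x = (a [^]\<^bsub>k\<^esub> m) \<otimes>\<^bsub>k\<^esub> y" using onto by blast
      have yc: "y \<in> carrier k" using y Id by auto
      have "b \<otimes>\<^bsub>k\<^esub> (a \<otimes>\<^bsub>k\<^esub> x) = (b \<otimes>\<^bsub>k\<^esub> a [^]\<^bsub>k\<^esub> Suc m) \<otimes>\<^bsub>k\<^esub> y"
        unfolding y(2) using a b(1) yc by (simp add: m_ac)
      also have "\<dots> = x" using b(2) y(2) by simp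
      finally show "b \<otimes>\<^bsub>k\<^esub> (a \<otimes>\<^bsub>k\<^esub> x) = x" .
    qed
  qed
  (* a hyperplane L of I: maximal among the submodules that avoid x0 *)
  obtain x0 where x0: "x0 \<in> I" "x0 \<noteq> \<zero>\<^bsub>k\<^esub>"
    using I noeth_on_subset[OF noeth_on_zero[of k ?K], of I] by auto
  define \<C> where "\<C> = {L. msub k ?K L \<and> L \<subseteq> I \<and> x0 \<notin> L}"
  have "\<exists>L\<in>\<C>. \<forall>X\<in>\<C>. L \<subseteq> X \<longrightarrow> X = L"
  proof (rule subset_Zorn_nonempty)
    have "{\<zero>\<^bsub>k\<^esub>} \<in> \<C>" unfolding \<C>_def msub_def using x0 Id by auto
    then show "\<C> \<noteq> {}" by blast
    fix C assume C: "C \<noteq> {}" "subset.chain \<C> C"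
    then have Cm: "\<And>L. L \<in> C \<Longrightarrow> msub k ?K L \<and> L \<subseteq> I \<and> x0 \<notin> L"
      and tot: "\<And>L X. L \<in> C \<Longrightarrow> X \<in> C \<Longrightarrow> L \<subseteq> X \<or> X \<subseteq> L"
      unfolding subset_chain_def \<C>_def by auto
    have "msub k ?K (\<Union>C)"
      unfolding msub_def
    proof (intro conjI ballI)
      show "\<Union>C \<subseteq> carrier ?K" using Cm Id(1) by auto
      show "\<zero>\<^bsub>?K\<^esub> \<in> \<Union>C" using C(1) Cm msubD(2) by blast
      fix x assume "x \<in> \<Union>C"
      then obtain L where L: "L \<in> C" "x \<in> L" by blast
      { fix y assume "y \<in> \<Union>C"
        then obtain X where X: "X \<in> C" "y \<in> X" by blast
        from tot[OF L(1) X(1)] show "x \<oplus>\<^bsub>?K\<^esub> y \<in> \<Union>C"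
          using L X Cm msubD(3) by (meson UnionI subsetD) }
      { fix a assume "a \<in> carrier k"
        then show "a \<odot>\<^bsub>?K\<^esub> x \<in> \<Union>C" using L Cm msubD(4) by (meson UnionI) }
    qed
    then show "\<Union>C \<in> \<C>" unfolding \<C>_def using Cm by blast
  qed
  then obtain L where LC: "L \<in> \<C>" and Lmax: "\<And>X. X \<in> \<C> \<Longrightarrow> L \<subseteq> X \<Longrightarrow> X = L" by blast
  have L: "msub k ?K L" "L \<subseteq> I" "x0 \<notin> L" using LC by (simp_all add: \<C>_def)
  have max: "X = L" if "msub k ?K X" "X \<subseteq> I" "x0 \<notin> X" "L \<subseteq> X" for X
    using that by (intro Lmax) (simp_all add: \<C>_def)
  note Ld = msubD[OF L(1), simplified]
  have L_noeth: "noeth_on k ?K L"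
    using min[of L] L x0 ideal_iff_msub by blast
  have decomp: "\<exists>l\<in>L. \<exists>c\<in>carrier k. z = l \<oplus>\<^bsub>k\<^esub> c \<otimes>\<^bsub>k\<^esub> y"
    if y: "y \<in> I" "y \<notin> L" and z: "z \<in> I" for y z
  proof -
    have yc: "y \<in> carrier k" using y Id by auto
    define X where "X y = {l \<oplus>\<^bsub>k\<^esub> c \<otimes>\<^bsub>k\<^esub> y | l c. l \<in> L \<and> c \<in> carrier k}" for y
    have X: "msub k ?K (X y)" "X y \<subseteq> I" "L \<subseteq> X y" "y \<in> X y" if y: "y \<in> I" for y
    proof -
      have yc: "y \<in> carrier k" using y Id by auto
      show "X y \<subseteq> I" unfolding X_def using L(2) Id(3,4) y by blast
      show "L \<subseteq> X y"
      proof
        fix l assume l: "l \<in> L"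
        then have "l = l \<oplus>\<^bsub>k\<^esub> \<zero>\<^bsub>k\<^esub> \<otimes>\<^bsub>k\<^esub> y" using yc Ld(1) by auto
        then show "l \<in> X y" unfolding X_def using l by blast
      qed
      have "y = \<zero>\<^bsub>k\<^esub> \<oplus>\<^bsub>k\<^esub> \<one>\<^bsub>k\<^esub> \<otimes>\<^bsub>k\<^esub> y" using yc by simp
      then show "y \<in> X y" unfolding X_def using Ld(2) by blast
      show "msub k ?K (X y)"
        unfolding msub_def
      proof (intro conjI ballI)
        show "X y \<subseteq> carrier ?K" unfolding X_def using Ld(1) yc by auto
        show "\<zero>\<^bsub>?K\<^esub> \<in> X y" using \<open>L \<subseteq> X y\<close> Ld(2) by auto
        fix u assume "u \<in> X y"
        then obtain l c where u: "u = l \<oplus>\<^bsub>k\<^esub> c \<otimes>\<^bsub>k\<^esub> y" "l \<in> L" "c \<in> carrier k" unfolding X_def by blast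
        { fix v assume "v \<in> X y"
          then obtain l' c' where v: "v = l' \<oplus>\<^bsub>k\<^esub> c' \<otimes>\<^bsub>k\<^esub> y" "l' \<in> L" "c' \<in> carrier k" unfolding X_def by blast
          have "u \<oplus>\<^bsub>k\<^esub> v = (l \<oplus>\<^bsub>k\<^esub> l') \<oplus>\<^bsub>k\<^esub> (c \<oplus>\<^bsub>k\<^esub> c') \<otimes>\<^bsub>k\<^esub> y"
            using u v yc Ld(5) by (simp add: l_distr a_ac)
          then show "u \<oplus>\<^bsub>?K\<^esub> v \<in> X y" unfolding X_def using u v Ld(3) by auto }
        { fix a assume a: "a \<in> carrier k"
          have "a \<otimes>\<^bsub>k\<^esub> u = (a \<otimes>\<^bsub>k\<^esub> l) \<oplus>\<^bsub>k\<^esub> (a \<otimes>\<^bsub>k\<^esub> c) \<otimes>\<^bsub>k\<^esub> y"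
            using u a yc Ld(5) by (simp add: r_distr m_assoc)
          then show "a \<odot>\<^bsub>?K\<^esub> u \<in> X y" unfolding X_def using u a Ld(4) by auto }
      qed
    qed
    have x0: "x0 \<in> X y" using max[OF X(1,2)[OF y(1)]] X(3,4)[OF y(1)] y(2) by blast
    show ?thesis
    proof -
      have "z \<in> X y" if "z \<in> I" for z
      proof (cases "z \<in> L")
        case False
        have "x0 \<in> X z" using max[OF X(1,2)[OF that]] X(3,4)[OF that] False by blast
        then obtain l' c' where lc': "x0 = l' \<oplus>\<^bsub>k\<^esub> c' \<otimes>\<^bsub>k\<^esub> z" "l' \<in> L" "c' \<in> carrier k" unfolding X_def by blast
        have zc: "z \<in> carrier k" using that Id by auto
        have "c' \<otimes>\<^bsub>k\<^esub> z \<noteq> \<zero>\<^bsub>k\<^esub>" using lc' L(3) Ld(5) by auto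
        then have "\<exists>x\<in>I. c' \<otimes>\<^bsub>k\<^esub> x \<noteq> \<zero>\<^bsub>k\<^esub>" using that by blast
        from inverse[OF lc'(3) this] that obtain b where
          b: "b \<in> carrier k" "b \<otimes>\<^bsub>k\<^esub> (c' \<otimes>\<^bsub>k\<^esub> z) = z" by auto
        have "c' \<otimes>\<^bsub>k\<^esub> z = x0 \<ominus>\<^bsub>k\<^esub> l'"
          using lc' Ld(5) zc a_comm[of l' "c' \<otimes>\<^bsub>k\<^esub> z"] by simp
        moreover have "x0 \<ominus>\<^bsub>k\<^esub> l' \<in> X y"
          using msub_minus[OF lmK X(1)[OF y(1)] x0] lc'(2) X(3)[OF y(1)]
          by auto
        ultimately have "b \<otimes>\<^bsub>k\<^esub> (c' \<otimes>\<^bsub>k\<^esub> z) \<in> X y" using msubD(4)[OF X(1)[OF y(1)] b(1)] by simp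
        then show ?thesis using b by simp
      qed (use X(3)[OF y(1)] in blast)
      from this[OF z] show ?thesis unfolding X_def by blast
    qed
  qed
  have "noeth_on k ?K I"
    unfolding noeth_on_def
  proof (intro allI impI, elim conjE)
    fix N assume N: "msub k ?K N" "N \<subseteq> I"
    note Nd = msubD[OF N(1), simplified]
    have "\<exists>B. finite B \<and> B \<subseteq> N \<inter> L \<and> mspan k ?K B = N \<inter> L"
      using L_noeth msub_Int[OF N(1) L(1)] unfolding noeth_on_def by blast
    then obtain B where B: "finite B" "B \<subseteq> N \<inter> L" "mspan k ?K B = N \<inter> L" by blast
    show "\<exists>B. finite B \<and> B \<subseteq> N \<and> mspan k ?K B = N"
    proof (cases "N \<subseteq> L")
      case True
      then show ?thesis using B by (metis Int_absorb2)
    next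
      case False
      then obtain y where y: "y \<in> N" "y \<notin> L" by blast
      have yB: "insert y B \<subseteq> N" using y B by blast
      have sp: "msub k ?K (mspan k ?K (insert y B))"
        by (rule msub_mspan[OF lmK]) (use yB Nd(1) in auto)
      have "N \<subseteq> mspan k ?K (insert y B)"
      proof
        fix z assume z: "z \<in> N"
        then obtain l c where lc: "l \<in> L" "c \<in> carrier k" "z = l \<oplus>\<^bsub>k\<^esub> c \<otimes>\<^bsub>k\<^esub> y"
          using decomp[of y z] y N(2) by blast
        have car: "z \<in> carrier k" "y \<in> carrier k" "l \<in> carrier k" using z y lc(1) Nd(5) Ld(5) by auto
        have cy: "c \<odot>\<^bsub>?K\<^esub> y \<in> N" using Nd(4) lc y by simp
        have "z \<ominus>\<^bsub>k\<^esub> c \<otimes>\<^bsub>k\<^esub> y = l" using lc car by simp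
        then have "l \<in> N" using msub_minus[OF lmK N(1) z cy]
          by simp
        then have "l \<in> mspan k ?K (insert y B)"
          using lc(1) B(3) mspan_mono[of B "insert y B" k ?K] by blast
        moreover have "c \<odot>\<^bsub>?K\<^esub> y \<in> mspan k ?K (insert y B)"
          using msubD(4)[OF sp lc(2)] mspan_superset[of "insert y B" k ?K] by blast
        ultimately show "z \<in> mspan k ?K (insert y B)" using msubD(3)[OF sp] lc(3) by fastforce
      qed
      moreover have "mspan k ?K (insert y B) \<subseteq> N" by (rule mspan_least[OF N(1) yB])
      ultimately show ?thesis using B(1) yB by (intro exI[of _ "insert y B"]) auto
    qed
  qed
  then show False using I by blast
qed


section \<open>Artin algebras\<close>

text \<open>Structure map of the algebra; its image is central.\<close>

definition central :: "('k, 'a) module \<Rightarrow> 'k \<Rightarrow> 'a" where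
  "central A c = c \<odot>\<^bsub>A\<^esub> \<one>\<^bsub>A\<^esub>"

locale artin_alg =
  fixes k :: "'k ring" and A :: "('k, 'a) module"
  assumes artin: "artin_algebra k A"
begin

lemma k_cring: "cring k" and k_artinian: "artinian_ring k" and ring_A: "ring A"
  and module_A: "Module.module k A" and fin_gen_A: "fin_gen k A"
  using artin by (auto simp: artin_algebra_def)

lemma smult_mult:
  assumes "c \<in> carrier k" "x \<in> carrier A" "y \<in> carrier A"
  shows "(c \<odot>\<^bsub>A\<^esub> x) \<otimes>\<^bsub>A\<^esub> y = c \<odot>\<^bsub>A\<^esub> (x \<otimes>\<^bsub>A\<^esub> y)" "x \<otimes>\<^bsub>A\<^esub> (c \<odot>\<^bsub>A\<^esub> y) = c \<odot>\<^bsub>A\<^esub> (x \<otimes>\<^bsub>A\<^esub> y)"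
  using artin assms by (auto simp: artin_algebra_def)

sublocale A: ring A by (rule ring_A)
sublocale k: cring k by (rule k_cring)
sublocale kA: Module.module k A by (rule module_A)

lemma left_module_A: "left_module k A"
  by (intro left_module.intro left_module_axioms.intro k.ring_axioms A.is_abelian_group)
     (auto simp: kA.smult_l_distr kA.smult_r_distr kA.smult_assoc1)

lemma left_noetherian_k: "left_noetherian k"
  by (rule artinian_imp_noetherian[OF k_cring k_artinian])

lemma central_closed [simp]: "c \<in> carrier k \<Longrightarrow> central A c \<in> carrier A"
  by (simp add: central_def)

lemma central_mult:
  assumes "c \<in> carrier k" "x \<in> carrier A"
  shows "central A c \<otimes>\<^bsub>A\<^esub> x = c \<odot>\<^bsub>A\<^esub> x" "x \<otimes>\<^bsub>A\<^esub> central A c = c \<odot>\<^bsub>A\<^esub> x"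
  using assms by (simp_all add: central_def smult_mult)

lemma central_add: "c \<in> carrier k \<Longrightarrow> d \<in> carrier k \<Longrightarrow> central A (c \<oplus>\<^bsub>k\<^esub> d) = central A c \<oplus>\<^bsub>A\<^esub> central A d"
  by (simp add: central_def kA.smult_l_distr)

lemma central_times: "c \<in> carrier k \<Longrightarrow> d \<in> carrier k \<Longrightarrow> central A (c \<otimes>\<^bsub>k\<^esub> d) = central A c \<otimes>\<^bsub>A\<^esub> central A d"
  by (simp add: central_def smult_mult kA.smult_assoc1[symmetric] k.m_comm)

lemma central_one: "central A \<one>\<^bsub>k\<^esub> = \<one>\<^bsub>A\<^esub>"
  by (simp add: central_def)

definition restrict_scalars :: "('a, 'm) module \<Rightarrow> ('k, 'm) module" where
  "restrict_scalars M = \<lparr>carrier = carrier M, mult = undefined, one = undefined, zero = \<zero>\<^bsub>M\<^esub>,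
     add = (\<lambda>x y. x \<oplus>\<^bsub>M\<^esub> y), smult = (\<lambda>c x. central A c \<odot>\<^bsub>M\<^esub> x)\<rparr>"

lemma restrict_scalars_simps [simp]:
  "carrier (restrict_scalars M) = carrier M" "\<zero>\<^bsub>restrict_scalars M\<^esub> = \<zero>\<^bsub>M\<^esub>"
  "x \<oplus>\<^bsub>restrict_scalars M\<^esub> y = x \<oplus>\<^bsub>M\<^esub> y" "c \<odot>\<^bsub>restrict_scalars M\<^esub> x = central A c \<odot>\<^bsub>M\<^esub> x"
  by (simp_all add: restrict_scalars_def)

lemma left_module_restrict_scalars:
  assumes "left_module A M" shows "left_module k (restrict_scalars M)"
proof -
  interpret M: left_module A M by fact
  have "abelian_group (restrict_scalars M)"
  proof (rule abelian_groupI)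
    fix x assume "x \<in> carrier (restrict_scalars M)"
    then show "\<exists>y\<in>carrier (restrict_scalars M). y \<oplus>\<^bsub>restrict_scalars M\<^esub> x = \<zero>\<^bsub>restrict_scalars M\<^esub>"
      by (intro bexI[of _ "\<ominus>\<^bsub>M\<^esub> x"]) (auto simp: M.M.l_neg)
  qed (auto simp: M.M.a_ac)
  then show ?thesis
    by (intro left_module.intro left_module_axioms.intro k.ring_axioms)
       (auto simp: M.smult_closed central_add M.smult_l_distr M.smult_r_distr central_times
          M.smult_assoc1 central_one M.smult_one)
qed

lemma msub_restrict_scalars: "msub A M N \<Longrightarrow> msub k (restrict_scalars M) N"
  by (auto simp: msub_def)

lemma mspan_restrict_scalars:
  assumes "left_module A M" "B \<subseteq> carrier M"
  shows "mspan k (restrict_scalars M) B \<subseteq> mspan A M B"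
  by (intro mspan_least msub_restrict_scalars msub_mspan assms mspan_superset)

lemma noeth_mod_descends:
  assumes M: "left_module A M" and n: "noeth_mod k (restrict_scalars M)" shows "noeth_mod A M"
  unfolding noeth_on_def
proof (intro allI impI, elim conjE)
  fix N assume N: "msub A M N" "N \<subseteq> carrier M"
  obtain B where B: "finite B" "B \<subseteq> N" "mspan k (restrict_scalars M) B = N"
    by (rule noeth_onD[OF n msub_restrict_scalars[OF N(1)]]) (use N in auto)
  have "mspan A M B = N"
    using mspan_restrict_scalars[OF M, of B] B N mspan_least[OF N(1) B(2)] by auto
  then show "\<exists>B. finite B \<and> B \<subseteq> N \<and> mspan A M B = N" using B by blast
qed

lemma left_noetherian: "left_noetherian A"
proof -
  have lm: "left_module A (regular A)" by (rule left_module_regular[OF ring_A])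
  have "A \<in> fgmod k" using left_module_A fin_gen_A by (simp add: fgmod_def)
  then have "noeth_mod k A" by (rule noeth_mod_fgmod[OF left_noetherian_k])
  then have "noeth_mod k (restrict_scalars (regular A))"
    by (rule noeth_mod_injective[OF left_module_restrict_scalars[OF lm] left_module_A, of "restrict (\<lambda>x. x) (carrier A)"])
       (use mhom_restrictI[OF left_module_restrict_scalars[OF lm], of "\<lambda>x. x" A] in \<open>auto simp: central_mult\<close>)
  then show ?thesis using noeth_mod_descends[OF lm] ring_A by (simp add: left_noetherian_def)
qed

text \<open>Products of generators of \<open>A\<close> over \<open>k\<close> with generators of \<open>X\<close> over \<open>A\<close> generate \<open>X\<close> over \<open>k\<close>.\<close>

lemma noeth_restrict_scalars:
  assumes X: "X \<in> fgmod A" shows "noeth_mod k (restrict_scalars X)"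
proof -
  interpret X: left_module A X by (rule fgmod_lm[OF X])
  have lm: "left_module k (restrict_scalars X)" by (rule left_module_restrict_scalars[OF fgmod_lm[OF X]])
  obtain B where B: "finite B" "B \<subseteq> carrier X" "mspan A X B = carrier X"
    using X by (auto simp: fgmod_mspan)
  have "A \<in> fgmod k" using left_module_A fin_gen_A by (simp add: fgmod_def)
  then obtain C where C: "finite C" "C \<subseteq> carrier A" "mspan k A C = carrier A"
    by (auto simp: fgmod_mspan)
  let ?D = "(\<lambda>(c, b). c \<odot>\<^bsub>X\<^esub> b) ` (C \<times> B)"
  let ?S = "mspan k (restrict_scalars X) ?D"
  have Dc: "?D \<subseteq> carrier X" using C B by (auto intro!: X.smult_closed)
  have S: "msub k (restrict_scalars X) ?S" by (rule msub_mspan[OF lm]) (use Dc in auto)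
  note Sd = msubD[OF S, simplified]
  have gen: "a \<odot>\<^bsub>X\<^esub> b \<in> ?S" if "a \<in> carrier A" "b \<in> B" for a b
  proof -
    have "msub k A {a \<in> carrier A. a \<odot>\<^bsub>X\<^esub> b \<in> ?S}"
      unfolding msub_def
    proof (intro conjI ballI)
      fix c x assume cx: "c \<in> carrier k" "x \<in> {a \<in> carrier A. a \<odot>\<^bsub>X\<^esub> b \<in> ?S}"
      then have "(c \<odot>\<^bsub>A\<^esub> x) \<odot>\<^bsub>X\<^esub> b = central A c \<odot>\<^bsub>X\<^esub> (x \<odot>\<^bsub>X\<^esub> b)"
        using that(2) B(2) by (auto simp: central_mult X.smult_assoc1[symmetric] subset_iff)
      then show "c \<odot>\<^bsub>A\<^esub> x \<in> {a \<in> carrier A. a \<odot>\<^bsub>X\<^esub> b \<in> ?S}" using cx Sd(4) by auto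
    qed (use that(2) B(2) Sd(2,3) in \<open>auto simp: X.smult_l_distr subset_iff\<close>)
    moreover have "C \<subseteq> {a \<in> carrier A. a \<odot>\<^bsub>X\<^esub> b \<in> ?S}"
      using C(2) that(2) mspan_superset[of ?D k "restrict_scalars X"] by force
    ultimately have "carrier A \<subseteq> {a \<in> carrier A. a \<odot>\<^bsub>X\<^esub> b \<in> ?S}" unfolding C(3)[symmetric] by (rule mspan_least)
    then show ?thesis using that(1) by blast
  qed
  have "msub A X {x \<in> carrier X. \<forall>a\<in>carrier A. a \<odot>\<^bsub>X\<^esub> x \<in> ?S}"
    using Sd(2,3) by (auto simp: msub_def X.smult_closed X.smult_r_distr X.smult_assoc1[symmetric])
  moreover have "B \<subseteq> {x \<in> carrier X. \<forall>a\<in>carrier A. a \<odot>\<^bsub>X\<^esub> x \<in> ?S}" using gen B(2) by auto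
  ultimately have "carrier X \<subseteq> {x \<in> carrier X. \<forall>a\<in>carrier A. a \<odot>\<^bsub>X\<^esub> x \<in> ?S}"
    unfolding B(3)[symmetric] by (rule mspan_least)
  then have one: "\<one>\<^bsub>A\<^esub> \<odot>\<^bsub>X\<^esub> x \<in> ?S" if "x \<in> carrier X" for x using that A.one_closed by blast
  have "carrier X \<subseteq> ?S"
  proof
    fix x assume "x \<in> carrier X"
    then show "x \<in> ?S" using one[of x] X.smult_one[of x] by (simp only:)
  qed
  then have "restrict_scalars X \<in> fgmod k"
    using B C Dc Sd(1) lm unfolding fgmod_mspan by (intro conjI exI[of _ ?D]) auto
  then show ?thesis by (rule noeth_mod_fgmod[OF left_noetherian_k])
qed

end


section \<open>Isomorphisms, direct sums and short exact sequences\<close>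

lemma (in left_module) smult_neg:
  assumes "a \<in> carrier R" "x \<in> carrier M" shows "a \<odot>\<^bsub>M\<^esub> (\<ominus>\<^bsub>M\<^esub> x) = \<ominus>\<^bsub>M\<^esub> (a \<odot>\<^bsub>M\<^esub> x)"
proof -
  have "a \<odot>\<^bsub>M\<^esub> (\<ominus>\<^bsub>M\<^esub> x) \<oplus>\<^bsub>M\<^esub> a \<odot>\<^bsub>M\<^esub> x = a \<odot>\<^bsub>M\<^esub> (\<ominus>\<^bsub>M\<^esub> x \<oplus>\<^bsub>M\<^esub> x)"
    using assms by (simp add: smult_r_distr)
  then show ?thesis
    using assms by (intro M.minus_equality[symmetric]) (simp_all add: M.l_neg smult_closed)
qed

lemma mhom_restrictI':
  assumes "left_module A M" "D = carrier M" "\<And>x. x \<in> carrier M \<Longrightarrow> f x \<in> carrier N"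
    "\<And>x y. x \<in> carrier M \<Longrightarrow> y \<in> carrier M \<Longrightarrow> f (x \<oplus>\<^bsub>M\<^esub> y) = f x \<oplus>\<^bsub>N\<^esub> f y"
    "\<And>a x. a \<in> carrier A \<Longrightarrow> x \<in> carrier M \<Longrightarrow> f (a \<odot>\<^bsub>M\<^esub> x) = a \<odot>\<^bsub>N\<^esub> f x"
  shows "restrict f D \<in> mhom A M N"
  using mhom_restrictI[OF assms(1,3-5)] assms(2) by simp

lemma mhom_inverse:
  assumes M: "left_module A M" and N: "left_module A N" and f: "f \<in> mhom A M N"
    and bij: "bij_betw f (carrier M) (carrier N)"
  obtains g where "g \<in> mhom A N M" "bij_betw g (carrier N) (carrier M)"
    "\<And>x. x \<in> carrier M \<Longrightarrow> g (f x) = x" "\<And>y. y \<in> carrier N \<Longrightarrow> f (g y) = y"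
proof -
  interpret M: left_module A M by fact
  interpret N: left_module A N by fact
  let ?h = "inv_into (carrier M) f"
  let ?g = "restrict ?h (carrier N)"
  have inj: "inj_on f (carrier M)" and im: "f ` carrier M = carrier N"
    using bij by (auto simp: bij_betw_def)
  have h: "?h y \<in> carrier M" "f (?h y) = y" if "y \<in> carrier N" for y
    using that im inv_into_into[of y f] f_inv_into_f[of y f] by auto
  have gf: "?g (f x) = x" if "x \<in> carrier M" for x
    using that inj mhomD(1)[OF f that] by simp
  have cancel: "?h (f x) = x" if "x \<in> carrier M" for x using that inj by simp
  have "?g \<in> mhom A N M"
  proof (rule mhom_restrictI[OF N])
    fix x y assume x: "x \<in> carrier N" and y: "y \<in> carrier N"
    have "f (?h x \<oplus>\<^bsub>M\<^esub> ?h y) = x \<oplus>\<^bsub>N\<^esub> y" using h x y mhomD(2)[OF f] by simp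
    then show "?h (x \<oplus>\<^bsub>N\<^esub> y) = ?h x \<oplus>\<^bsub>M\<^esub> ?h y"
      using cancel[of "?h x \<oplus>\<^bsub>M\<^esub> ?h y"] h(1) x y by simp
  next
    fix a x assume a: "a \<in> carrier A" and x: "x \<in> carrier N"
    have "f (a \<odot>\<^bsub>M\<^esub> ?h x) = a \<odot>\<^bsub>N\<^esub> x" using h x a mhomD(3)[OF f] by simp
    then show "?h (a \<odot>\<^bsub>N\<^esub> x) = a \<odot>\<^bsub>M\<^esub> ?h x"
      using cancel[of "a \<odot>\<^bsub>M\<^esub> ?h x"] h(1) x a by (simp add: M.smult_closed)
  qed (rule h(1))
  moreover have "bij_betw ?g (carrier N) (carrier M)"
    by (rule bij_betw_byWitness[where f' = f]) (use h gf mhomD(1)[OF f] in auto)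
  moreover have "f (?g y) = y" if "y \<in> carrier N" for y using that h by simp
  ultimately show ?thesis using gf that by blast
qed

lemma misoE:
  assumes "miso A M N"
  obtains f where "f \<in> mhom A M N" "bij_betw f (carrier M) (carrier N)"
  using assms unfolding miso_def by blast

lemma misoI: "f \<in> mhom A M N \<Longrightarrow> bij_betw f (carrier M) (carrier N) \<Longrightarrow> miso A M N"
  unfolding miso_def by blast

lemma misoI2:
  assumes "f \<in> mhom A M N" "g \<in> mhom A N M" "\<And>x. x \<in> carrier M \<Longrightarrow> g (f x) = x"
    "\<And>y. y \<in> carrier N \<Longrightarrow> f (g y) = y"
  shows "miso A M N"
  by (rule misoI[OF assms(1)], rule bij_betw_byWitness[where f' = g])
     (use assms mhomD(1)[OF assms(1)] mhomD(1)[OF assms(2)] in auto)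

lemma miso_refl: "left_module A M \<Longrightarrow> miso A M M"
  by (rule misoI2[OF mid_mhom mid_mhom]) auto

lemma miso_sym:
  assumes "left_module A M" "left_module A N" "miso A M N" shows "miso A N M"
proof -
  obtain f where f: "f \<in> mhom A M N" "bij_betw f (carrier M) (carrier N)" by (rule misoE[OF assms(3)])
  obtain g where "g \<in> mhom A N M" "bij_betw g (carrier N) (carrier M)"
    by (rule mhom_inverse[OF assms(1,2) f]) blast
  then show ?thesis by (rule misoI)
qed

lemma miso_trans:
  assumes L: "left_module A L" and "miso A L M" "miso A M N" shows "miso A L N"
proof -
  obtain f where f: "f \<in> mhom A L M" "bij_betw f (carrier L) (carrier M)" by (rule misoE[OF assms(2)])
  obtain g where g: "g \<in> mhom A M N" "bij_betw g (carrier M) (carrier N)" by (rule misoE[OF assms(3)])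
  show ?thesis
    by (rule misoI[OF mhom_comp[OF L f(1) g(1)]])
       (use bij_betw_trans[OF f(2) g(2)] in \<open>simp add: compose_def comp_def cong: bij_betw_cong\<close>)
qed

lemma zero_module_miso:
  assumes M: "left_module A M" and N: "left_module A N" and f: "miso A M N" and z: "zero_module N"
  shows "zero_module M"
proof -
  interpret M: left_module A M by fact
  obtain f where f: "f \<in> mhom A M N" "bij_betw f (carrier M) (carrier N)" by (rule misoE[OF f])
  have "x = \<zero>\<^bsub>M\<^esub>" if "x \<in> carrier M" for x
    using f z that mhomD(1)[OF f(1) that] mhom_inj_iff[OF M N f(1)]
    unfolding zero_module_def bij_betw_def by blast
  then show ?thesis unfolding zero_module_def by auto
qed

lemma dsum_simps [simp]:
  "carrier (dsum M N) = carrier M \<times> carrier N" "\<zero>\<^bsub>dsum M N\<^esub> = (\<zero>\<^bsub>M\<^esub>, \<zero>\<^bsub>N\<^esub>)"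
  "u \<oplus>\<^bsub>dsum M N\<^esub> v = (fst u \<oplus>\<^bsub>M\<^esub> fst v, snd u \<oplus>\<^bsub>N\<^esub> snd v)"
  "a \<odot>\<^bsub>dsum M N\<^esub> u = (a \<odot>\<^bsub>M\<^esub> fst u, a \<odot>\<^bsub>N\<^esub> snd u)"
  by (simp_all add: dsum_def case_prod_unfold)

lemma left_module_dsum:
  assumes "left_module A M" "left_module A N" shows "left_module A (dsum M N)"
proof -
  interpret M: left_module A M by fact
  interpret N: left_module A N by fact
  have "abelian_group (dsum M N)"
  proof (rule abelian_groupI)
    fix x assume "x \<in> carrier (dsum M N)"
    then show "\<exists>y\<in>carrier (dsum M N). y \<oplus>\<^bsub>dsum M N\<^esub> x = \<zero>\<^bsub>dsum M N\<^esub>"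
      by (intro bexI[of _ "(\<ominus>\<^bsub>M\<^esub> fst x, \<ominus>\<^bsub>N\<^esub> snd x)"]) (auto simp: M.M.l_neg N.M.l_neg)
  qed (auto simp: M.M.a_ac N.M.a_ac)
  then show ?thesis
    by (intro left_module.intro left_module_axioms.intro M.R.ring_axioms)
       (auto simp: M.smult_closed M.smult_l_distr M.smult_r_distr M.smult_assoc1 M.smult_one
          N.smult_closed N.smult_l_distr N.smult_r_distr N.smult_assoc1 N.smult_one)
qed

lemma fgmod_dsum:
  assumes M: "M \<in> fgmod A" and N: "N \<in> fgmod A" shows "dsum M N \<in> fgmod A"
proof -
  interpret M: left_module A M by (rule fgmod_lm[OF M])
  interpret N: left_module A N by (rule fgmod_lm[OF N])
  note lm = left_module_dsum[OF fgmod_lm[OF M] fgmod_lm[OF N]]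
  obtain B where B: "finite B" "B \<subseteq> carrier M" "mspan A M B = carrier M" using M by (auto simp: fgmod_mspan)
  obtain C where C: "finite C" "C \<subseteq> carrier N" "mspan A N C = carrier N" using N by (auto simp: fgmod_mspan)
  let ?i = "restrict (\<lambda>x. (x, \<zero>\<^bsub>N\<^esub>)) (carrier M)" and ?j = "restrict (\<lambda>y. (\<zero>\<^bsub>M\<^esub>, y)) (carrier N)"
  have i: "?i \<in> mhom A M (dsum M N)" by (rule mhom_restrictI[OF fgmod_lm[OF M]]) auto
  have j: "?j \<in> mhom A N (dsum M N)" by (rule mhom_restrictI[OF fgmod_lm[OF N]]) auto
  let ?D = "?i ` B \<union> ?j ` C"
  have D: "?D \<subseteq> carrier (dsum M N)" using B C by auto
  have S: "msub A (dsum M N) (mspan A (dsum M N) ?D)" by (rule msub_mspan[OF lm D])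
  have 1: "?i ` carrier M \<subseteq> mspan A (dsum M N) ?D"
    using mhom_span_subset[OF fgmod_lm[OF M] lm i B(2)] mspan_mono[of "?i ` B" ?D A "dsum M N"] B(3) by auto
  have 2: "?j ` carrier N \<subseteq> mspan A (dsum M N) ?D"
    using mhom_span_subset[OF fgmod_lm[OF N] lm j C(2)] mspan_mono[of "?j ` C" ?D A "dsum M N"] C(3) by auto
  have "carrier (dsum M N) \<subseteq> mspan A (dsum M N) ?D"
  proof
    fix z assume z: "z \<in> carrier (dsum M N)"
    then have "?i (fst z) \<oplus>\<^bsub>dsum M N\<^esub> ?j (snd z) \<in> mspan A (dsum M N) ?D"
      using 1 2 by (intro msubD(3)[OF S]) auto
    then show "z \<in> mspan A (dsum M N) ?D" using z by auto
  qed
  then have "mspan A (dsum M N) ?D = carrier (dsum M N)" using msubD(1)[OF S] by blast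
  moreover have "finite ?D" using B(1) C(1) by simp
  ultimately show ?thesis using D lm unfolding fgmod_mspan by blast
qed

lemma dsum_representative:
  fixes M N :: "'a lmod"
  assumes "M \<in> fgmod A" "N \<in> fgmod A"
  obtains Z :: "'a lmod" where "Z \<in> fgmod A" "miso A Z (dsum M N)"
proof -
  have fg: "dsum M N \<in> fgmod A" by (rule fgmod_dsum[OF assms])
  obtain Z :: "'a lmod" where Z: "Z \<in> fgmod A" "miso A (dsum M N) Z"
    using fgmod_list_representative[OF fg] by blast
  show ?thesis using that[OF Z(1)] miso_sym[OF fgmod_lm[OF fg] fgmod_lm[OF Z(1)] Z(2)] by blast
qed

lemma miso_dsum_cong:
  assumes "left_module A M" "left_module A N" "miso A M M'" "miso A N N'"
  shows "miso A (dsum M N) (dsum M' N')"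
proof -
  obtain f where f: "f \<in> mhom A M M'" "bij_betw f (carrier M) (carrier M')" by (rule misoE[OF assms(3)])
  obtain g where g: "g \<in> mhom A N N'" "bij_betw g (carrier N) (carrier N')" by (rule misoE[OF assms(4)])
  let ?h = "restrict (map_prod f g) (carrier (dsum M N))"
  have "?h \<in> mhom A (dsum M N) (dsum M' N')"
    by (rule mhom_restrictI[OF left_module_dsum[OF assms(1,2)]]) (auto simp: mhomD[OF f(1)] mhomD[OF g(1)])
  moreover have "bij_betw (map_prod f g) (carrier (dsum M N)) (carrier (dsum M' N'))"
    using bij_betw_map_prod[OF f(2) g(2)] by simp
  then have "bij_betw ?h (carrier (dsum M N)) (carrier (dsum M' N'))"
    by (rule bij_betw_cong[THEN iffD1, rotated]) simp
  ultimately show ?thesis by (rule misoI)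
qed

lemma miso_dsum_comm:
  assumes "left_module A M" "left_module A N"
  shows "miso A (dsum M N) (dsum N M)"
  by (rule misoI2[of "restrict prod.swap (carrier (dsum M N))" _ _ _ "restrict prod.swap (carrier (dsum N M))"])
     (auto intro!: mhom_restrictI' left_module_dsum assms)

lemma miso_dsum_assoc:
  assumes "left_module A L" "left_module A M" "left_module A N"
  shows "miso A (dsum (dsum L M) N) (dsum L (dsum M N))"
  by (rule misoI2[of "restrict (\<lambda>((x, y), z). (x, y, z)) (carrier (dsum (dsum L M) N))" _ _ _
        "restrict (\<lambda>(x, y, z). ((x, y), z)) (carrier (dsum L (dsum M N)))"])
     (auto intro!: mhom_restrictI' left_module_dsum assms)

lemma miso_dsum_interchange:
  assumes "left_module A M" "left_module A M'" "left_module A N" "left_module A N'"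
  shows "miso A (dsum (dsum M M') (dsum N N')) (dsum (dsum M N) (dsum M' N'))"
  by (rule misoI2[of "restrict (\<lambda>((x, x'), (y, y')). ((x, y), (x', y'))) (carrier (dsum (dsum M M') (dsum N N')))" _ _ _
        "restrict (\<lambda>((x, x'), (y, y')). ((x, y), (x', y'))) (carrier (dsum (dsum M N) (dsum M' N')))"])
     (auto intro!: mhom_restrictI' left_module_dsum assms)

lemma miso_dsum_zero:
  assumes "left_module A M" "left_module A N" "zero_module N"
  shows "miso A M (dsum M N)"
proof -
  interpret M: left_module A M by fact
  interpret N: left_module A N by fact
  have N: "carrier N = {\<zero>\<^bsub>N\<^esub>}" using assms(3) by (simp add: zero_module_def)
  have N0: "y = \<zero>\<^bsub>N\<^esub>" if "y \<in> carrier N" for y using that N by blast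
  have f: "restrict (\<lambda>x. (x, \<zero>\<^bsub>N\<^esub>)) (carrier M) \<in> mhom A M (dsum M N)"
    by (rule mhom_restrictI[OF assms(1)]) auto
  have g: "restrict fst (carrier (dsum M N)) \<in> mhom A (dsum M N) M"
    by (rule mhom_restrictI[OF left_module_dsum[OF assms(1,2)]]) auto
  show ?thesis by (rule misoI2[OF f g]) (auto dest: N0)
qed

lemma short_exactD:
  assumes "short_exact A U f X g V"
  shows "f \<in> mhom A U X" "g \<in> mhom A X V" "inj_on f (carrier U)"
    "\<And>u. u \<in> carrier U \<Longrightarrow> g (f u) = \<zero>\<^bsub>V\<^esub>"
    "\<And>x. x \<in> carrier X \<Longrightarrow> g x = \<zero>\<^bsub>V\<^esub> \<Longrightarrow> \<exists>u\<in>carrier U. x = f u"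
    "g ` carrier X = carrier V"
  using assms unfolding short_exact_def by blast+

lemma short_exactI:
  assumes "f \<in> mhom A U X" "g \<in> mhom A X V" "inj_on f (carrier U)"
    "\<And>u. u \<in> carrier U \<Longrightarrow> g (f u) = \<zero>\<^bsub>V\<^esub>"
    "\<And>x. x \<in> carrier X \<Longrightarrow> g x = \<zero>\<^bsub>V\<^esub> \<Longrightarrow> \<exists>u\<in>carrier U. x = f u"
    "\<And>v. v \<in> carrier V \<Longrightarrow> \<exists>x\<in>carrier X. v = g x"
  shows "short_exact A U f X g V"
  unfolding short_exact_def using assms mhomD(1)[OF assms(1)] mhomD(1)[OF assms(2)] by blast

lemma short_exact_kernel:
  assumes X: "left_module A X" and V: "left_module A V" and g: "g \<in> mhom A X V"
    and onto: "g ` carrier X = carrier V"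
  shows "short_exact A (mker X V g) (mid (mker X V g)) X g V"
proof (rule short_exactI)
  have "left_module A (mker X V g)"
    unfolding mker_def by (rule left_module_submod[OF X msub_kernel[OF X V g]])
  then have "mid (mker X V g) \<in> mhom A (mker X V g) (mker X V g)" by (rule mid_mhom)
  then show "mid (mker X V g) \<in> mhom A (mker X V g) X"
    unfolding mhom_def by (auto simp: mker_def)
  show "inj_on (mid (mker X V g)) (carrier (mker X V g))" by (rule inj_onI) simp
qed (use g onto in \<open>auto simp: mker_def mid_def\<close>)

lemma short_exact_iso:
  assumes lm: "left_module A U'" "left_module A X'" "left_module A U" "left_module A X" "left_module A V"  "left_module A V'"
    and iso: "miso A U' U" "miso A X' X" "miso A V' V" and ses: "short_exact A U f X g V"
  obtains f' g' where "short_exact A U' f' X' g' V'"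
proof -
  note s = short_exactD[OF ses]
  obtain u where u: "u \<in> mhom A U' U" "bij_betw u (carrier U') (carrier U)" by (rule misoE[OF iso(1)])
  obtain x where x: "x \<in> mhom A X' X" "bij_betw x (carrier X') (carrier X)" by (rule misoE[OF iso(2)])
  obtain v where v: "v \<in> mhom A V' V" "bij_betw v (carrier V') (carrier V)" by (rule misoE[OF iso(3)])
  obtain x' where x': "x' \<in> mhom A X X'" "bij_betw x' (carrier X) (carrier X')"
    "\<And>z. z \<in> carrier X' \<Longrightarrow> x' (x z) = z" "\<And>z. z \<in> carrier X \<Longrightarrow> x (x' z) = z"
    by (rule mhom_inverse[OF lm(2,4) x]) blast
  obtain v' where v': "v' \<in> mhom A V V'" "bij_betw v' (carrier V) (carrier V')"
    "\<And>z. z \<in> carrier V' \<Longrightarrow> v' (v z) = z" "\<And>z. z \<in> carrier V \<Longrightarrow> v (v' z) = z"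
    by (rule mhom_inverse[OF lm(6,5) v]) blast
  let ?f = "compose (carrier U') x' (compose (carrier U') f u)"
  let ?g = "compose (carrier X') v' (compose (carrier X') g x)"
  have uim: "u ` carrier U' = carrier U" and uinj: "inj_on u (carrier U')" using u(2) by (auto simp: bij_betw_def)
  have x'inj: "inj_on x' (carrier X)" using x'(2) by (auto simp: bij_betw_def)
  note cl = mhomD(1)[OF u(1)] mhomD(1)[OF x(1)] mhomD(1)[OF v(1)] mhomD(1)[OF x'(1)] mhomD(1)[OF v'(1)]
    mhomD(1)[OF s(1)] mhomD(1)[OF s(2)]
  have "short_exact A U' ?f X' ?g V'"
  proof (rule short_exactI)
    show "?f \<in> mhom A U' X'" by (rule mhom_comp[OF lm(1) mhom_comp[OF lm(1) u(1) s(1)] x'(1)])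
    show "?g \<in> mhom A X' V'" by (rule mhom_comp[OF lm(2) mhom_comp[OF lm(2) x(1) s(2)] v'(1)])
    show "inj_on ?f (carrier U')"
    proof (rule inj_onI)
      fix a b assume ab: "a \<in> carrier U'" "b \<in> carrier U'" "?f a = ?f b"
      then have "x' (f (u a)) = x' (f (u b))" by (simp add: compose_def)
      then have "f (u a) = f (u b)" using ab by (intro inj_onD[OF x'inj]) (auto intro: cl)
      then have "u a = u b" using ab by (intro inj_onD[OF s(3)]) (auto intro: cl)
      then show "a = b" using ab by (intro inj_onD[OF uinj])
    qed
    show "?g (?f a) = \<zero>\<^bsub>V'\<^esub>" if "a \<in> carrier U'" for a
      using that cl s(4) x'(4) mhom_zero[OF lm(5,6) v'(1)] by (simp add: compose_def)
    show "\<exists>a\<in>carrier U'. z = ?f a" if z: "z \<in> carrier X'" "?g z = \<zero>\<^bsub>V'\<^esub>" for z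
    proof -
      have "v' (g (x z)) = \<zero>\<^bsub>V'\<^esub>" using z by (simp add: compose_def)
      then have "g (x z) = \<zero>\<^bsub>V\<^esub>"
        using v'(4)[of "g (x z)"] z cl mhom_zero[OF lm(6,5) v(1)] by simp
      then obtain b where b: "b \<in> carrier U" "x z = f b"
        using s(5)[OF mhomD(1)[OF x(1) z(1)]] by blast
      then obtain a where a: "a \<in> carrier U'" "b = u a" using uim by blast
      have "z = ?f a" using a b z x'(3)[OF z(1)] by (simp add: compose_def)
      then show ?thesis using a by blast
    qed
    show "\<exists>z\<in>carrier X'. w = ?g z" if w: "w \<in> carrier V'" for w
    proof -
      obtain y where y: "y \<in> carrier X" "v w = g y" using s(6) cl w by blast
      have "w = ?g (x' y)" using y w v'(3)[OF w] x'(4)[OF y(1)] cl by (simp add: compose_def)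
      then show ?thesis using cl y by blast
    qed
  qed
  then show ?thesis by (rule that)
qed

lemma short_exact_dsum:
  assumes lm: "left_module A U" "left_module A X" "left_module A U'" "left_module A X'"
    and ses: "short_exact A U f X g V" "short_exact A U' f' X' g' V'"
  obtains a b where "short_exact A (dsum U U') a (dsum X X') b (dsum V V')"
proof -
  note s = short_exactD[OF ses(1)] and s' = short_exactD[OF ses(2)]
  let ?a = "restrict (map_prod f f') (carrier (dsum U U'))"
  let ?b = "restrict (map_prod g g') (carrier (dsum X X'))"
  note m = mhomD[OF s(1)] mhomD[OF s(2)] mhomD[OF s'(1)] mhomD[OF s'(2)]
  have "short_exact A (dsum U U') ?a (dsum X X') ?b (dsum V V')"
  proof (rule short_exactI)
    show "?a \<in> mhom A (dsum U U') (dsum X X')"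
      by (rule mhom_restrictI) (auto intro: left_module_dsum lm simp: m)
    show "?b \<in> mhom A (dsum X X') (dsum V V')"
      by (rule mhom_restrictI) (auto intro: left_module_dsum lm simp: m)
    show "inj_on ?a (carrier (dsum U U'))"
      using map_prod_inj_on[OF s(3) s'(3)] by (simp add: inj_on_def)
    show "?b (?a u) = \<zero>\<^bsub>dsum V V'\<^esub>" if "u \<in> carrier (dsum U U')" for u
      using that s(4) s'(4) by (auto simp: m)
    show "\<exists>u\<in>carrier (dsum U U'). x = ?a u" if x: "x \<in> carrier (dsum X X')" "?b x = \<zero>\<^bsub>dsum V V'\<^esub>" for x
    proof -
      obtain p q where pq: "x = (p, q)" by (cases x)
      obtain u where u: "u \<in> carrier U" "p = f u" using s(5)[of p] x pq by auto
      obtain u' where u': "u' \<in> carrier U'" "q = f' u'" using s'(5)[of q] x pq by auto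
      show ?thesis using u u' pq by (intro bexI[of _ "(u, u')"]) auto
    qed
    show "\<exists>x\<in>carrier (dsum X X'). v = ?b x" if v: "v \<in> carrier (dsum V V')" for v
    proof -
      obtain p q where pq: "v = (p, q)" by (cases v)
      obtain x where x: "x \<in> carrier X" "p = g x" using s(6) v pq by auto
      obtain x' where x': "x' \<in> carrier X'" "q = g' x'" using s'(6) v pq by auto
      show ?thesis using x x' pq by (intro bexI[of _ "(x, x')"]) auto
    qed
  qed
  then show ?thesis by (rule that)
qed

lemma short_exact_retraction_iso:
  assumes lm: "left_module A U" "left_module A X" "left_module A V"
    and ses: "short_exact A U f X g V" and r: "r \<in> mhom A X U" "\<And>u. u \<in> carrier U \<Longrightarrow> r (f u) = u"
  shows "miso A X (dsum U V)"
proof -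
  interpret U: left_module A U by fact
  interpret X: left_module A X by fact
  interpret V: left_module A V by fact
  note s = short_exactD[OF ses]
  note cl = mhomD(1)[OF s(1)] mhomD(1)[OF s(2)] mhomD(1)[OF r(1)]
  let ?h = "restrict (\<lambda>x. (r x, g x)) (carrier X)"
  have h: "?h \<in> mhom A X (dsum U V)"
    by (rule mhom_restrictI[OF lm(2)]) (auto simp: mhomD[OF r(1)] mhomD[OF s(2)])
  have "inj_on ?h (carrier X)"
    unfolding mhom_inj_iff[OF lm(2) left_module_dsum[OF lm(1,3)] h]
  proof (intro ballI impI)
    fix x assume x: "x \<in> carrier X" "?h x = \<zero>\<^bsub>dsum U V\<^esub>"
    then obtain u where u: "u \<in> carrier U" "x = f u" using s(5)[of x] by auto
    have "u = \<zero>\<^bsub>U\<^esub>" using x u r(2)[of u] by simp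
    then show "x = \<zero>\<^bsub>X\<^esub>" using u mhom_zero[OF lm(1,2) s(1)] by simp
  qed
  moreover have "?h ` carrier X = carrier (dsum U V)"
  proof
    show "?h ` carrier X \<subseteq> carrier (dsum U V)" using cl by auto
    show "carrier (dsum U V) \<subseteq> ?h ` carrier X"
    proof
      fix w assume w: "w \<in> carrier (dsum U V)"
      obtain u v where uv: "w = (u, v)" by (cases w)
      have c: "u \<in> carrier U" "v \<in> carrier V" using w uv by auto
      obtain x where x: "x \<in> carrier X" "v = g x" using s(6) c by blast
      let ?y = "f (u \<ominus>\<^bsub>U\<^esub> r x) \<oplus>\<^bsub>X\<^esub> x"
      have d: "u \<ominus>\<^bsub>U\<^esub> r x \<in> carrier U" using c x cl by simp
      have y: "?y \<in> carrier X" using d x cl by simp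
      have "r ?y = u" using d x cl c by (simp add: mhomD(2)[OF r(1)] r(2))
      moreover have "g ?y = v" using d x cl c by (simp add: mhomD(2)[OF s(2)] s(4))
      ultimately show "w \<in> ?h ` carrier X" using y uv by (intro image_eqI[of _ _ ?y]) auto
    qed
  qed
  ultimately show ?thesis by (intro misoI[OF h]) (simp add: bij_betw_def)
qed

lemma short_exact_section_retraction:
  assumes lm: "left_module A U" "left_module A X" "left_module A V"
    and ses: "short_exact A U f X g V" and t: "t \<in> mhom A V X" "\<And>v. v \<in> carrier V \<Longrightarrow> g (t v) = v"
  obtains r where "r \<in> mhom A X U" "\<And>u. u \<in> carrier U \<Longrightarrow> r (f u) = u"
    "\<And>x. x \<in> carrier X \<Longrightarrow> f (r x) = x \<ominus>\<^bsub>X\<^esub> t (g x)"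
proof -
  interpret U: left_module A U by fact
  interpret X: left_module A X by fact
  interpret V: left_module A V by fact
  note s = short_exactD[OF ses]
  note cl = mhomD(1)[OF s(1)] mhomD(1)[OF s(2)] mhomD(1)[OF t(1)]
  have "\<exists>u\<in>carrier U. x \<ominus>\<^bsub>X\<^esub> t (g x) = f u" if x: "x \<in> carrier X" for x
    by (rule s(5)) (use x cl t(2) in \<open>simp_all add: mhom_minus[OF lm(2,3) s(2)]\<close>)
  then obtain r where r: "\<And>x. x \<in> carrier X \<Longrightarrow> r x \<in> carrier U"
    "\<And>x. x \<in> carrier X \<Longrightarrow> f (r x) = x \<ominus>\<^bsub>X\<^esub> t (g x)"
    using bchoice[of "carrier X" "\<lambda>x u. u \<in> carrier U \<and> x \<ominus>\<^bsub>X\<^esub> t (g x) = f u"] by metis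
  have "restrict r (carrier X) \<in> mhom A X U"
  proof (rule mhom_restrictI[OF lm(2) r(1)])
    fix x y assume xy: "x \<in> carrier X" "y \<in> carrier X"
    have "f (r (x \<oplus>\<^bsub>X\<^esub> y)) = f (r x \<oplus>\<^bsub>U\<^esub> r y)"
      using xy cl r by (simp add: mhomD(2)[OF s(1)] mhomD(2)[OF s(2)] mhomD(2)[OF t(1)] X.M.minus_eq X.M.minus_add X.M.a_ac)
    then show "r (x \<oplus>\<^bsub>X\<^esub> y) = r x \<oplus>\<^bsub>U\<^esub> r y"
      by (rule inj_onD[OF s(3)]) (use xy r(1) in auto)
  next
    fix a x assume ax: "a \<in> carrier A" "x \<in> carrier X"
    have "a \<odot>\<^bsub>X\<^esub> (\<ominus>\<^bsub>X\<^esub> t (g x)) = \<ominus>\<^bsub>X\<^esub> t (g (a \<odot>\<^bsub>X\<^esub> x))"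
      using ax cl by (simp add: X.smult_neg mhomD(3)[OF s(2)] mhomD(3)[OF t(1)])
    then have "f (r (a \<odot>\<^bsub>X\<^esub> x)) = f (a \<odot>\<^bsub>U\<^esub> r x)"
      using ax cl r by (simp add: mhomD(3)[OF s(1)] X.smult_closed X.M.minus_eq X.smult_r_distr)
    then show "r (a \<odot>\<^bsub>X\<^esub> x) = a \<odot>\<^bsub>U\<^esub> r x"
      by (rule inj_onD[OF s(3)]) (use ax r(1) in \<open>auto intro: X.smult_closed U.smult_closed\<close>)
  qed
  moreover have "restrict r (carrier X) (f u) = u" if u: "u \<in> carrier U" for u
  proof -
    have "f (r (f u)) = f u"
      using u cl r(2)[of "f u"] s(4)[OF u] mhom_zero[OF lm(3,2) t(1)] by (simp add: X.M.minus_eq)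
    then have "r (f u) = u" by (rule inj_onD[OF s(3)]) (use u cl r(1) in auto)
    then show ?thesis using u cl by simp
  qed
  moreover have "f (restrict r (carrier X) x) = x \<ominus>\<^bsub>X\<^esub> t (g x)" if "x \<in> carrier X" for x
    using r(2)[OF that] that by simp
  ultimately show ?thesis using that by blast
qed

lemma dsum_short_exact:
  assumes lm: "left_module A Z" "left_module A U" "left_module A V" and iso: "miso A Z (dsum U V)"
  obtains f g r where "short_exact A U f Z g V" "r \<in> mhom A Z U" "\<And>u. u \<in> carrier U \<Longrightarrow> r (f u) = u"
proof -
  interpret U: left_module A U by fact
  interpret V: left_module A V by fact
  obtain h where h: "h \<in> mhom A Z (dsum U V)" "bij_betw h (carrier Z) (carrier (dsum U V))" by (rule misoE[OF iso])
  obtain k where k: "k \<in> mhom A (dsum U V) Z" "\<And>z. z \<in> carrier Z \<Longrightarrow> k (h z) = z"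
    "\<And>w. w \<in> carrier (dsum U V) \<Longrightarrow> h (k w) = w"
    by (rule mhom_inverse[OF lm(1) left_module_dsum[OF lm(2,3)] h]) blast
  let ?f = "restrict (\<lambda>u. k (u, \<zero>\<^bsub>V\<^esub>)) (carrier U)"
  let ?g = "restrict (\<lambda>z. snd (h z)) (carrier Z)" and ?r = "restrict (\<lambda>z. fst (h z)) (carrier Z)"
  have hc: "fst (h z) \<in> carrier U" "snd (h z) \<in> carrier V" if "z \<in> carrier Z" for z
    using mhomD(1)[OF h(1) that] by auto
  have f: "?f \<in> mhom A U Z"
  proof (rule mhom_restrictI[OF lm(2)])
    fix x y assume xy: "x \<in> carrier U" "y \<in> carrier U"
    then show "k (x \<oplus>\<^bsub>U\<^esub> y, \<zero>\<^bsub>V\<^esub>) = k (x, \<zero>\<^bsub>V\<^esub>) \<oplus>\<^bsub>Z\<^esub> k (y, \<zero>\<^bsub>V\<^esub>)"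
      using mhomD(2)[OF k(1), of "(x, \<zero>\<^bsub>V\<^esub>)" "(y, \<zero>\<^bsub>V\<^esub>)"] by simp
  next
    fix a x assume ax: "a \<in> carrier A" "x \<in> carrier U"
    then show "k (a \<odot>\<^bsub>U\<^esub> x, \<zero>\<^bsub>V\<^esub>) = a \<odot>\<^bsub>Z\<^esub> k (x, \<zero>\<^bsub>V\<^esub>)"
      using mhomD(3)[OF k(1), of a "(x, \<zero>\<^bsub>V\<^esub>)"] by simp
  qed (use mhomD(1)[OF k(1)] in auto)
  have g: "?g \<in> mhom A Z V" by (rule mhom_restrictI[OF lm(1)]) (use hc in \<open>auto simp: mhomD[OF h(1)]\<close>)
  have r: "?r \<in> mhom A Z U" by (rule mhom_restrictI[OF lm(1)]) (use hc in \<open>auto simp: mhomD[OF h(1)]\<close>)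
  have kc: "k w \<in> carrier Z" if "w \<in> carrier (dsum U V)" for w using mhomD(1)[OF k(1) that] .
  have rf: "?r (?f u) = u" if "u \<in> carrier U" for u using that kc k(3) by simp
  have "short_exact A U ?f Z ?g V"
  proof (rule short_exactI[OF f g])
    show "inj_on ?f (carrier U)" by (rule inj_on_inverseI[of _ ?r]) (rule rf)
    show "?g (?f u) = \<zero>\<^bsub>V\<^esub>" if "u \<in> carrier U" for u using that kc k(3) by simp
    show "\<exists>u\<in>carrier U. z = ?f u" if z: "z \<in> carrier Z" "?g z = \<zero>\<^bsub>V\<^esub>" for z
    proof (intro bexI[of _ "fst (h z)"])
      have "h z = (fst (h z), \<zero>\<^bsub>V\<^esub>)" using z by (simp add: prod_eq_iff)
      then show "z = ?f (fst (h z))" using k(2)[OF z(1)] hc[OF z(1)] by simp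
    qed (use hc z in auto)
    show "\<exists>z\<in>carrier Z. v = ?g z" if "v \<in> carrier V" for v
      using that kc k(3) by (intro bexI[of _ "k (\<zero>\<^bsub>U\<^esub>, v)"]) auto
  qed
  then show ?thesis using r rf by (rule that)
qed


section \<open>Exact functors\<close>

locale mod_functor =
  fixes A :: "('a, 'x) ring_scheme" and B :: "('b, 'y) ring_scheme" and E :: "('a, 'b) mfunctor"
  assumes functorial: "is_functor A B E"
begin

lemma obj_fg [simp, intro]: "M \<in> fgmod A \<Longrightarrow> obj E M \<in> fgmod B"
  using functorial by (simp add: is_functor_def)

lemma obj_lm [simp, intro]: "M \<in> fgmod A \<Longrightarrow> left_module B (obj E M)"
  by (rule fgmod_lm) simp

lemma arr_hom: "M \<in> fgmod A \<Longrightarrow> N \<in> fgmod A \<Longrightarrow> f \<in> mhom A M N \<Longrightarrow> arr E M N f \<in> mhom B (obj E M) (obj E N)"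
  using functorial by (simp add: is_functor_def)

lemma arr_mid: "M \<in> fgmod A \<Longrightarrow> arr E M M (mid M) = mid (obj E M)"
  using functorial by (simp add: is_functor_def)

lemma arr_compose:
  assumes "L \<in> fgmod A" "M \<in> fgmod A" "N \<in> fgmod A" "f \<in> mhom A L M" "g \<in> mhom A M N"
  shows "arr E L N (compose (carrier L) g f) = compose (carrier (obj E L)) (arr E M N g) (arr E L M f)"
  using functorial assms by (simp add: is_functor_def)

text \<open>Functoriality in pointwise form, for a composite \<open>h\<close> that need not be written with
  \<^const>\<open>compose\<close>.\<close>

lemma arr_comp_apply:
  assumes "L \<in> fgmod A" "M \<in> fgmod A" "N \<in> fgmod A" "f \<in> mhom A L M" "g \<in> mhom A M N" "h \<in> mhom A L N"
    "\<And>x. x \<in> carrier L \<Longrightarrow> h x = g (f x)" "y \<in> carrier (obj E L)"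
  shows "arr E L N h y = arr E M N g (arr E L M f y)"
proof -
  have "h = compose (carrier L) g f"
    by (rule mhom_eqI[OF assms(6) mhom_comp[OF fgmod_lm[OF assms(1)] assms(4,5)]])
       (simp add: assms(7) compose_def)
  then show ?thesis using arr_compose[OF assms(1-5)] assms(8) by (simp add: compose_def)
qed

lemma arr_id_apply:
  assumes "M \<in> fgmod A" "f \<in> mhom A M M" "\<And>x. x \<in> carrier M \<Longrightarrow> f x = x" "y \<in> carrier (obj E M)"
  shows "arr E M M f y = y"
proof -
  have "f = mid M" by (rule mhom_eqI[OF assms(2) mid_mhom[OF fgmod_lm[OF assms(1)]]]) (simp add: assms(3))
  then show ?thesis using arr_mid[OF assms(1)] assms(4) by simp
qed

lemma arr_inverse:
  assumes M: "M \<in> fgmod A" and N: "N \<in> fgmod A" and f: "f \<in> mhom A M N" and g: "g \<in> mhom A N M"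
    and gf: "\<And>x. x \<in> carrier M \<Longrightarrow> g (f x) = x" and y: "y \<in> carrier (obj E M)"
  shows "arr E N M g (arr E M N f y) = y"
proof -
  have "arr E M M (mid M) y = arr E N M g (arr E M N f y)"
    by (rule arr_comp_apply[OF M N M f g mid_mhom[OF fgmod_lm[OF M]] _ y]) (simp add: gf)
  then show ?thesis using arr_mid[OF M] y by simp
qed

lemma obj_miso:
  assumes M: "M \<in> fgmod A" and N: "N \<in> fgmod A" and iso: "miso A M N"
  shows "miso B (obj E M) (obj E N)"
proof -
  obtain f where f: "f \<in> mhom A M N" "bij_betw f (carrier M) (carrier N)" by (rule misoE[OF iso])
  obtain g where g: "g \<in> mhom A N M" "\<And>x. x \<in> carrier M \<Longrightarrow> g (f x) = x" "\<And>y. y \<in> carrier N \<Longrightarrow> f (g y) = y"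
    by (rule mhom_inverse[OF fgmod_lm[OF M] fgmod_lm[OF N] f]) blast
  show ?thesis
    by (rule misoI2[OF arr_hom[OF M N f(1)] arr_hom[OF N M g(1)]])
       (auto intro: arr_inverse[OF M N f(1) g(1)] arr_inverse[OF N M g(1) f(1)] g)
qed

end

locale exact_mod_functor = mod_functor A B E
  for A :: "('a, 'x) ring_scheme" and B :: "('b, 'y) ring_scheme" and E :: "('a, 'b) mfunctor" +
  assumes exact: "exact_functor A B E" and noeth: "left_noetherian A"
begin

lemma preserves_exact:
  assumes "U \<in> fgmod A" "X \<in> fgmod A" "V \<in> fgmod A" "short_exact A U f X g V"
  shows "short_exact B (obj E U) (arr E U X f) (obj E X) (arr E X V g) (obj E V)"
  using exact assms unfolding exact_functor_def by blast

lemma kernel_fg: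
  assumes "X \<in> fgmod A" "left_module A V" "g \<in> mhom A X V" shows "mker X V g \<in> fgmod A"
  unfolding mker_def using fgmod_submod[OF noeth assms(1) msub_kernel[OF fgmod_lm[OF assms(1)] assms(2,3)]] .

lemma arr_onto:
  assumes X: "X \<in> fgmod A" and V: "V \<in> fgmod A" and g: "g \<in> mhom A X V" and onto: "g ` carrier X = carrier V"
  shows "arr E X V g ` carrier (obj E X) = carrier (obj E V)"
  using preserves_exact[OF kernel_fg[OF X fgmod_lm[OF V] g] X V
    short_exact_kernel[OF fgmod_lm[OF X] fgmod_lm[OF V] g onto]]
  by (rule short_exactD)

text \<open>A monomorphism is the kernel of its cokernel.\<close>

lemma arr_inj:
  assumes U: "U \<in> fgmod A" and X: "X \<in> fgmod A" and f: "f \<in> mhom A U X" and inj: "inj_on f (carrier U)"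
  shows "inj_on (arr E U X f) (carrier (obj E U))"
proof -
  note lU = fgmod_lm[OF U] and lX = fgmod_lm[OF X]
  have sub: "msub A X (f ` carrier U)" by (rule msub_image[OF lU lX f msub_carrier[OF lU]])
  obtain Q :: "'a lmod" and p where Q: "Q \<in> fgmod A" "p \<in> mhom A X Q" "p ` carrier X = carrier Q"
    "{x \<in> carrier X. p x = \<zero>\<^bsub>Q\<^esub>} = f ` carrier U"
    by (rule quotient_exists[OF X sub])
  have "short_exact A U f X p Q" unfolding short_exact_def using f inj Q by auto
  from preserves_exact[OF U X Q(1) this] show ?thesis by (rule short_exactD)
qed

text \<open>The map \<open>f\<close> factors through an epimorphism onto the kernel of \<open>g\<close>, and \<open>g\<close> through the inclusion of
  its image; the functor respects epimorphisms, monomorphisms and the short exact sequence in between.\<close>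

lemma arr_exact:
  assumes X: "X \<in> fgmod A" and Y: "Y \<in> fgmod A" and Z: "Z \<in> fgmod A"
    and f: "f \<in> mhom A X Y" and g: "g \<in> mhom A Y Z"
    and ex: "f ` carrier X = {y \<in> carrier Y. g y = \<zero>\<^bsub>Z\<^esub>}"
  shows "arr E X Y f ` carrier (obj E X) = {y \<in> carrier (obj E Y). arr E Y Z g y = \<zero>\<^bsub>obj E Z\<^esub>}"
proof -
  note lX = fgmod_lm[OF X] and lY = fgmod_lm[OF Y] and lZ = fgmod_lm[OF Z]
  let ?K = "mker Y Z g" and ?I = "submod Z (g ` carrier Y)"
  have K: "?K \<in> fgmod A" by (rule kernel_fg[OF Y lZ g])
  have subI: "msub A Z (g ` carrier Y)" by (rule msub_image[OF lY lZ g msub_carrier[OF lY]])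
  have I: "?I \<in> fgmod A" by (rule fgmod_submod[OF noeth Z subI])
  have fK: "f \<in> mhom A X ?K" using f ex by (auto simp: mhom_def mker_def)
  have gI: "g \<in> mhom A Y ?I" using g by (auto simp: mhom_def)
  have kerI: "mker Y ?I g = ?K" by (simp add: mker_def)
  have iK: "mid ?K \<in> mhom A ?K Y"
    using mid_mhom[OF fgmod_lm[OF K]] by (auto simp: mhom_def mker_def)
  have iI: "mid ?I \<in> mhom A ?I Z" using mid_mhom[OF fgmod_lm[OF I]] subI by (auto simp: mhom_def msub_def)
  have "short_exact A ?K (mid ?K) Y g ?I"
    using short_exact_kernel[OF lY fgmod_lm[OF I] gI] unfolding kerI by simp
  note s = short_exactD[OF preserves_exact[OF K Y I this]]
  have 1: "arr E X Y f x = arr E ?K Y (mid ?K) (arr E X ?K f x)" if "x \<in> carrier (obj E X)" for x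
    by (rule arr_comp_apply[OF X K Y fK iK f _ that]) (use mhomD(1)[OF fK] in auto)
  have 2: "arr E Y Z g y = arr E ?I Z (mid ?I) (arr E Y ?I g y)" if "y \<in> carrier (obj E Y)" for y
    by (rule arr_comp_apply[OF Y I Z gI iI g _ that]) auto
  have onto: "arr E X ?K f ` carrier (obj E X) = carrier (obj E ?K)"
    by (rule arr_onto[OF X K fK]) (simp add: mker_def ex)
  have "inj_on (arr E ?I Z (mid ?I)) (carrier (obj E ?I))"
    by (rule arr_inj[OF I Z iI]) (auto simp: inj_on_def)
  then have 3: "arr E Y Z g y = \<zero>\<^bsub>obj E Z\<^esub> \<longleftrightarrow> arr E Y ?I g y = \<zero>\<^bsub>obj E ?I\<^esub>" if "y \<in> carrier (obj E Y)" for y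
    using mhom_inj_iff[OF obj_lm[OF I] obj_lm[OF Z] arr_hom[OF I Z iI]] 2[OF that] mhomD(1)[OF s(2) that]
      mhom_zero[OF obj_lm[OF I] obj_lm[OF Z] arr_hom[OF I Z iI]] by metis
  have "arr E X Y f ` carrier (obj E X) = arr E ?K Y (mid ?K) ` carrier (obj E ?K)"
    unfolding onto[symmetric] image_image by (rule image_cong[OF refl 1])
  also have "\<dots> = {y \<in> carrier (obj E Y). arr E Y ?I g y = \<zero>\<^bsub>obj E ?I\<^esub>}"
    using s(4,5) mhomD(1)[OF s(1)] by blast
  also have "\<dots> = {y \<in> carrier (obj E Y). arr E Y Z g y = \<zero>\<^bsub>obj E Z\<^esub>}" using 3 by blast
  finally show ?thesis .
qed

lemma obj_dsum:
  assumes Z: "Z \<in> fgmod A" and U: "U \<in> fgmod A" and V: "V \<in> fgmod A" and iso: "miso A Z (dsum U V)"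
  shows "miso B (obj E Z) (dsum (obj E U) (obj E V))"
proof -
  obtain f g r where s: "short_exact A U f Z g V" and r: "r \<in> mhom A Z U" "\<And>u. u \<in> carrier U \<Longrightarrow> r (f u) = u"
    by (rule dsum_short_exact[OF fgmod_lm[OF Z] fgmod_lm[OF U] fgmod_lm[OF V] iso]) blast
  show ?thesis
    by (rule short_exact_retraction_iso[OF obj_lm[OF U] obj_lm[OF Z] obj_lm[OF V] preserves_exact[OF U Z V s]
          arr_hom[OF Z U r(1)]])
       (rule arr_inverse[OF U Z short_exactD(1)[OF s] r])
qed

text \<open>Additivity: a sum \<open>f + g\<close> is the composite of the diagonal \<open>M \<rightarrow> M \<oplus> M\<close> with \<open>(f, g)\<close>, and the
  functor respects the two split exact sequences that make up \<open>M \<oplus> M\<close>.\<close>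

lemma arr_add:
  assumes M: "M \<in> fgmod A" and N: "N \<in> fgmod A" and f: "f \<in> mhom A M N" and g: "g \<in> mhom A M N"
    and h: "h \<in> mhom A M N" and hfg: "\<And>x. x \<in> carrier M \<Longrightarrow> h x = f x \<oplus>\<^bsub>N\<^esub> g x"
    and y: "y \<in> carrier (obj E M)"
  shows "arr E M N h y = arr E M N f y \<oplus>\<^bsub>obj E N\<^esub> arr E M N g y"
proof -
  note lM = fgmod_lm[OF M] and lN = fgmod_lm[OF N]
  interpret M: left_module A M by (rule lM)
  interpret N: left_module A N by (rule lN)
  interpret EM: left_module B "obj E M" by (rule obj_lm[OF M])
  interpret EN: left_module B "obj E N" by (rule obj_lm[OF N])
  obtain Z :: "'a lmod" and q where Z: "Z \<in> fgmod A" "q \<in> mhom A (dsum M M) Z"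
    "bij_betw q (carrier (dsum M M)) (carrier Z)"
    by (rule list_representative[OF fgmod_dsum[OF M M]])
  note lZ = fgmod_lm[OF Z(1)] and lMM = left_module_dsum[OF lM lM]
  interpret EZ: left_module B "obj E Z" by (rule obj_lm[OF Z(1)])
  obtain t where t: "t \<in> mhom A Z (dsum M M)" "\<And>x. x \<in> carrier (dsum M M) \<Longrightarrow> t (q x) = x"
    "\<And>z. z \<in> carrier Z \<Longrightarrow> q (t z) = z"
    by (rule mhom_inverse[OF lMM lZ Z(2,3)]) blast
  have tc: "fst (t z) \<in> carrier M" "snd (t z) \<in> carrier M" if "z \<in> carrier Z" for z
    using mhomD(1)[OF t(1) that] by auto
  have qc: "q w \<in> carrier Z" if "w \<in> carrier (dsum M M)" for w using mhomD(1)[OF Z(2) that] .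
  let ?i1 = "restrict (\<lambda>x. q (x, \<zero>\<^bsub>M\<^esub>)) (carrier M)" and ?i2 = "restrict (\<lambda>x. q (\<zero>\<^bsub>M\<^esub>, x)) (carrier M)"
  let ?p1 = "restrict (\<lambda>z. fst (t z)) (carrier Z)" and ?p2 = "restrict (\<lambda>z. snd (t z)) (carrier Z)"
  let ?d = "restrict (\<lambda>x. q (x, x)) (carrier M)"
  let ?n = "restrict (\<lambda>z. f (fst (t z)) \<oplus>\<^bsub>N\<^esub> g (snd (t z))) (carrier Z)"
  have qa: "q (a \<oplus>\<^bsub>M\<^esub> a', b \<oplus>\<^bsub>M\<^esub> b') = q (a, b) \<oplus>\<^bsub>Z\<^esub> q (a', b')"
    if "a \<in> carrier M" "b \<in> carrier M" "a' \<in> carrier M" "b' \<in> carrier M" for a b a' b'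
    using mhomD(2)[OF Z(2), of "(a, b)" "(a', b')"] that by simp
  have qs: "q (r \<odot>\<^bsub>M\<^esub> a, r \<odot>\<^bsub>M\<^esub> b) = r \<odot>\<^bsub>Z\<^esub> q (a, b)"
    if "r \<in> carrier A" "a \<in> carrier M" "b \<in> carrier M" for r a b
    using mhomD(3)[OF Z(2), of r "(a, b)"] that by simp
  have i1: "?i1 \<in> mhom A M Z"
    by (rule mhom_restrictI[OF lM]) (use qa[of _ "\<zero>\<^bsub>M\<^esub>" _ "\<zero>\<^bsub>M\<^esub>"] qs[of _ _ "\<zero>\<^bsub>M\<^esub>"] in \<open>auto intro!: qc\<close>)
  have i2: "?i2 \<in> mhom A M Z"
    by (rule mhom_restrictI[OF lM]) (use qa[of "\<zero>\<^bsub>M\<^esub>" _ "\<zero>\<^bsub>M\<^esub>"] qs[of _ "\<zero>\<^bsub>M\<^esub>"] in \<open>auto intro!: qc\<close>)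
  have d: "?d \<in> mhom A M Z" by (rule mhom_restrictI[OF lM]) (auto intro!: qc qa qs)
  have p1: "?p1 \<in> mhom A Z M" by (rule mhom_restrictI[OF lZ]) (auto simp: tc mhomD[OF t(1)])
  have p2: "?p2 \<in> mhom A Z M" by (rule mhom_restrictI[OF lZ]) (auto simp: tc mhomD[OF t(1)])
  note fgc = mhomD(1)[OF f] mhomD(1)[OF g]
  have n: "?n \<in> mhom A Z N"
    by (rule mhom_restrictI[OF lZ])
       (simp_all add: tc mhomD[OF t(1)] mhomD[OF f] mhomD[OF g] N.M.a_ac N.smult_r_distr)
  have s1: "short_exact A M ?i1 Z ?p2 M"
  proof (rule short_exactI[OF i1 p2])
    show "inj_on ?i1 (carrier M)" by (rule inj_on_inverseI[of _ "\<lambda>z. fst (t z)"]) (simp add: t)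
    show "?p2 (?i1 u) = \<zero>\<^bsub>M\<^esub>" if "u \<in> carrier M" for u using that by (simp add: qc t)
    show "\<exists>u\<in>carrier M. z = ?i1 u" if z: "z \<in> carrier Z" "?p2 z = \<zero>\<^bsub>M\<^esub>" for z
    proof (rule bexI[of _ "fst (t z)"])
      have "t z = (fst (t z), \<zero>\<^bsub>M\<^esub>)" using z by (simp add: prod_eq_iff)
      then show "z = ?i1 (fst (t z))" using t(3)[OF z(1)] tc[OF z(1)] by simp
    qed (rule tc[OF z(1)])
    show "\<exists>z\<in>carrier Z. v = ?p2 z" if "v \<in> carrier M" for v
      using that by (intro bexI[of _ "q (\<zero>\<^bsub>M\<^esub>, v)"]) (auto simp: qc t)
  qed
  have s2: "short_exact A M ?i2 Z ?p1 M"
  proof (rule short_exactI[OF i2 p1])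
    show "inj_on ?i2 (carrier M)" by (rule inj_on_inverseI[of _ "\<lambda>z. snd (t z)"]) (simp add: t)
    show "?p1 (?i2 u) = \<zero>\<^bsub>M\<^esub>" if "u \<in> carrier M" for u using that by (simp add: qc t)
    show "\<exists>u\<in>carrier M. z = ?i2 u" if z: "z \<in> carrier Z" "?p1 z = \<zero>\<^bsub>M\<^esub>" for z
    proof (rule bexI[of _ "snd (t z)"])
      have "t z = (\<zero>\<^bsub>M\<^esub>, snd (t z))" using z by (simp add: prod_eq_iff)
      then show "z = ?i2 (snd (t z))" using t(3)[OF z(1)] tc[OF z(1)] by simp
    qed (rule tc[OF z(1)])
    show "\<exists>z\<in>carrier Z. v = ?p1 z" if "v \<in> carrier M" for v
      using that by (intro bexI[of _ "q (v, \<zero>\<^bsub>M\<^esub>)"]) (auto simp: qc t)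
  qed
  note e1 = short_exactD[OF preserves_exact[OF M Z(1) M s1]] and e2 = short_exactD[OF preserves_exact[OF M Z(1) M s2]]
  let ?I1 = "arr E M Z ?i1" and ?I2 = "arr E M Z ?i2" and ?P1 = "arr E Z M ?p1" and ?P2 = "arr E Z M ?p2"
  have P1I1: "?P1 (?I1 w) = w" if "w \<in> carrier (obj E M)" for w
    by (rule arr_inverse[OF M Z(1) i1 p1 _ that]) (simp add: qc t)
  have P2I2: "?P2 (?I2 w) = w" if "w \<in> carrier (obj E M)" for w
    by (rule arr_inverse[OF M Z(1) i2 p2 _ that]) (simp add: qc t)
  let ?z = "arr E M Z ?d y"
  have z: "?z \<in> carrier (obj E Z)" by (rule mhomD(1)[OF arr_hom[OF M Z(1) d] y])
  have Pz: "?P1 ?z = y" "?P2 ?z = y"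
    by (rule arr_inverse[OF M Z(1) d p1 _ y], simp add: qc t) (rule arr_inverse[OF M Z(1) d p2 _ y], simp add: qc t)
  have I2y: "?I2 y \<in> carrier (obj E Z)" "?I1 y \<in> carrier (obj E Z)" by (rule mhomD(1)[OF e2(1) y] mhomD(1)[OF e1(1) y])+
  have "?P2 (?z \<ominus>\<^bsub>obj E Z\<^esub> ?I2 y) = \<zero>\<^bsub>obj E M\<^esub>"
    using y by (simp add: mhom_minus[OF obj_lm[OF Z(1)] obj_lm[OF M] e1(2) z I2y(1)] Pz P2I2)
  then obtain w where w: "w \<in> carrier (obj E M)" "?z \<ominus>\<^bsub>obj E Z\<^esub> ?I2 y = ?I1 w"
    using e1(5)[of "?z \<ominus>\<^bsub>obj E Z\<^esub> ?I2 y"] z I2y by auto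
  have "w = ?P1 (?z \<ominus>\<^bsub>obj E Z\<^esub> ?I2 y)" using w P1I1 by simp
  also have "\<dots> = y"
    using y by (simp add: mhom_minus[OF obj_lm[OF Z(1)] obj_lm[OF M] e2(2) z I2y(1)] Pz e2(4))
  finally have wy: "w = y" .
  have zsum: "?z = ?I1 y \<oplus>\<^bsub>obj E Z\<^esub> ?I2 y"
    using EZ.M.minus_add_cancel[OF z I2y(1)] w(2) wy by simp
  have "arr E M N h y = arr E Z N ?n ?z"
    by (rule arr_comp_apply[OF M Z(1) N d n h _ y]) (simp add: qc t hfg)
  also have "\<dots> = arr E Z N ?n (?I1 y) \<oplus>\<^bsub>obj E N\<^esub> arr E Z N ?n (?I2 y)"
    unfolding zsum by (rule mhomD(2)[OF arr_hom[OF Z(1) N n] I2y(2,1)])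
  also have "arr E Z N ?n (?I1 y) = arr E M N f y"
    by (rule arr_comp_apply[OF M Z(1) N i1 n f _ y, symmetric])
       (simp add: qc t fgc mhom_zero[OF lM lN g])
  also have "arr E Z N ?n (?I2 y) = arr E M N g y"
    by (rule arr_comp_apply[OF M Z(1) N i2 n g _ y, symmetric])
       (simp add: qc t fgc mhom_zero[OF lM lN f])
  finally show ?thesis .
qed

lemma arr_zero:
  assumes M: "M \<in> fgmod A" and N: "N \<in> fgmod A" and f: "f \<in> mhom A M N" "\<And>x. x \<in> carrier M \<Longrightarrow> f x = \<zero>\<^bsub>N\<^esub>"
    and y: "y \<in> carrier (obj E M)"
  shows "arr E M N f y = \<zero>\<^bsub>obj E N\<^esub>"
proof -
  interpret N: left_module A N by (rule fgmod_lm[OF N])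
  interpret EN: left_module B "obj E N" by (rule obj_lm[OF N])
  have "arr E M N f y = arr E M N f y \<oplus>\<^bsub>obj E N\<^esub> arr E M N f y"
    by (rule arr_add[OF M N f(1) f(1) f(1) _ y]) (simp add: f(2))
  then show ?thesis using EN.M.add_self_eq_self[OF mhomD(1)[OF arr_hom[OF M N f(1)] y]] by simp
qed

lemma obj_zero:
  assumes M: "M \<in> fgmod A" and z: "zero_module M" shows "zero_module (obj E M)"
proof -
  interpret EM: left_module B "obj E M" by (rule obj_lm[OF M])
  note h = mid_mhom[OF fgmod_lm[OF M]]
  have "y = \<zero>\<^bsub>obj E M\<^esub>" if y: "y \<in> carrier (obj E M)" for y
  proof -
    have "arr E M M (mid M) y = \<zero>\<^bsub>obj E M\<^esub>"
      by (rule arr_zero[OF M M h _ y]) (use z in \<open>auto simp: zero_module_def mid_def\<close>)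
    then show ?thesis using arr_mid[OF M] y by simp
  qed
  then show ?thesis unfolding zero_module_def by auto
qed

end


section \<open>Layers of extensions\<close>

lemma add_closure_fg: "X \<in> add_closure A U \<Longrightarrow> X \<in> fgmod A"
  by (induction rule: add_closure.induct) auto

lemma ext_layer_Suc_cases:
  obtains W where "ext_layer A U (Suc n) = add_closure A W"
  by (cases n) auto

lemma ext_layer_fg: "X \<in> ext_layer A U n \<Longrightarrow> X \<in> fgmod A"
proof (cases n)
  case (Suc m)
  assume "X \<in> ext_layer A U n"
  then show ?thesis using Suc ext_layer_Suc_cases[of A U m] add_closure_fg by metis
qed auto

lemma zero_submodule:
  fixes X :: "'a lmod"
  assumes X: "X \<in> fgmod A"
  shows "submod X {\<zero>\<^bsub>X\<^esub>} \<in> fgmod A" "zero_module (submod X {\<zero>\<^bsub>X\<^esub>})"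
proof -
  interpret X: left_module A X by (rule fgmod_lm[OF X])
  have s: "msub A X {\<zero>\<^bsub>X\<^esub>}" by (auto simp: msub_def)
  then have "mspan A X {\<zero>\<^bsub>X\<^esub>} = {\<zero>\<^bsub>X\<^esub>}"
    using mspan_superset[of "{\<zero>\<^bsub>X\<^esub>}" A X] mspan_least[OF s, of "{\<zero>\<^bsub>X\<^esub>}"] by auto
  then show "submod X {\<zero>\<^bsub>X\<^esub>} \<in> fgmod A" using fgmod_submod_iff[OF fgmod_lm[OF X] s] by blast
  show "zero_module (submod X {\<zero>\<^bsub>X\<^esub>})" by (simp add: zero_module_def)
qed

lemma add_closure_iso:
  assumes X: "X \<in> fgmod A" and Y: "Y \<in> add_closure A U" and iso: "miso A X Y"
  shows "X \<in> add_closure A U"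
proof -
  note Yf = add_closure_fg[OF Y]
  note O = zero_submodule[OF Yf]
  have "miso A X (dsum Y (submod Y {\<zero>\<^bsub>Y\<^esub>}))"
    by (rule miso_trans[OF fgmod_lm[OF X] iso miso_dsum_zero[OF fgmod_lm[OF Yf] fgmod_lm[OF O(1)] O(2)]])
  then show ?thesis by (rule add_closure.direct_sum[OF Y add_closure.empty_sum[OF O] X])
qed

lemma ext_layer_iso:
  assumes "X \<in> fgmod A" "Y \<in> ext_layer A U (Suc n)" "miso A X Y"
  shows "X \<in> ext_layer A U (Suc n)"
  using assms add_closure_iso ext_layer_Suc_cases[of A U n] by metis

lemma ext_layer_summand:
  fixes Y :: "'a lmod"
  assumes "Z \<in> ext_layer A U (Suc n)" "X \<in> fgmod A" "Y \<in> fgmod A" "miso A Z (dsum X Y)"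
  shows "X \<in> ext_layer A U (Suc n)"
proof -
  obtain W where W: "ext_layer A U (Suc n) = add_closure A W" by (rule ext_layer_Suc_cases)
  show ?thesis using add_closure.summand[OF assms(1)[unfolded W] assms(2-4)] unfolding W .
qed

lemma ext_layer_zero:
  assumes "X \<in> fgmod A" "zero_module X" shows "X \<in> ext_layer A U (Suc n)"
  using assms add_closure.empty_sum ext_layer_Suc_cases[of A U n] by metis

lemma ext_layer_dsum:
  assumes "X \<in> ext_layer A U (Suc n)" "Y \<in> ext_layer A U (Suc n)" "Z \<in> fgmod A" "miso A Z (dsum X Y)"
  shows "Z \<in> ext_layer A U (Suc n)"
  using assms add_closure.direct_sum ext_layer_Suc_cases[of A U n] by metis

lemma add_closure_least:
  assumes "X \<in> add_closure A U" "\<And>X. X \<in> U \<Longrightarrow> X \<in> fgmod A \<Longrightarrow> X \<in> add_closure A W"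
  shows "X \<in> add_closure A W"
  using assms(1)
proof (induction rule: add_closure.induct)
  case (direct_sum X Y Z) then show ?case by (blast intro: add_closure.direct_sum)
next
  case (summand Z X Y) then show ?case by (blast intro: add_closure.summand)
qed (auto intro: add_closure.empty_sum assms(2))

lemma ext_layer_closed_under_add:
  assumes "W \<subseteq> ext_layer A U (Suc n)" shows "add_closure A W \<subseteq> ext_layer A U (Suc n)"
proof -
  obtain V where V: "ext_layer A U (Suc n) = add_closure A V" by (rule ext_layer_Suc_cases)
  show ?thesis unfolding V by (intro subsetI, erule add_closure_least) (use assms V in blast)
qed

lemma ext_layer_mono:
  assumes "U \<subseteq> add_closure A W" shows "ext_layer A U (Suc n) \<subseteq> ext_layer A W (Suc n)"
proof (induction n)
  case 0
  show ?case using assms by (auto intro: add_closure_least)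
next
  case (Suc n)
  have base: "add_closure A U \<subseteq> add_closure A W" using assms by (auto intro: add_closure_least)
  have "ext_prod A (ext_layer A U (Suc n)) (add_closure A U) \<subseteq> ext_prod A (ext_layer A W (Suc n)) (add_closure A W)"
    using Suc base unfolding ext_prod_def by blast
  then show ?case by (auto intro: add_closure_least add_closure.base)
qed

context exact_mod_functor
begin

lemma obj_add_closure:
  assumes "X \<in> add_closure A U" "\<And>X. X \<in> U \<Longrightarrow> X \<in> fgmod A \<Longrightarrow> obj E X \<in> add_closure B W"
  shows "obj E X \<in> add_closure B W"
  using assms(1)
proof (induction rule: add_closure.induct)
  case (empty_sum X)
  then show ?case by (intro add_closure.empty_sum obj_zero) auto
next
  case (direct_sum X Y Z)
  then show ?case
    by (intro add_closure.direct_sum[OF direct_sum.IH _ obj_dsum]) (auto intro: add_closure_fg)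
next
  case (summand Z X Y)
  then show ?case
    by (intro add_closure.summand[OF summand.IH _ _ obj_dsum]) (auto intro: add_closure_fg)
qed (rule assms(2))

lemma obj_ext_layer:
  assumes "X \<in> ext_layer A {N} (Suc n)"
  shows "obj E X \<in> ext_layer B {obj E N} (Suc n)"
  using assms
proof (induction n arbitrary: X)
  case 0
  then show ?case by (auto intro: obj_add_closure add_closure.base)
next
  case (Suc n)
  have base: "obj E V \<in> add_closure B {obj E N}" if "V \<in> add_closure A {N}" for V
    using that by (auto intro: obj_add_closure add_closure.base)
  have "obj E X \<in> add_closure B (ext_prod B (ext_layer B {obj E N} (Suc n)) (add_closure B {obj E N}))"
  proof (rule obj_add_closure)
    show "X \<in> add_closure A (ext_prod A (ext_layer A {N} (Suc n)) (add_closure A {N}))"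
      using Suc.prems by simp
    fix X assume "X \<in> ext_prod A (ext_layer A {N} (Suc n)) (add_closure A {N})"
    then obtain U V f g where X: "X \<in> fgmod A" and U: "U \<in> ext_layer A {N} (Suc n)" and V: "V \<in> add_closure A {N}"
      and s: "short_exact A U f X g V" by (auto simp: ext_prod_def)
    have "obj E X \<in> ext_prod B (ext_layer B {obj E N} (Suc n)) (add_closure B {obj E N})"
      unfolding ext_prod_def
      using Suc.IH[OF U] base[OF V] preserves_exact[OF ext_layer_fg[OF U] X add_closure_fg[OF V] s] obj_fg[OF X] by blast
    then show "obj E X \<in> add_closure B (ext_prod B (ext_layer B {obj E N} (Suc n)) (add_closure B {obj E N}))"
      using obj_fg[OF X] by (rule add_closure.base)
  qed
  then show ?case by simp
qed

end

text \<open>Complements can be added up: direct sums and direct summands do not lead out of the class of all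
  direct summands of members of \<open>W\<close>.\<close>

lemma add_closure_summand_of:
  assumes X: "X \<in> add_closure A W"
    and sum: "\<And>X Y Z. X \<in> W \<Longrightarrow> Y \<in> W \<Longrightarrow> Z \<in> fgmod A \<Longrightarrow> miso A Z (dsum X Y) \<Longrightarrow> Z \<in> W"
    and zero: "\<And>X. X \<in> fgmod A \<Longrightarrow> zero_module X \<Longrightarrow> X \<in> W"
    and fg: "W \<subseteq> fgmod A"
  shows "\<exists>Y\<in>(fgmod A :: 'a lmod set). \<exists>Z\<in>W. miso A Z (dsum X Y)"
  using X
proof (induction rule: add_closure.induct)
  case (base X)
  note O = zero_submodule[OF base(2)]
  have "miso A X (dsum X (submod X {\<zero>\<^bsub>X\<^esub>}))"
    by (rule miso_dsum_zero[OF fgmod_lm[OF base(2)] fgmod_lm[OF O(1)] O(2)])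
  then show ?case using O base by blast
next
  case (empty_sum X)
  have "miso A X (dsum X X)"
    by (rule miso_dsum_zero[OF fgmod_lm[OF empty_sum(1)] fgmod_lm[OF empty_sum(1)] empty_sum(2)])
  then show ?case using zero[OF empty_sum] empty_sum by blast
next
  case (direct_sum X Y Z)
  obtain X' :: "'a lmod" and T where X': "X' \<in> fgmod A" "T \<in> W" "miso A T (dsum X X')" using direct_sum.IH(1) by blast
  obtain Y' :: "'a lmod" and T' where Y': "Y' \<in> fgmod A" "T' \<in> W" "miso A T' (dsum Y Y')" using direct_sum.IH(2) by blast
  have f: "X \<in> fgmod A" "Y \<in> fgmod A" "T \<in> fgmod A" "T' \<in> fgmod A"
    using direct_sum.hyps X' Y' fg add_closure_fg by blast+
  obtain Z' :: "'a lmod" where Z': "Z' \<in> fgmod A" "miso A Z' (dsum X' Y')" by (rule dsum_representative[OF X'(1) Y'(1)])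
  obtain T'' :: "'a lmod" where T'': "T'' \<in> fgmod A" "miso A T'' (dsum T T')" by (rule dsum_representative[OF f(3,4)])
  note lm = f[THEN fgmod_lm] X'(1)[THEN fgmod_lm] Y'(1)[THEN fgmod_lm] Z'(1)[THEN fgmod_lm] T''(1)[THEN fgmod_lm]
    direct_sum.hyps(3)[THEN fgmod_lm]
  have "miso A (dsum T T') (dsum (dsum X X') (dsum Y Y'))"
    by (rule miso_dsum_cong[OF lm(3,4) X'(3) Y'(3)])
  then have "miso A T'' (dsum (dsum X X') (dsum Y Y'))" by (rule miso_trans[OF lm(8) T''(2)])
  from miso_trans[OF lm(8) this miso_dsum_interchange[OF lm(1,5,2,6)]]
  have 1: "miso A T'' (dsum (dsum X Y) (dsum X' Y'))" .
  have "miso A (dsum X Y) Z"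
    by (rule miso_sym[OF lm(9) left_module_dsum[OF lm(1,2)] direct_sum.hyps(4)])
  moreover have "miso A (dsum X' Y') Z'"
    by (rule miso_sym[OF lm(7) left_module_dsum[OF lm(5,6)] Z'(2)])
  ultimately have "miso A (dsum (dsum X Y) (dsum X' Y')) (dsum Z Z')"
    by (intro miso_dsum_cong left_module_dsum lm)
  from miso_trans[OF lm(8) 1 this] have "miso A T'' (dsum Z Z')" .
  moreover have "T'' \<in> W" by (rule sum[OF X'(2) Y'(2) T''])
  ultimately show ?case using Z'(1) by blast
next
  case (summand Z X Y)
  obtain Z' :: "'a lmod" and T where Z': "Z' \<in> fgmod A" "T \<in> W" "miso A T (dsum Z Z')" using summand.IH by blast
  have f: "Z \<in> fgmod A" "T \<in> fgmod A" using summand.hyps Z' fg add_closure_fg by blast+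
  obtain Y' :: "'a lmod" where Y': "Y' \<in> fgmod A" "miso A Y' (dsum Y Z')"
    by (rule dsum_representative[OF summand.hyps(3) Z'(1)])
  note lm = f[THEN fgmod_lm] Z'(1)[THEN fgmod_lm] Y'(1)[THEN fgmod_lm] summand.hyps(2)[THEN fgmod_lm]
    summand.hyps(3)[THEN fgmod_lm]
  have "miso A (dsum Z Z') (dsum (dsum X Y) Z')"
    by (intro miso_dsum_cong lm summand.hyps(4) miso_refl)
  from miso_trans[OF lm(2) Z'(3) this] have "miso A T (dsum (dsum X Y) Z')" .
  from miso_trans[OF lm(2) this miso_dsum_assoc[OF lm(5,6,3)]] have 1: "miso A T (dsum X (dsum Y Z'))" .
  have "miso A (dsum Y Z') Y'" by (rule miso_sym[OF lm(4) left_module_dsum[OF lm(6,3)] Y'(2)])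
  then have "miso A (dsum X (dsum Y Z')) (dsum X Y')"
    by (intro miso_dsum_cong left_module_dsum lm miso_refl)
  from miso_trans[OF lm(2) 1 this] show ?case using Y'(1) Z'(2) by blast
qed

text \<open>The module \<open>X\<^sub>1\<close> is the preimage of \<open>V\<^sub>1\<close> in \<open>X\<close>.\<close>

lemma ext_assoc:
  fixes X :: "'a lmod"
  assumes A: "left_noetherian A" and fg: "U \<in> fgmod A" "X \<in> fgmod A" "V \<in> fgmod A" "V1 \<in> fgmod A" "V2 \<in> fgmod A"
    and s: "short_exact A U f X g V" and t: "short_exact A V1 a V b V2"
  obtains X1 :: "'a lmod" and f1 g1 f2 g2 where "X1 \<in> fgmod A" "short_exact A U f1 X1 g1 V1" "short_exact A X1 f2 X g2 V2"
proof -
  note lm = fg[THEN fgmod_lm] and sd = short_exactD[OF s] and td = short_exactD[OF t]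
  interpret X: left_module A X by (rule lm(2))
  define h where "h = compose (carrier X) b g"
  have h: "h \<in> mhom A X V2" unfolding h_def by (rule mhom_comp[OF lm(2) sd(2) td(2)])
  have hx: "h x = b (g x)" if "x \<in> carrier X" for x using that by (simp add: h_def compose_def)
  let ?X1 = "mker X V2 h"
  have X1: "?X1 \<in> fgmod A"
    unfolding mker_def by (rule fgmod_submod[OF A fg(2) msub_kernel[OF lm(2,5) h]])
  have x1: "x \<in> carrier ?X1 \<longleftrightarrow> x \<in> carrier X \<and> b (g x) = \<zero>\<^bsub>V2\<^esub>" for x using hx by (auto simp: mker_def)
  have X1ops: "x \<oplus>\<^bsub>?X1\<^esub> y = x \<oplus>\<^bsub>X\<^esub> y" "r \<odot>\<^bsub>?X1\<^esub> x = r \<odot>\<^bsub>X\<^esub> x" "\<zero>\<^bsub>?X1\<^esub> = \<zero>\<^bsub>X\<^esub>" for x y r by (simp_all add: mker_def)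
  have "h ` carrier X = carrier V2"
  proof
    show "h ` carrier X \<subseteq> carrier V2" using mhomD(1)[OF h] by blast
    show "carrier V2 \<subseteq> h ` carrier X"
    proof
      fix w assume "w \<in> carrier V2"
      then obtain v where v: "v \<in> carrier V" "w = b v" using td(6) by blast
      then obtain x where "x \<in> carrier X" "v = g x" using sd(6) by blast
      then show "w \<in> h ` carrier X" using v hx by force
    qed
  qed
  then have s2: "short_exact A ?X1 (mid ?X1) X h V2" by (rule short_exact_kernel[OF lm(2,5) h])
  have "\<exists>w\<in>carrier V1. g x = a w" if "x \<in> carrier ?X1" for x
    using that td(5)[of "g x"] mhomD(1)[OF sd(2)] unfolding x1 by blast
  then obtain c where c: "\<And>x. x \<in> carrier ?X1 \<Longrightarrow> c x \<in> carrier V1" "\<And>x. x \<in> carrier ?X1 \<Longrightarrow> g x = a (c x)"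
    using bchoice[of "carrier ?X1" "\<lambda>x w. w \<in> carrier V1 \<and> g x = a w"] by metis
  have c_eq: "c x = w" if "x \<in> carrier ?X1" "w \<in> carrier V1" "g x = a w" for x w
    by (rule inj_onD[OF td(3)]) (use c that in auto)
  interpret X1: left_module A ?X1 by (rule fgmod_lm[OF X1])
  interpret V1: left_module A V1 by (rule lm(4))
  have cm: "restrict c (carrier ?X1) \<in> mhom A ?X1 V1"
  proof (rule mhom_restrictI[OF fgmod_lm[OF X1] c(1)])
    fix x y assume xy: "x \<in> carrier ?X1" "y \<in> carrier ?X1"
    show "c (x \<oplus>\<^bsub>?X1\<^esub> y) = c x \<oplus>\<^bsub>V1\<^esub> c y"
      by (rule c_eq) (use xy c X1.M.a_closed x1 in \<open>simp_all add: X1ops mhomD(2)[OF td(1)] mhomD(2)[OF sd(2)]\<close>)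
  next
    fix r x assume rx: "r \<in> carrier A" "x \<in> carrier ?X1"
    show "c (r \<odot>\<^bsub>?X1\<^esub> x) = r \<odot>\<^bsub>V1\<^esub> c x"
      by (rule c_eq) (use rx c X1.smult_closed V1.smult_closed x1 in \<open>simp_all add: X1ops mhomD(3)[OF td(1)] mhomD(3)[OF sd(2)]\<close>)
  qed
  have fX1: "f u \<in> carrier ?X1" if "u \<in> carrier U" for u
    unfolding x1 using that sd(4) mhomD(1)[OF sd(1)] mhom_zero[OF lm(3,5) td(2)] by simp
  have f1: "f \<in> mhom A U ?X1"
    by (rule mhomI) (use fX1 in \<open>simp_all add: X1ops mhomD[OF sd(1)]\<close>)
  have a0: "a \<zero>\<^bsub>V1\<^esub> = \<zero>\<^bsub>V\<^esub>" by (rule mhom_zero[OF lm(4,3) td(1)])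
  have "short_exact A U f ?X1 (restrict c (carrier ?X1)) V1"
  proof (rule short_exactI[OF f1 cm sd(3)])
    show "restrict c (carrier ?X1) (f u) = \<zero>\<^bsub>V1\<^esub>" if "u \<in> carrier U" for u
      using fX1[OF that] c_eq[OF fX1[OF that], of "\<zero>\<^bsub>V1\<^esub>"] sd(4)[OF that] a0 by simp
    show "\<exists>u\<in>carrier U. x = f u" if "x \<in> carrier ?X1" "restrict c (carrier ?X1) x = \<zero>\<^bsub>V1\<^esub>" for x
      using that c(2)[OF that(1)] a0 by (intro sd(5)) (simp_all add: x1)
    show "\<exists>x\<in>carrier ?X1. w = restrict c (carrier ?X1) x" if w: "w \<in> carrier V1" for w
    proof -
      have "a w \<in> carrier V" using mhomD(1)[OF td(1) w] .
      then obtain x where x: "x \<in> carrier X" "a w = g x" using sd(6) by blast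
      have "x \<in> carrier ?X1" unfolding x1 using x td(4)[OF w] by simp
      then show ?thesis using c_eq[of x w] w x by (intro bexI[of _ x]) simp_all
    qed
  qed
  then show ?thesis using s2 X1 that by blast
qed

lemma ext_prod_closed_dsum:
  assumes X: "X \<in> ext_prod A (ext_layer A K (Suc m)) (ext_layer A K (Suc n))"
    and Y: "Y \<in> ext_prod A (ext_layer A K (Suc m)) (ext_layer A K (Suc n))"
    and Z: "Z \<in> fgmod A" "miso A Z (dsum X Y)"
  shows "Z \<in> ext_prod A (ext_layer A K (Suc m)) (ext_layer A K (Suc n))"
proof -
  obtain U V f g where 1: "X \<in> fgmod A" "U \<in> ext_layer A K (Suc m)" "V \<in> ext_layer A K (Suc n)" "short_exact A U f X g V"
    using X by (auto simp: ext_prod_def)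
  obtain U' V' f' g' where 2: "Y \<in> fgmod A" "U' \<in> ext_layer A K (Suc m)" "V' \<in> ext_layer A K (Suc n)" "short_exact A U' f' Y g' V'"
    using Y by (auto simp: ext_prod_def)
  have fg: "U \<in> fgmod A" "V \<in> fgmod A" "U' \<in> fgmod A" "V' \<in> fgmod A" using 1 2 ext_layer_fg by blast+
  obtain U'' :: "'a lmod" where U'': "U'' \<in> fgmod A" "miso A U'' (dsum U U')" by (rule dsum_representative[OF fg(1,3)])
  obtain V'' :: "'a lmod" where V'': "V'' \<in> fgmod A" "miso A V'' (dsum V V')" by (rule dsum_representative[OF fg(2,4)])
  note lm = fg[THEN fgmod_lm] 1(1)[THEN fgmod_lm] 2(1)[THEN fgmod_lm] U''(1)[THEN fgmod_lm] V''(1)[THEN fgmod_lm] Z(1)[THEN fgmod_lm]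
  obtain a b where "short_exact A (dsum U U') a (dsum X Y) b (dsum V V')"
    by (rule short_exact_dsum[OF lm(1,5,3,6) 1(4) 2(4)])
  then obtain a' b' where "short_exact A U'' a' Z b' V''"
    by (rule short_exact_iso[OF lm(7,9) left_module_dsum[OF lm(1,3)] left_module_dsum[OF lm(5,6)]
          left_module_dsum[OF lm(2,4)] lm(8) U''(2) Z(2) V''(2)])
  moreover have "U'' \<in> ext_layer A K (Suc m)" by (rule ext_layer_dsum[OF 1(2) 2(2) U''])
  moreover have "V'' \<in> ext_layer A K (Suc n)" by (rule ext_layer_dsum[OF 1(3) 2(3) V''])
  ultimately show ?thesis using Z(1) unfolding ext_prod_def by blast
qed

lemma zero_short_exact:
  assumes X: "X \<in> fgmod A"
  shows "short_exact A (submod X {\<zero>\<^bsub>X\<^esub>}) (mid (submod X {\<zero>\<^bsub>X\<^esub>})) X (mid X) X"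
proof -
  interpret X: left_module A X by (rule fgmod_lm[OF X])
  have m: "mid X \<in> mhom A X X" by (rule mid_mhom[OF fgmod_lm[OF X]])
  have "{x \<in> carrier X. mid X x = \<zero>\<^bsub>X\<^esub>} = {\<zero>\<^bsub>X\<^esub>}" by auto
  then have "mker X X (mid X) = submod X {\<zero>\<^bsub>X\<^esub>}" by (simp add: mker_def)
  moreover have "mid X ` carrier X = carrier X" by simp
  ultimately show ?thesis using short_exact_kernel[OF fgmod_lm[OF X] fgmod_lm[OF X] m] by simp
qed

text \<open>The induction is on the layers of the right-hand term \<open>V\<close>, which \<open>ext_assoc\<close> peels off one by one. A direct summand \<open>V\<close> of \<open>Z\<close> is replaced by \<open>Z = V \<oplus> V'\<close> at the price of adding \<open>V'\<close> to the
  middle term as well, which is harmless because layers are closed under direct summands.\<close>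

lemma ext_layer_add:
  fixes X :: "'a lmod"
  assumes A: "left_noetherian A"
    and "U \<in> ext_layer A K (Suc m)" "V \<in> ext_layer A K (Suc n)" "X \<in> fgmod A" "short_exact A U f X g V"
  shows "X \<in> ext_layer A K (Suc m + Suc n)"
  using assms(3-5)
proof (induction n arbitrary: V X f g)
  case 0
  have "X \<in> ext_prod A (ext_layer A K (Suc m)) (ext_layer A K (Suc 0))"
    unfolding ext_prod_def using 0 assms(2) by blast
  then show ?case using 0 by (auto intro: add_closure.base)
next
  case (Suc n)
  let ?W = "ext_prod A (ext_layer A K (Suc n)) (ext_layer A K (Suc 0))"
  note Ufg = ext_layer_fg[OF assms(2)] and Vfg = ext_layer_fg[OF Suc.prems(1)]
  have "V \<in> add_closure A ?W" using Suc.prems(1) by simp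
  then have "\<exists>Y\<in>(fgmod A :: 'a lmod set). \<exists>Z\<in>?W. miso A Z (dsum V Y)"
  proof (rule add_closure_summand_of)
    show "Z \<in> ?W" if "X \<in> ?W" "Y \<in> ?W" "Z \<in> fgmod A" "miso A Z (dsum X Y)" for X Y Z
      using that by (rule ext_prod_closed_dsum)
    show "X \<in> ?W" if X: "X \<in> fgmod A" "zero_module X" for X
      unfolding ext_prod_def using X zero_short_exact[OF X(1)] ext_layer_zero[OF X, of K 0]
        ext_layer_zero[OF zero_submodule[OF X(1)], of K n] by blast
  qed (auto simp: ext_prod_def)
  then obtain V' :: "'a lmod" and Z where V': "V' \<in> fgmod A" and Z: "Z \<in> ?W" "miso A Z (dsum V V')" by blast
  obtain Z1 Z2 a b where Z12: "Z \<in> fgmod A" "Z1 \<in> ext_layer A K (Suc n)" "Z2 \<in> ext_layer A K (Suc 0)"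
    "short_exact A Z1 a Z b Z2" using Z(1) by (auto simp: ext_prod_def)
  obtain T :: "'a lmod" where T: "T \<in> fgmod A" "miso A T (dsum X V')" by (rule dsum_representative[OF Suc.prems(2) V'])
  let ?O = "submod V' {\<zero>\<^bsub>V'\<^esub>}"
  note O = zero_submodule[OF V']
  note lm = Ufg[THEN fgmod_lm] Vfg[THEN fgmod_lm] Suc.prems(2)[THEN fgmod_lm] V'[THEN fgmod_lm] Z12(1)[THEN fgmod_lm]
    T(1)[THEN fgmod_lm] O(1)[THEN fgmod_lm]
  obtain p q where "short_exact A (dsum U ?O) p (dsum X V') q (dsum V V')"
    by (rule short_exact_dsum[OF lm(1,3,7,4) Suc.prems(3) zero_short_exact[OF V']])
  then obtain p' q' where UTZ: "short_exact A U p' T q' Z"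
    by (rule short_exact_iso[OF lm(1,6) left_module_dsum[OF lm(1,7)] left_module_dsum[OF lm(3,4)]
          left_module_dsum[OF lm(2,4)] lm(5) miso_dsum_zero[OF lm(1,7) O(2)] T(2) Z(2)])
  obtain T1 :: "'a lmod" and f1 g1 f2 g2 where T1: "T1 \<in> fgmod A" "short_exact A U f1 T1 g1 Z1" "short_exact A T1 f2 T g2 Z2"
    by (rule ext_assoc[OF A Ufg T(1) Z12(1) ext_layer_fg[OF Z12(2)] ext_layer_fg[OF Z12(3)] UTZ Z12(4)])
  have "T1 \<in> ext_layer A K (Suc (m + Suc n))" using Suc.IH[OF Z12(2) T1(1,2)] by simp
  then have "T \<in> ext_prod A (ext_layer A K (Suc (m + Suc n))) (ext_layer A K (Suc 0))"
    unfolding ext_prod_def using T(1) T1(3) Z12(3) by blast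
  then have "T \<in> ext_layer A K (Suc (Suc (m + Suc n)))" using T(1) by (auto intro: add_closure.base)
  then have "X \<in> ext_layer A K (Suc (Suc (m + Suc n)))" by (rule ext_layer_summand[OF _ Suc.prems(2) V' T(2)])
  then show ?case by simp
qed


section \<open>Projective modules and syzygies\<close>

lemma projective_fg: "projective A P \<Longrightarrow> P \<in> fgmod A"
  by (simp add: projective_def)

lemma projective_lift:
  fixes M N :: "'a lmod"
  assumes P: "projective A P" and M: "M \<in> fgmod A" and N: "N \<in> fgmod A"
    and p: "p \<in> mhom A M N" "p ` carrier M = carrier N" and f: "f \<in> mhom A P N"
  obtains h where "h \<in> mhom A P M" "\<And>x. x \<in> carrier P \<Longrightarrow> p (h x) = f x"
proof -
  obtain h where h: "h \<in> mhom A P M" "f = compose (carrier P) p h"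
    using P M N p f unfolding projective_def by blast
  have "p (h x) = f x" if "x \<in> carrier P" for x using h(2) that by (simp add: compose_def)
  then show ?thesis using h(1) that by blast
qed

lemma projectiveI:
  assumes "P \<in> fgmod A"
    and "\<And>(M :: 'a lmod) (N :: 'a lmod) p f. \<lbrakk>M \<in> fgmod A; N \<in> fgmod A; p \<in> mhom A M N; f \<in> mhom A P N;
      p ` carrier M = carrier N\<rbrakk> \<Longrightarrow> \<exists>h\<in>mhom A P M. \<forall>x\<in>carrier P. p (h x) = f x"
  shows "projective A (P :: 'a lmod)"
  unfolding projective_def
proof (intro conjI ballI impI assms(1))
  fix M N :: "'a lmod" and p f
  assume *: "M \<in> fgmod A" "N \<in> fgmod A" "p \<in> mhom A M N" "f \<in> mhom A P N" "p ` carrier M = carrier N"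
  then obtain h where h: "h \<in> mhom A P M" "\<forall>x\<in>carrier P. p (h x) = f x" using assms(2) by blast
  have "f = compose (carrier P) p h"
    by (rule mhom_eqI[OF *(4) mhom_comp[OF fgmod_lm[OF assms(1)] h(1) *(3)]]) (use h in \<open>simp add: compose_def\<close>)
  then show "\<exists>h\<in>mhom A P M. f = compose (carrier P) p h" using h(1) by blast
qed

lemma Syz_iso:
  assumes X: "X \<in> fgmod A" and Y: "Y \<in> Syz A j" and iso: "miso A X Y"
  shows "X \<in> Syz A j"
proof -
  obtain M where M: "M \<in> fgmod A" "is_syzygy A j M Y" using Y by (auto simp: Syz_def)
  have "is_syzygy A j M X"
  proof (cases j)
    case 0
    then show ?thesis using M(2) miso_trans[OF fgmod_lm[OF X] iso] by simp
  next
    case (Suc n)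
    then show ?thesis using M(2) miso_trans[OF fgmod_lm[OF X] iso] by auto
  qed
  then show ?thesis using X M(1) by (auto simp: Syz_def)
qed

context exact_mod_functor
begin

lemma obj_mim:
  assumes X: "X \<in> fgmod A" and Y: "Y \<in> fgmod A" and f: "f \<in> mhom A X Y"
  shows "miso B (obj E (mim X Y f)) (mim (obj E X) (obj E Y) (arr E X Y f))"
proof -
  let ?I = "mim X Y f"
  have sub: "msub A Y (f ` carrier X)"
    by (rule msub_image[OF fgmod_lm[OF X] fgmod_lm[OF Y] f msub_carrier[OF fgmod_lm[OF X]]])
  have I: "?I \<in> fgmod A" unfolding mim_def by (rule fgmod_submod[OF noeth Y sub])
  have fI: "f \<in> mhom A X ?I" using f by (auto simp: mhom_def mim_def)
  have iI: "mid ?I \<in> mhom A ?I Y"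
    using mid_mhom[OF fgmod_lm[OF I]] msubD(1)[OF sub] by (auto simp: mhom_def mim_def)
  have cI: "carrier ?I = f ` carrier X" by (simp add: mim_def)
  have comp: "arr E X Y f x = arr E ?I Y (mid ?I) (arr E X ?I f x)" if "x \<in> carrier (obj E X)" for x
    by (rule arr_comp_apply[OF X I Y fI iI f _ that]) (simp add: cI)
  have onto: "arr E X ?I f ` carrier (obj E X) = carrier (obj E ?I)"
    by (rule arr_onto[OF X I fI]) (simp add: cI)
  have inj: "inj_on (arr E ?I Y (mid ?I)) (carrier (obj E ?I))"
    by (rule arr_inj[OF I Y iI]) (auto simp: inj_on_def)
  have "arr E ?I Y (mid ?I) ` carrier (obj E ?I) = arr E X Y f ` carrier (obj E X)"
    unfolding onto[symmetric] image_image by (rule image_cong[OF refl comp[symmetric]])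
  then have "bij_betw (arr E ?I Y (mid ?I)) (carrier (obj E ?I)) (carrier (mim (obj E X) (obj E Y) (arr E X Y f)))"
    using inj by (simp add: bij_betw_def mim_def)
  moreover have "arr E ?I Y (mid ?I) \<in> mhom B (obj E ?I) (mim (obj E X) (obj E Y) (arr E X Y f))"
    using arr_hom[OF I Y iI] calculation by (auto simp: mhom_def mim_def bij_betw_def)
  ultimately show ?thesis by (rule misoI[rotated])
qed

lemma obj_Syz:
  assumes pp: "preserves_projectives A B E" and X: "X \<in> Syz A j"
  shows "obj E X \<in> Syz B j"
proof -
  obtain M where Xf: "X \<in> fgmod A" and M: "M \<in> fgmod A" "is_syzygy A j M X" using X by (auto simp: Syz_def)
  have "is_syzygy B j (obj E M) (obj E X)"
  proof (cases j)
    case 0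
    then show ?thesis using M obj_miso[OF Xf M(1)] by simp
  next
    case (Suc n)
    then obtain P d \<epsilon> where res: "proj_resolution A M P d \<epsilon>" and iso: "miso A X (mim (P (Suc n)) (P n) (d n))"
      using M(2) by auto
    have P: "projective A (P m)" and d: "d m \<in> mhom A (P (Suc m)) (P m)" for m
      using res unfolding proj_resolution_def by simp_all
    have Pf: "P m \<in> fgmod A" for m by (rule projective_fg[OF P])
    have \<epsilon>: "\<epsilon> \<in> mhom A (P 0) M" "\<epsilon> ` carrier (P 0) = carrier M"
      and d0: "d 0 ` carrier (P (Suc 0)) = {x \<in> carrier (P 0). \<epsilon> x = \<zero>\<^bsub>M\<^esub>}"
      and dS: "d (Suc m) ` carrier (P (Suc (Suc m))) = {x \<in> carrier (P (Suc m)). d m x = \<zero>\<^bsub>P m\<^esub>}" for m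
      using res unfolding proj_resolution_def by simp_all
    let ?d = "\<lambda>m. arr E (P (Suc m)) (P m) (d m)"
    have "proj_resolution B (obj E M) (\<lambda>m. obj E (P m)) ?d (arr E (P 0) M \<epsilon>)"
      unfolding proj_resolution_def
    proof (intro conjI allI)
      show "projective B (obj E (P m))" for m using pp P unfolding preserves_projectives_def by blast
      show "?d m \<in> mhom B (obj E (P (Suc m))) (obj E (P m))" for m by (rule arr_hom[OF Pf Pf d])
      show "arr E (P 0) M \<epsilon> \<in> mhom B (obj E (P 0)) (obj E M)" by (rule arr_hom[OF Pf M(1) \<epsilon>(1)])
      show "arr E (P 0) M \<epsilon> ` carrier (obj E (P 0)) = carrier (obj E M)" by (rule arr_onto[OF Pf M(1) \<epsilon>])
      show "?d 0 ` carrier (obj E (P 1)) = {x \<in> carrier (obj E (P 0)). arr E (P 0) M \<epsilon> x = \<zero>\<^bsub>obj E M\<^esub>}"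
        using arr_exact[OF Pf Pf M(1) d \<epsilon>(1) d0] by simp
      show "?d (Suc m) ` carrier (obj E (P (Suc (Suc m)))) = {x \<in> carrier (obj E (P (Suc m))). ?d m x = \<zero>\<^bsub>obj E (P m)\<^esub>}" for m
        by (rule arr_exact[OF Pf Pf Pf d d dS])
    qed
    moreover have "miso B (obj E X) (mim (obj E (P (Suc n))) (obj E (P n)) (?d n))"
    proof -
      have I: "mim (P (Suc n)) (P n) (d n) \<in> fgmod A"
        unfolding mim_def
        by (rule fgmod_submod[OF noeth Pf msub_image[OF fgmod_lm[OF Pf] fgmod_lm[OF Pf] d msub_carrier[OF fgmod_lm[OF Pf]]]])
      show ?thesis by (rule miso_trans[OF obj_lm[OF Xf] obj_miso[OF Xf I iso] obj_mim[OF Pf Pf d]])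
    qed
    ultimately show ?thesis unfolding Suc is_syzygy.simps by blast
  qed
  then show ?thesis using Xf M(1) by (auto simp: Syz_def)
qed

end


text \<open>The maps \<open>r\<^sub>1 a\<^sub>1 j\<^sub>2\<close> and \<open>r\<^sub>2 a\<^sub>2 j\<^sub>1\<close> compare the kernels of two split epimorphisms. Their composite is
  the identity, because \<open>a\<^sub>2\<close> carries one section into the other, where the retraction vanishes.\<close>

lemma split_kernel_half:
  assumes lm: "left_module A K1" "left_module A U1" "left_module A K2" "left_module A U2"
    and h: "j1 \<in> mhom A K1 U1" "j2 \<in> mhom A K2 U2" "q1 \<in> mhom A U1 V1" "q2 \<in> mhom A U2 V2" "t1 \<in> mhom A V1 U1" "t2 \<in> mhom A V2 U2"
        "r1 \<in> mhom A U1 K1" "r2 \<in> mhom A U2 K2" "a1 \<in> mhom A U2 U1" "a2 \<in> mhom A U1 U2" and i: "inj_on j2 (carrier K2)"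
      and r1: "\<And>x. x \<in> carrier U1 \<Longrightarrow> j1 (r1 x) = x \<ominus>\<^bsub>U1\<^esub> t1 (q1 x)"
      and r2: "\<And>u. u \<in> carrier K2 \<Longrightarrow> r2 (j2 u) = u" "\<And>x. x \<in> carrier U2 \<Longrightarrow> j2 (r2 x) = x \<ominus>\<^bsub>U2\<^esub> t2 (q2 x)"
      and qt: "\<And>v. v \<in> carrier V2 \<Longrightarrow> q2 (t2 v) = v" and aa: "\<And>u. u \<in> carrier U2 \<Longrightarrow> a2 (a1 u) = u"
      and at: "\<And>v. v \<in> carrier V1 \<Longrightarrow> \<exists>w\<in>carrier V2. a2 (t1 v) = t2 w" and y: "y \<in> carrier K2"
  shows "r2 (a2 (j1 (r1 (a1 (j2 y))))) = y"
proof -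
  interpret K2: left_module A K2 by fact
  interpret U2: left_module A U2 by fact
  let ?u = "a1 (j2 y)"
  have jy: "j2 y \<in> carrier U2" by (rule mhomD(1)[OF h(2) y])
  have u: "?u \<in> carrier U1" by (rule mhomD(1)[OF h(9) jy])
  have q: "q1 ?u \<in> carrier V1" by (rule mhomD(1)[OF h(3) u])
  have t: "t1 (q1 ?u) \<in> carrier U1" by (rule mhomD(1)[OF h(5) q])
  obtain w where w: "w \<in> carrier V2" "a2 (t1 (q1 ?u)) = t2 w" using at[OF q] by blast
  have t2: "t2 w \<in> carrier U2" by (rule mhomD(1)[OF h(6) w(1)])
  have "j2 (r2 (t2 w)) = j2 \<zero>\<^bsub>K2\<^esub>"
    using r2(2)[OF t2] t2 by (simp add: qt[OF w(1)] mhom_zero[OF lm(3,4) h(2)])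
  then have rt: "r2 (t2 w) = \<zero>\<^bsub>K2\<^esub>" by (rule inj_onD[OF i]) (use mhomD(1)[OF h(8) t2] in auto)
  have "a2 (j1 (r1 ?u)) = a2 ?u \<ominus>\<^bsub>U2\<^esub> t2 w"
    using r1[OF u] w(2) mhom_minus[OF lm(2,4) h(10) u t] by simp
  also have "\<dots> = j2 y \<ominus>\<^bsub>U2\<^esub> t2 w" using aa[OF jy] by simp
  finally show ?thesis using mhom_minus[OF lm(4,3) h(8) jy t2] rt r2(1)[OF y] y by simp
qed

text \<open>The kernel of a split epimorphism is the cokernel of its section, and isomorphisms that respect the
  sections pass to the cokernels.\<close>

lemma split_kernel_cong:
  assumes lm: "left_module A K" "left_module A U" "left_module A V" "left_module A K'" "left_module A U'" "left_module A V'"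
    and ses: "short_exact A K j U q V" "short_exact A K' j' U' q' V'"
    and t: "t \<in> mhom A V U" "t' \<in> mhom A V' U'"
    and qt: "\<And>v. v \<in> carrier V \<Longrightarrow> q (t v) = v" "\<And>v. v \<in> carrier V' \<Longrightarrow> q' (t' v) = v"
    and a: "a \<in> mhom A U U'" "a' \<in> mhom A U' U"
    and aa: "\<And>u. u \<in> carrier U \<Longrightarrow> a' (a u) = u" "\<And>u. u \<in> carrier U' \<Longrightarrow> a (a' u) = u"
    and at: "\<And>v. v \<in> carrier V \<Longrightarrow> \<exists>w\<in>carrier V'. a (t v) = t' w" "\<And>v. v \<in> carrier V' \<Longrightarrow> \<exists>w\<in>carrier V. a' (t' v) = t w"
  shows "miso A K K'"
proof -
  obtain r where r: "r \<in> mhom A U K" "\<And>u. u \<in> carrier K \<Longrightarrow> r (j u) = u" "\<And>x. x \<in> carrier U \<Longrightarrow> j (r x) = x \<ominus>\<^bsub>U\<^esub> t (q x)"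
    by (rule short_exact_section_retraction[OF lm(1-3) ses(1) t(1) qt(1)], assumption, rule that; assumption)
  obtain r' where r': "r' \<in> mhom A U' K'" "\<And>u. u \<in> carrier K' \<Longrightarrow> r' (j' u) = u" "\<And>x. x \<in> carrier U' \<Longrightarrow> j' (r' x) = x \<ominus>\<^bsub>U'\<^esub> t' (q' x)"
    by (rule short_exact_section_retraction[OF lm(4-6) ses(2) t(2) qt(2)], assumption, rule that; assumption)
  note s = short_exactD[OF ses(1)] and s' = short_exactD[OF ses(2)]
  let ?h = "compose (carrier K) r' (compose (carrier K) a j)"
  let ?g = "compose (carrier K') r (compose (carrier K') a' j')"
  show ?thesis
  proof (rule misoI2[of ?h _ _ _ ?g])
    show "?h \<in> mhom A K K'" by (rule mhom_comp[OF lm(1) mhom_comp[OF lm(1) s(1) a(1)] r'(1)])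
    show "?g \<in> mhom A K' K" by (rule mhom_comp[OF lm(4) mhom_comp[OF lm(4) s'(1) a(2)] r(1)])
    fix y assume y: "y \<in> carrier K"
    have "r' (a (j y)) \<in> carrier K'" using y mhomD(1)[OF s(1)] mhomD(1)[OF a(1)] mhomD(1)[OF r'(1)] by blast
    then have "?g (?h y) = r (a' (j' (r' (a (j y)))))" using y by (simp add: compose_def)
    also have "\<dots> = y"
      by (rule split_kernel_half[OF lm(4,5,1,2) s'(1) s(1) s'(2) s(2) t(2,1) r'(1) r(1) a s(3) r'(3) r(2,3) qt(1) aa(1) at(2) y])
    finally show "?g (?h y) = y" .
  next
    fix y assume y: "y \<in> carrier K'"
    have "r (a' (j' y)) \<in> carrier K" using y mhomD(1)[OF s'(1)] mhomD(1)[OF a(2)] mhomD(1)[OF r(1)] by blast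
    then have "?h (?g y) = r' (a (j (r (a' (j' y)))))" using y by (simp add: compose_def)
    also have "\<dots> = y"
      by (rule split_kernel_half[OF lm(1,2,4,5) s(1) s'(1) s(2) s'(2) t(1,2) r(1) r'(1) a(2,1) s'(3) r(3) r'(2,3) qt(2) aa(2) at(1) y])
    finally show "?h (?g y) = y" .
  qed
qed


section \<open>Extension dimension\<close>

lemma ext_dim_le:
  assumes "N \<in> fgmod A" "U \<subseteq> ext_layer A {N} (n + 1)"
  shows "ext_dim A U \<le> enat n"
  unfolding ext_dim_def by (rule Inf_lower) (use assms in blast)

lemma ext_dim_attained:
  assumes "ext_dim A U = enat n"
  obtains N where "N \<in> fgmod A" "U \<subseteq> ext_layer A {N} (n + 1)"
proof -
  let ?D = "{enat n |n. \<exists>N\<in>fgmod A. U \<subseteq> ext_layer A {N} (n + 1)}"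
  have ne: "?D \<noteq> {}" using assms unfolding ext_dim_def Inf_enat_def by (auto split: if_splits)
  then have "Inf ?D \<in> ?D" unfolding Inf_enat_def by (simp only: if_False) (rule LeastI_ex, blast)
  then show ?thesis using assms that unfolding ext_dim_def by auto
qed


section \<open>Cleft extensions\<close>

locale cleft =
  fixes k :: "'k ring" and R :: "('k, 'r) module" and S :: "('k, 's) module"
    and i l :: "('s, 'r) mfunctor" and e :: "('r, 's) mfunctor"
    and \<eta> :: "'s lmod \<Rightarrow> 's list \<Rightarrow> 's list" and \<mu> :: "'r lmod \<Rightarrow> 'r list \<Rightarrow> 'r list"
  assumes artin_R: "artin_algebra k R" and artin_S: "artin_algebra k S"
    and cleft: "cleft_extension S R i e l \<eta> \<mu>"
    and e_projectives: "preserves_projectives R S e"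
    and l_exact: "exact_functor S R l"
begin

sublocale Rk: artin_alg k R by unfold_locales (rule artin_R)
sublocale Sk: artin_alg k S by unfold_locales (rule artin_S)

sublocale e: exact_mod_functor R S e
  by unfold_locales (use cleft Rk.left_noetherian in \<open>auto simp: cleft_extension_def\<close>)
sublocale l: exact_mod_functor S R l
  by unfold_locales (use cleft l_exact Sk.left_noetherian in \<open>auto simp: cleft_extension_def\<close>)
sublocale i: mod_functor S R i
  by unfold_locales (use cleft in \<open>auto simp: cleft_extension_def\<close>)

lemma adjoint: "adjoint_pair S R l e \<eta> \<mu>" and e_faithful: "faithful_functor R e"
  using cleft by (auto simp: cleft_extension_def)

lemma \<eta>_hom: "N \<in> fgmod S \<Longrightarrow> \<eta> N \<in> mhom S N (obj e (obj l N))"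
  using adjoint by (auto simp: adjoint_pair_def nat_transf_def id_functor_def comp_functor_def)

lemma \<mu>_hom: "X \<in> fgmod R \<Longrightarrow> \<mu> X \<in> mhom R (obj l (obj e X)) X"
  using adjoint by (auto simp: adjoint_pair_def nat_transf_def id_functor_def comp_functor_def)

lemma \<eta>_natural:
  assumes "M \<in> fgmod S" "N \<in> fgmod S" "f \<in> mhom S M N" "x \<in> carrier M"
  shows "\<eta> N (f x) = arr e (obj l M) (obj l N) (arr l M N f) (\<eta> M x)"
proof -
  have "nat_transf S S id_functor (comp_functor e l) \<eta>" using adjoint by (simp add: adjoint_pair_def)
  then have "compose (carrier M) (\<eta> N) f = compose (carrier M) (arr e (obj l M) (obj l N) (arr l M N f)) (\<eta> M)"
    using assms(1-3) by (simp add: nat_transf_def id_functor_def comp_functor_def)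
  from fun_cong[OF this, of x] show ?thesis using assms(4) by (simp add: compose_def)
qed

lemma \<mu>_natural:
  assumes "X \<in> fgmod R" "Y \<in> fgmod R" "f \<in> mhom R X Y" "z \<in> carrier (obj l (obj e X))"
  shows "\<mu> Y (arr l (obj e X) (obj e Y) (arr e X Y f) z) = f (\<mu> X z)"
proof -
  have "nat_transf R R (comp_functor l e) id_functor \<mu>" using adjoint by (simp add: adjoint_pair_def)
  then have "compose (carrier (obj l (obj e X))) (\<mu> Y) (arr l (obj e X) (obj e Y) (arr e X Y f)) =
      compose (carrier (obj l (obj e X))) f (\<mu> X)"
    using assms(1-3) by (simp add: nat_transf_def id_functor_def comp_functor_def)
  from fun_cong[OF this, of z] show ?thesis using assms(4) by (simp add: compose_def)
qed

lemma triangle_l: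
  assumes "N \<in> fgmod S" "z \<in> carrier (obj l N)"
  shows "\<mu> (obj l N) (arr l N (obj e (obj l N)) (\<eta> N) z) = z"
proof -
  have "compose (carrier (obj l N)) (\<mu> (obj l N)) (arr l N (obj e (obj l N)) (\<eta> N)) = mid (obj l N)"
    using adjoint assms(1) by (simp add: adjoint_pair_def)
  from fun_cong[OF this, of z] show ?thesis using assms(2) by (simp add: compose_def)
qed

lemma triangle_e:
  assumes "X \<in> fgmod R" "y \<in> carrier (obj e X)"
  shows "arr e (obj l (obj e X)) X (\<mu> X) (\<eta> (obj e X) y) = y"
proof -
  have "compose (carrier (obj e X)) (arr e (obj l (obj e X)) X (\<mu> X)) (\<eta> (obj e X)) = mid (obj e X)"
    using adjoint assms(1) by (simp add: adjoint_pair_def)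
  from fun_cong[OF this, of y] show ?thesis using assms(2) by (simp add: compose_def)
qed

lemma e_faithfulD:
  assumes "M \<in> fgmod R" "N \<in> fgmod R" "f \<in> mhom R M N" "g \<in> mhom R M N"
    "\<And>y. y \<in> carrier (obj e M) \<Longrightarrow> arr e M N f y = arr e M N g y"
  shows "f = g"
proof -
  have "arr e M N f = arr e M N g"
    by (rule mhom_eqI[OF e.arr_hom[OF assms(1-3)] e.arr_hom[OF assms(1,2,4)] assms(5)])
  then show ?thesis using e_faithful assms(1-4) unfolding faithful_functor_def by (auto dest: inj_onD)
qed

lemma e_reflects_zero:
  assumes X: "X \<in> fgmod R" and z: "zero_module (obj e X)" shows "zero_module X"
proof -
  interpret X: left_module R X by (rule fgmod_lm[OF X])
  let ?o = "restrict (\<lambda>_. \<zero>\<^bsub>X\<^esub>) (carrier X)"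
  have o: "?o \<in> mhom R X X" by (rule mhom_zero_map[OF fgmod_lm[OF X] fgmod_lm[OF X]])
  have m: "mid X \<in> mhom R X X" by (rule mid_mhom[OF fgmod_lm[OF X]])
  have zz: "y = \<zero>\<^bsub>obj e X\<^esub>" if "y \<in> carrier (obj e X)" for y using z that by (auto simp: zero_module_def)
  have "mid X = ?o"
  proof (rule e_faithfulD[OF X X m o])
    fix y assume y: "y \<in> carrier (obj e X)"
    show "arr e X X (mid X) y = arr e X X ?o y"
      using zz[OF mhomD(1)[OF e.arr_hom[OF X X m] y]] zz[OF mhomD(1)[OF e.arr_hom[OF X X o] y]] by simp
  qed
  from fun_cong[OF this] have "x = \<zero>\<^bsub>X\<^esub>" if "x \<in> carrier X" for x
    using that by (metis mid_apply restrict_apply')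
  then show ?thesis unfolding zero_module_def by auto
qed

text \<open>After applying \<open>e\<close> the counit is split by the unit, and a faithful exact functor detects that
  its cokernel vanishes.\<close>

lemma \<mu>_onto:
  assumes X: "X \<in> fgmod R"
  shows "\<mu> X ` carrier (obj l (obj e X)) = carrier X"
proof -
  let ?U = "obj l (obj e X)"
  have U: "?U \<in> fgmod R" using X by blast
  note lX = fgmod_lm[OF X] and lU = fgmod_lm[OF U]
  have sub: "msub R X (\<mu> X ` carrier ?U)" by (rule msub_image[OF lU lX \<mu>_hom[OF X] msub_carrier[OF lU]])
  obtain Q :: "'r lmod" and p where Q: "Q \<in> fgmod R" "p \<in> mhom R X Q" "p ` carrier X = carrier Q"
    "{x \<in> carrier X. p x = \<zero>\<^bsub>Q\<^esub>} = \<mu> X ` carrier ?U"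
    by (rule quotient_exists[OF X sub])
  note lQ = fgmod_lm[OF Q(1)]
  have p\<mu>: "p (\<mu> X x) = \<zero>\<^bsub>Q\<^esub>" if "x \<in> carrier ?U" for x
    using that Q(4) by blast
  let ?o = "\<lambda>M. restrict (\<lambda>_. \<zero>\<^bsub>Q\<^esub>) (carrier M)"
  have "p = ?o X"
  proof (rule e_faithfulD[OF X Q(1,2) mhom_zero_map[OF lX lQ]])
    fix y assume y: "y \<in> carrier (obj e X)"
    let ?z = "\<eta> (obj e X) y"
    have z: "?z \<in> carrier (obj e ?U)" by (rule mhomD(1)[OF \<eta>_hom[OF e.obj_fg[OF X]] y])
    have "arr e ?U Q (?o ?U) ?z = arr e X Q p (arr e ?U X (\<mu> X) ?z)"
      by (rule e.arr_comp_apply[OF U X Q(1) \<mu>_hom[OF X] Q(2) mhom_zero_map[OF lU lQ] _ z]) (simp add: p\<mu>)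
    then have 1: "arr e X Q p y = \<zero>\<^bsub>obj e Q\<^esub>"
      using triangle_e[OF X y] e.arr_zero[OF U Q(1) mhom_zero_map[OF lU lQ] _ z] by simp
    have 2: "arr e X Q (?o X) y = \<zero>\<^bsub>obj e Q\<^esub>" by (rule e.arr_zero[OF X Q(1) mhom_zero_map[OF lX lQ] _ y]) simp
    show "arr e X Q p y = arr e X Q (?o X) y" using 1 2 by simp
  qed
  then have "p x = \<zero>\<^bsub>Q\<^esub>" if "x \<in> carrier X" for x using that by simp
  then show ?thesis using Q(4) by auto
qed

definition G :: "'r lmod \<Rightarrow> 'r lmod" where
  "G X = mker (obj l (obj e X)) X (\<mu> X)"

lemma G_fg [simp, intro]: "X \<in> fgmod R \<Longrightarrow> G X \<in> fgmod R"
  unfolding G_def by (intro e.kernel_fg fgmod_lm \<mu>_hom) auto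

lemma G_exact:
  assumes "X \<in> fgmod R" shows "short_exact R (G X) (mid (G X)) (obj l (obj e X)) (\<mu> X) X"
  unfolding G_def using assms by (intro short_exact_kernel \<mu>_hom \<mu>_onto fgmod_lm) auto

lemma F_obj: "obj (induced_endofunctor i e l \<mu>) N = obj e (G (obj i N))"
  by (simp add: induced_endofunctor_def comp_functor_def counit_kernel_def G_def Let_def)

lemma eG_exact:
  assumes "X \<in> fgmod R"
  shows "short_exact S (obj e (G X)) (arr e (G X) (obj l (obj e X)) (mid (G X))) (obj e (obj l (obj e X)))
    (arr e (obj l (obj e X)) X (\<mu> X)) (obj e X)"
  using assms by (intro e.preserves_exact G_exact) auto

lemma eG_retraction:
  assumes X: "X \<in> fgmod R"
  obtains s where "s \<in> mhom S (obj e (obj l (obj e X))) (obj e (G X))"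
    "\<And>y. y \<in> carrier (obj e (G X)) \<Longrightarrow> s (arr e (G X) (obj l (obj e X)) (mid (G X)) y) = y"
proof (rule short_exact_section_retraction[OF _ _ _ eG_exact[OF X] \<eta>_hom[OF e.obj_fg[OF X]]])
  show "left_module S (obj e (G X))" "left_module S (obj e (obj l (obj e X)))" "left_module S (obj e X)"
    using X by auto
  show "arr e (obj l (obj e X)) X (\<mu> X) (\<eta> (obj e X) v) = v" if "v \<in> carrier (obj e X)" for v
    by (rule triangle_e[OF X that])
qed (rule that)

lemma ele_decomposition:
  assumes X: "X \<in> fgmod R"
  shows "miso S (obj e (obj l (obj e X))) (dsum (obj e (G X)) (obj e X))"
proof -
  obtain s where s: "s \<in> mhom S (obj e (obj l (obj e X))) (obj e (G X))"
    "\<And>y. y \<in> carrier (obj e (G X)) \<Longrightarrow> s (arr e (G X) (obj l (obj e X)) (mid (G X)) y) = y"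
    by (rule eG_retraction[OF X]) blast
  show ?thesis using X by (intro short_exact_retraction_iso[OF _ _ _ eG_exact[OF X] s]) auto
qed

text \<open>The module \<open>e (G X)\<close> is the kernel of a retraction of the unit at \<open>e X\<close>, hence isomorphic to the
  cokernel of the unit, which depends on \<open>e X\<close> only.\<close>

lemma eG_cong:
  assumes X: "X \<in> fgmod R" and Y: "Y \<in> fgmod R" and iso: "miso S (obj e X) (obj e Y)"
  shows "miso S (obj e (G X)) (obj e (G Y))"
proof -
  note eX = e.obj_fg[OF X] and eY = e.obj_fg[OF Y]
  have UX: "obj l (obj e X) \<in> fgmod R" and UY: "obj l (obj e Y) \<in> fgmod R" using X Y by auto
  obtain f where f: "f \<in> mhom S (obj e X) (obj e Y)" "bij_betw f (carrier (obj e X)) (carrier (obj e Y))" by (rule misoE[OF iso])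
  obtain g where g: "g \<in> mhom S (obj e Y) (obj e X)" "\<And>x. x \<in> carrier (obj e X) \<Longrightarrow> g (f x) = x"
    "\<And>y. y \<in> carrier (obj e Y) \<Longrightarrow> f (g y) = y"
    by (rule mhom_inverse[OF fgmod_lm[OF eX] fgmod_lm[OF eY] f]) blast
  let ?el = "\<lambda>X Y f. arr e (obj l (obj e X)) (obj l (obj e Y)) (arr l (obj e X) (obj e Y) f)"
  have el_hom: "?el X Y f \<in> mhom S (obj e (obj l (obj e X))) (obj e (obj l (obj e Y)))"
    if "X \<in> fgmod R" "Y \<in> fgmod R" "f \<in> mhom S (obj e X) (obj e Y)" for X Y f
    using that by (intro e.arr_hom l.arr_hom) auto
  show ?thesis
  proof (rule split_kernel_cong[OF _ _ _ _ _ _ eG_exact[OF X] eG_exact[OF Y] \<eta>_hom[OF eX] \<eta>_hom[OF eY]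
        _ _ el_hom[OF X Y f(1)] el_hom[OF Y X g(1)]])
    show "arr e (obj l (obj e X)) X (\<mu> X) (\<eta> (obj e X) v) = v" if "v \<in> carrier (obj e X)" for v
      by (rule triangle_e[OF X that])
    show "arr e (obj l (obj e Y)) Y (\<mu> Y) (\<eta> (obj e Y) v) = v" if "v \<in> carrier (obj e Y)" for v
      by (rule triangle_e[OF Y that])
    show "?el Y X g (?el X Y f u) = u" if "u \<in> carrier (obj e (obj l (obj e X)))" for u
      by (rule e.arr_inverse[OF UX UY l.arr_hom[OF eX eY f(1)] l.arr_hom[OF eY eX g(1)]
            l.arr_inverse[OF eX eY f(1) g(1,2)] that])
    show "?el X Y f (?el Y X g u) = u" if "u \<in> carrier (obj e (obj l (obj e Y)))" for u
      by (rule e.arr_inverse[OF UY UX l.arr_hom[OF eY eX g(1)] l.arr_hom[OF eX eY f(1)]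
            l.arr_inverse[OF eY eX g(1) f(1) g(3)] that])
    show "\<exists>w\<in>carrier (obj e Y). ?el X Y f (\<eta> (obj e X) v) = \<eta> (obj e Y) w" if "v \<in> carrier (obj e X)" for v
      using \<eta>_natural[OF eX eY f(1) that] mhomD(1)[OF f(1) that] by metis
    show "\<exists>w\<in>carrier (obj e X). ?el Y X g (\<eta> (obj e Y) v) = \<eta> (obj e X) w" if "v \<in> carrier (obj e Y)" for v
      using \<eta>_natural[OF eY eX g(1) that] mhomD(1)[OF g(1) that] by metis
  qed (use X Y in auto)
qed

text \<open>Standard for left adjoints of exact functors: lift along \<open>e p\<close> and transpose back.\<close>

lemma l_projectives: "preserves_projectives S R l"
  unfolding preserves_projectives_def
proof (intro allI impI)
  fix P assume P: "projective S P"
  note Pf = projective_fg[OF P]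
  have lP: "obj l P \<in> fgmod R" using Pf by auto
  show "projective R (obj l P)"
  proof (rule projectiveI[OF lP])
    fix M N :: "'r lmod" and p f
    assume M: "M \<in> fgmod R" and N: "N \<in> fgmod R" and p: "p \<in> mhom R M N" and f: "f \<in> mhom R (obj l P) N"
      and onto: "p ` carrier M = carrier N"
    note eM = e.obj_fg[OF M] and eN = e.obj_fg[OF N]
    let ?ef = "arr e (obj l P) N f" and ?ep = "arr e M N p"
    have ef: "?ef \<in> mhom S (obj e (obj l P)) (obj e N)" by (rule e.arr_hom[OF lP N f])
    have ep: "?ep \<in> mhom S (obj e M) (obj e N)" by (rule e.arr_hom[OF M N p])
    have epo: "?ep ` carrier (obj e M) = carrier (obj e N)" by (rule e.arr_onto[OF M N p onto])
    let ?t = "compose (carrier P) ?ef (\<eta> P)"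
    have t: "?t \<in> mhom S P (obj e N)" by (rule mhom_comp[OF fgmod_lm[OF Pf] \<eta>_hom[OF Pf] ef])
    obtain h where h: "h \<in> mhom S P (obj e M)" "\<And>x. x \<in> carrier P \<Longrightarrow> ?ep (h x) = ?t x"
      by (rule projective_lift[OF P eM eN ep epo t]) blast
    have lh: "arr l P (obj e M) h \<in> mhom R (obj l P) (obj l (obj e M))" by (rule l.arr_hom[OF Pf eM h(1)])
    let ?g = "compose (carrier (obj l P)) (\<mu> M) (arr l P (obj e M) h)"
    have g: "?g \<in> mhom R (obj l P) M" by (rule mhom_comp[OF fgmod_lm[OF lP] lh \<mu>_hom[OF M]])
    have elP: "obj e (obj l P) \<in> fgmod S" using lP by auto
    have "p (?g z) = f z" if z: "z \<in> carrier (obj l P)" for z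
    proof -
      have lz: "arr l P (obj e M) h z \<in> carrier (obj l (obj e M))" by (rule mhomD(1)[OF lh z])
      have \<eta>z: "arr l P (obj e (obj l P)) (\<eta> P) z \<in> carrier (obj l (obj e (obj l P)))"
        by (rule mhomD(1)[OF l.arr_hom[OF Pf elP \<eta>_hom[OF Pf]] z])
      have "p (?g z) = p (\<mu> M (arr l P (obj e M) h z))" using z by (simp add: compose_def)
      also have "\<dots> = \<mu> N (arr l (obj e M) (obj e N) ?ep (arr l P (obj e M) h z))"
        by (rule \<mu>_natural[OF M N p lz, symmetric])
      also have "arr l (obj e M) (obj e N) ?ep (arr l P (obj e M) h z) = arr l P (obj e N) ?t z"
        by (rule l.arr_comp_apply[OF Pf eM eN h(1) ep t _ z, symmetric]) (simp add: h(2))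
      also have "arr l P (obj e N) ?t z =
          arr l (obj e (obj l P)) (obj e N) ?ef (arr l P (obj e (obj l P)) (\<eta> P) z)"
        by (rule l.arr_comp_apply[OF Pf elP eN \<eta>_hom[OF Pf] ef t _ z]) (simp add: compose_def)
      also have "\<mu> N \<dots> = f (\<mu> (obj l P) (arr l P (obj e (obj l P)) (\<eta> P) z))"
        by (rule \<mu>_natural[OF lP N f \<eta>z])
      also have "\<dots> = f z" by (simp add: triangle_l[OF Pf z])
      finally show ?thesis .
    qed
    then show "\<exists>h\<in>mhom R (obj l P) M. \<forall>x\<in>carrier (obj l P). p (h x) = f x" using g by blast
  qed
qed

lemma ei_iso:
  obtains \<tau> where "\<And>N. N \<in> fgmod S \<Longrightarrow> \<tau> N \<in> mhom S (obj e (obj i N)) N"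
    "\<And>N. N \<in> fgmod S \<Longrightarrow> bij_betw (\<tau> N) (carrier (obj e (obj i N))) (carrier N)"
    "\<And>(M :: 's lmod) (N :: 's lmod) f x. M \<in> fgmod S \<Longrightarrow> N \<in> fgmod S \<Longrightarrow> f \<in> mhom S M N \<Longrightarrow> x \<in> carrier (obj e (obj i M)) \<Longrightarrow>
      \<tau> N (arr e (obj i M) (obj i N) (arr i M N f) x) = f (\<tau> M x)"
proof -
  have "nat_isomorphic S S (comp_functor e i) id_functor" using cleft by (simp add: cleft_extension_def)
  then obtain \<tau> where t: "nat_transf S S (comp_functor e i) id_functor \<tau>"
    and b: "\<forall>M\<in>fgmod S. bij_betw (\<tau> M) (carrier (obj (comp_functor e i) M)) (carrier (obj id_functor M))"
    unfolding nat_isomorphic_def by blast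
  show ?thesis
  proof (rule that[of \<tau>])
    fix M N :: "'s lmod" and f x assume *: "M \<in> fgmod S" "N \<in> fgmod S" "f \<in> mhom S M N" "x \<in> carrier (obj e (obj i M))"
    have "compose (carrier (obj e (obj i M))) (\<tau> N) (arr e (obj i M) (obj i N) (arr i M N f)) =
        compose (carrier (obj e (obj i M))) f (\<tau> M)"
      using t *(1-3) by (simp add: nat_transf_def comp_functor_def id_functor_def)
    from fun_cong[OF this, of x] show "\<tau> N (arr e (obj i M) (obj i N) (arr i M N f) x) = f (\<tau> M x)"
      using *(4) by (simp add: compose_def)
  qed (use t b in \<open>auto simp: nat_transf_def comp_functor_def id_functor_def\<close>)
qed

lemma ei_miso: "N \<in> fgmod S \<Longrightarrow> miso S (obj e (obj i N)) N"
  by (rule ei_iso) (auto intro: misoI)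

text \<open>If \<open>X\<close> is a \<open>j\<close>-th syzygy over \<open>S\<close> then \<open>l X\<close> is one over \<open>R\<close>, and \<open>X\<close> is a direct
  summand of \<open>e (l X)\<close>.\<close>

lemma ext_dim_S_le_R: "ext_dim S (Syz S j) \<le> ext_dim R (Syz R j)"
proof (cases "ext_dim R (Syz R j)")
  case (enat m)
  obtain N where N: "N \<in> fgmod R" "Syz R j \<subseteq> ext_layer R {N} (m + 1)" by (rule ext_dim_attained[OF enat])
  have "Syz S j \<subseteq> ext_layer S {obj e N} (m + 1)"
  proof
    fix X assume X: "X \<in> Syz S j"
    then have Xf: "X \<in> fgmod S" by (simp add: Syz_def)
    let ?I = "obj i X"
    have I: "?I \<in> fgmod R" using Xf by auto
    have eI: "obj e ?I \<in> fgmod S" using I by auto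
    have "obj e ?I \<in> Syz S j" by (rule Syz_iso[OF eI X ei_miso[OF Xf]])
    then have "obj l (obj e ?I) \<in> ext_layer R {N} (Suc m)" using l.obj_Syz[OF l_projectives] N(2) by auto
    then have "obj e (obj l (obj e ?I)) \<in> ext_layer S {obj e N} (Suc m)" by (rule e.obj_ext_layer)
    then have "obj e ?I \<in> ext_layer S {obj e N} (Suc m)"
    proof (rule ext_layer_summand)
      show "obj e ?I \<in> fgmod S" "obj e (G ?I) \<in> fgmod S" using I by auto
      have "miso S (obj e (obj l (obj e ?I))) (dsum (obj e (G ?I)) (obj e ?I))" by (rule ele_decomposition[OF I])
      moreover have "miso S (dsum (obj e (G ?I)) (obj e ?I)) (dsum (obj e ?I) (obj e (G ?I)))"
        using I by (intro miso_dsum_comm) auto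
      moreover have "left_module S (obj e (obj l (obj e ?I)))" using I by auto
      ultimately show "miso S (obj e (obj l (obj e ?I))) (dsum (obj e ?I) (obj e (G ?I)))"
        by (blast intro: miso_trans)
    qed
    moreover have "miso S X (obj e ?I)"
      by (rule miso_sym[OF fgmod_lm[OF eI] fgmod_lm[OF Xf] ei_miso[OF Xf]])
    ultimately show "X \<in> ext_layer S {obj e N} (m + 1)" using ext_layer_iso[OF Xf] by simp
  qed
  then show ?thesis unfolding enat using ext_dim_le e.obj_fg[OF N(1)] by blast
qed simp

end


section \<open>Modules of homomorphisms and the regular module\<close>

text \<open>A ring acts on \<open>Hom(M, N)\<close> through a right action \<open>act\<close> on the first argument.\<close>

definition hom_module ::
  "('a, 'x) ring_scheme \<Rightarrow> ('a, 'm) module \<Rightarrow> ('a, 'n) module \<Rightarrow> ('b \<Rightarrow> 'm \<Rightarrow> 'm) \<Rightarrow> ('b, 'm \<Rightarrow> 'n) module" where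
  "hom_module A M N act = \<lparr>carrier = mhom A M N, mult = undefined, one = undefined,
     zero = (\<lambda>x\<in>carrier M. \<zero>\<^bsub>N\<^esub>), add = (\<lambda>\<phi> \<psi>. \<lambda>x\<in>carrier M. \<phi> x \<oplus>\<^bsub>N\<^esub> \<psi> x),
     smult = (\<lambda>b \<phi>. compose (carrier M) \<phi> (act b))\<rparr>"

lemma hom_module_simps [simp]:
  "carrier (hom_module A M N act) = mhom A M N"
  "\<zero>\<^bsub>hom_module A M N act\<^esub> = (\<lambda>x\<in>carrier M. \<zero>\<^bsub>N\<^esub>)"
  "\<phi> \<oplus>\<^bsub>hom_module A M N act\<^esub> \<psi> = (\<lambda>x\<in>carrier M. \<phi> x \<oplus>\<^bsub>N\<^esub> \<psi> x)"
  "b \<odot>\<^bsub>hom_module A M N act\<^esub> \<phi> = compose (carrier M) \<phi> (act b)"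
  by (simp_all add: hom_module_def)

lemma mhom_sum:
  assumes "left_module A M" "left_module A N" "\<phi> \<in> mhom A M N" "\<psi> \<in> mhom A M N"
  shows "(\<lambda>x\<in>carrier M. \<phi> x \<oplus>\<^bsub>N\<^esub> \<psi> x) \<in> mhom A M N"
proof -
  interpret N: left_module A N by fact
  show ?thesis
    by (rule mhom_restrictI[OF assms(1)])
       (simp_all add: mhomD[OF assms(3)] mhomD[OF assms(4)] N.M.a_ac N.smult_r_distr)
qed

lemma mhom_uminus:
  assumes "left_module A M" "left_module A N" "\<phi> \<in> mhom A M N"
  shows "(\<lambda>x\<in>carrier M. \<ominus>\<^bsub>N\<^esub> \<phi> x) \<in> mhom A M N"
proof -
  interpret N: left_module A N by fact
  show ?thesis
    by (rule mhom_restrictI[OF assms(1)])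
       (simp_all add: mhomD[OF assms(3)] N.M.minus_add N.smult_neg)
qed

lemma left_module_hom_module:
  assumes M: "left_module A M" and N: "left_module A N" and B: "ring B"
    and act: "\<And>b. b \<in> carrier B \<Longrightarrow> act b \<in> mhom A M M"
    and act_add: "\<And>b c x. b \<in> carrier B \<Longrightarrow> c \<in> carrier B \<Longrightarrow> x \<in> carrier M \<Longrightarrow> act (b \<oplus>\<^bsub>B\<^esub> c) x = act b x \<oplus>\<^bsub>M\<^esub> act c x"
    and act_mult: "\<And>b c x. b \<in> carrier B \<Longrightarrow> c \<in> carrier B \<Longrightarrow> x \<in> carrier M \<Longrightarrow> act (b \<otimes>\<^bsub>B\<^esub> c) x = act c (act b x)"
    and act_one: "\<And>x. x \<in> carrier M \<Longrightarrow> act \<one>\<^bsub>B\<^esub> x = x"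
  shows "left_module B (hom_module A M N act)"
proof -
  interpret M: left_module A M by fact
  interpret N: left_module A N by fact
  interpret B: ring B by fact
  note ext = mhomD(4)
  have eq: "\<phi> = \<psi>" if "\<phi> \<in> extensional (carrier M)" "\<psi> \<in> extensional (carrier M)"
    "\<And>x. x \<in> carrier M \<Longrightarrow> \<phi> x = \<psi> x" for \<phi> \<psi> :: "'c \<Rightarrow> 'd"
    by (rule extensionalityI[OF that])
  have actc: "act b x \<in> carrier M" if "b \<in> carrier B" "x \<in> carrier M" for b x using mhomD(1)[OF act] that by blast
  note cl = mhomD(1)
  have "abelian_group (hom_module A M N act)"
  proof (rule abelian_groupI, goal_cases)
    case (1 \<phi> \<psi>)
    then show ?case using mhom_sum[OF M N] by simp
  next
    case 2
    show ?case using mhom_zero_map[OF M N] by simp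
  next
    case (3 \<phi> \<psi> \<chi>)
    then have c: "\<phi> x \<in> carrier N" "\<psi> x \<in> carrier N" "\<chi> x \<in> carrier N" if "x \<in> carrier M" for x
      using that cl by auto
    show ?case unfolding hom_module_simps by (rule eq) (simp_all add: c N.M.a_assoc)
  next
    case (4 \<phi> \<psi>)
    then have c: "\<phi> x \<in> carrier N" "\<psi> x \<in> carrier N" if "x \<in> carrier M" for x using that cl by auto
    show ?case unfolding hom_module_simps by (rule eq) (simp_all add: c N.M.a_comm)
  next
    case (5 \<phi>)
    then have c: "\<phi> x \<in> carrier N" if "x \<in> carrier M" for x using that cl by auto
    show ?case unfolding hom_module_simps by (rule eq) (use 5 ext in \<open>auto simp: c\<close>)
  next
    case (6 \<phi>)
    then have c: "\<phi> x \<in> carrier N" if "x \<in> carrier M" for x using that cl by auto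
    have "(\<lambda>x\<in>carrier M. \<ominus>\<^bsub>N\<^esub> \<phi> x) \<in> mhom A M N" using mhom_uminus[OF M N] 6 by simp
    then show ?case unfolding hom_module_simps
      by (rule bexI[rotated]) (rule eq, simp_all add: c N.M.l_neg)
  qed
  moreover have "left_module_axioms B (hom_module A M N act)"
  proof (rule left_module_axioms.intro, goal_cases)
    case (1 b \<phi>)
    then show ?case using mhom_comp[OF M act] by simp
  next
    case (2 b c \<phi>)
    then have h: "\<phi> \<in> mhom A M N" by simp
    show ?case unfolding hom_module_simps
      by (rule eq) (use 2 in \<open>simp_all add: compose_def actc act_add mhomD[OF h]\<close>)
  next
    case (3 b \<phi> \<psi>)
    then show ?case unfolding hom_module_simps
      by (intro eq) (simp_all add: compose_def actc)
  next
    case (4 b c \<phi>)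
    then show ?case unfolding hom_module_simps
      by (intro eq) (simp_all add: compose_def actc act_mult)
  next
    case (5 \<phi>)
    then show ?case unfolding hom_module_simps
      by (intro eq) (use ext in \<open>auto simp: compose_def act_one\<close>)
  qed
  ultimately show ?thesis by (intro left_module.intro B)
qed

text \<open>The regular module on lists of length one, which makes it an object of the module category.\<close>

definition reg :: "('a, 'x) ring_scheme \<Rightarrow> 'a lmod" where
  "reg A = \<lparr>carrier = (\<lambda>a. [a]) ` carrier A, mult = undefined, one = undefined, zero = [\<zero>\<^bsub>A\<^esub>],
     add = (\<lambda>u v. [hd u \<oplus>\<^bsub>A\<^esub> hd v]), smult = (\<lambda>a u. [a \<otimes>\<^bsub>A\<^esub> hd u])\<rparr>"

lemma reg_simps [simp]:
  "carrier (reg A) = (\<lambda>a. [a]) ` carrier A" "\<zero>\<^bsub>reg A\<^esub> = [\<zero>\<^bsub>A\<^esub>]"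
  "u \<oplus>\<^bsub>reg A\<^esub> v = [hd u \<oplus>\<^bsub>A\<^esub> hd v]" "a \<odot>\<^bsub>reg A\<^esub> u = [a \<otimes>\<^bsub>A\<^esub> hd u]"
  by (simp_all add: reg_def)

lemma left_module_reg: "ring A \<Longrightarrow> left_module A (reg A)"
  by (rule left_module_image[OF left_module_regular, of A "\<lambda>a. [a]"]) auto

text \<open>The homomorphism out of the regular module that sends \<open>1\<close> to \<open>x\<close>; if \<open>X\<close> is the regular module
  itself, this is right multiplication by \<open>x\<close>.\<close>

definition from_reg :: "('a, 'x) ring_scheme \<Rightarrow> ('a, 'm) module \<Rightarrow> 'm \<Rightarrow> 'a list \<Rightarrow> 'm" where
  "from_reg A X x = (\<lambda>u\<in>carrier (reg A). hd u \<odot>\<^bsub>X\<^esub> x)"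

abbreviation rmult :: "('a, 'x) ring_scheme \<Rightarrow> 'a \<Rightarrow> 'a list \<Rightarrow> 'a list" where
  "rmult A a \<equiv> from_reg A (reg A) [a]"

lemma from_reg_apply [simp]: "a \<in> carrier A \<Longrightarrow> from_reg A X x [a] = a \<odot>\<^bsub>X\<^esub> x"
  by (simp add: from_reg_def)

lemma from_reg_hom:
  assumes "left_module A X" "x \<in> carrier X" shows "from_reg A X x \<in> mhom A (reg A) X"
proof -
  interpret X: left_module A X by fact
  show ?thesis unfolding from_reg_def
    by (rule mhom_restrictI[OF left_module_reg[OF X.R.ring_axioms]])
       (use assms(2) in \<open>auto simp: X.smult_closed X.smult_l_distr X.smult_assoc1\<close>)
qed

lemma rmult_hom: "ring A \<Longrightarrow> a \<in> carrier A \<Longrightarrow> rmult A a \<in> mhom A (reg A) (reg A)"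
  by (rule from_reg_hom[OF left_module_reg]) auto

lemma reg_fg:
  assumes "ring A" shows "reg A \<in> fgmod A"
proof -
  interpret ring A by fact
  note lm = left_module_reg[OF assms]
  have s: "msub A (reg A) (mspan A (reg A) {[\<one>\<^bsub>A\<^esub>]})" by (rule msub_mspan[OF lm]) auto
  have "carrier (reg A) \<subseteq> mspan A (reg A) {[\<one>\<^bsub>A\<^esub>]}"
  proof
    fix u assume "u \<in> carrier (reg A)"
    then obtain a where a: "a \<in> carrier A" "u = [a]" by auto
    have "a \<odot>\<^bsub>reg A\<^esub> [\<one>\<^bsub>A\<^esub>] \<in> mspan A (reg A) {[\<one>\<^bsub>A\<^esub>]}"
      using msubD(4)[OF s a(1)] mspan_superset[of "{[\<one>\<^bsub>A\<^esub>]}" A "reg A"] by blast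
    then show "u \<in> mspan A (reg A) {[\<one>\<^bsub>A\<^esub>]}" using a by simp
  qed
  then have "mspan A (reg A) {[\<one>\<^bsub>A\<^esub>]} = carrier (reg A)" using msubD(1)[OF s] by blast
  then show ?thesis using lm unfolding fgmod_mspan by (intro conjI exI[of _ "{[\<one>\<^bsub>A\<^esub>]}"]) auto
qed

lemma reg_projective:
  assumes "ring A" shows "projective A (reg A)"
proof (rule projectiveI[OF reg_fg[OF assms]])
  interpret ring A by fact
  fix M N :: "'a lmod" and p f
  assume M: "M \<in> fgmod A" and N: "N \<in> fgmod A" and p: "p \<in> mhom A M N" and f: "f \<in> mhom A (reg A) N"
    and onto: "p ` carrier M = carrier N"
  have "f [\<one>\<^bsub>A\<^esub>] \<in> carrier N" by (rule mhomD(1)[OF f]) auto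
  then obtain m where m: "m \<in> carrier M" "p m = f [\<one>\<^bsub>A\<^esub>]" using onto by (metis imageE)
  have "p (from_reg A M m u) = f u" if u: "u \<in> carrier (reg A)" for u
  proof -
    obtain a where a: "a \<in> carrier A" "u = [a]" using u by auto
    have "f (a \<odot>\<^bsub>reg A\<^esub> [\<one>\<^bsub>A\<^esub>]) = a \<odot>\<^bsub>N\<^esub> f [\<one>\<^bsub>A\<^esub>]" by (rule mhomD(3)[OF f a(1)]) auto
    then show ?thesis using a m by (simp add: mhomD(3)[OF p])
  qed
  then show "\<exists>h\<in>mhom A (reg A) M. \<forall>x\<in>carrier (reg A). p (h x) = f x"
    using from_reg_hom[OF fgmod_lm[OF M] m(1)] by blast
qed


section \<open>Finiteness of the coinduced modules\<close>

context cleft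
begin

text \<open>Multiplication by a scalar is natural in the \<open>R\<close>-module. As \<open>e\<close> need not be \<open>k\<close>-linear, the
  resulting action of \<open>k\<close> on \<open>e X\<close> may differ from the one that comes from \<open>S\<close>.\<close>

definition scal :: "'r lmod \<Rightarrow> 'k \<Rightarrow> 'r list \<Rightarrow> 'r list" where
  "scal X c = (\<lambda>x\<in>carrier X. central R c \<odot>\<^bsub>X\<^esub> x)"

definition escal :: "'r lmod \<Rightarrow> 'k \<Rightarrow> 's list \<Rightarrow> 's list" where
  "escal X c = arr e X X (scal X c)"

lemma scal_hom:
  assumes X: "X \<in> fgmod R" and c: "c \<in> carrier k" shows "scal X c \<in> mhom R X X"
proof -
  interpret X: left_module R X by (rule fgmod_lm[OF X])
  show ?thesis unfolding scal_def
    by (rule mhom_restrictI[OF fgmod_lm[OF X]])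
       (use c in \<open>auto simp: X.smult_closed X.smult_r_distr X.smult_assoc1[symmetric] Rk.central_mult\<close>)
qed

lemma escal_hom: "X \<in> fgmod R \<Longrightarrow> c \<in> carrier k \<Longrightarrow> escal X c \<in> mhom S (obj e X) (obj e X)"
  unfolding escal_def by (intro e.arr_hom scal_hom)

lemma escal_closed: "X \<in> fgmod R \<Longrightarrow> c \<in> carrier k \<Longrightarrow> y \<in> carrier (obj e X) \<Longrightarrow> escal X c y \<in> carrier (obj e X)"
  by (rule mhomD(1)[OF escal_hom])

lemma escal_natural:
  assumes X: "X \<in> fgmod R" and Y: "Y \<in> fgmod R" and f: "f \<in> mhom R X Y" and c: "c \<in> carrier k" and y: "y \<in> carrier (obj e X)"
  shows "arr e X Y f (escal X c y) = escal Y c (arr e X Y f y)"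
proof -
  interpret X: left_module R X by (rule fgmod_lm[OF X])
  let ?h = "compose (carrier X) f (scal X c)"
  have h: "?h \<in> mhom R X Y" by (rule mhom_comp[OF fgmod_lm[OF X] scal_hom[OF X c] f])
  have hx: "?h x = f (scal X c x)" "?h x = scal Y c (f x)" if "x \<in> carrier X" for x
    using that c mhomD(1)[OF f that] by (simp_all add: compose_def scal_def mhomD(3)[OF f] X.smult_closed)
  have "arr e X Y ?h y = arr e X Y f (escal X c y)"
    unfolding escal_def by (rule e.arr_comp_apply[OF X X Y scal_hom[OF X c] f h hx(1) y])
  moreover have "arr e X Y ?h y = escal Y c (arr e X Y f y)"
    unfolding escal_def by (rule e.arr_comp_apply[OF X Y Y f scal_hom[OF Y c] h hx(2) y])
  ultimately show ?thesis by simp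
qed

lemma escal_add:
  assumes X: "X \<in> fgmod R" and "c \<in> carrier k" "d \<in> carrier k" "y \<in> carrier (obj e X)"
  shows "escal X (c \<oplus>\<^bsub>k\<^esub> d) y = escal X c y \<oplus>\<^bsub>obj e X\<^esub> escal X d y"
proof -
  interpret X: left_module R X by (rule fgmod_lm[OF X])
  show ?thesis unfolding escal_def
    by (rule e.arr_add[OF X X scal_hom scal_hom scal_hom])
       (use assms in \<open>auto simp: scal_def Rk.central_add X.smult_l_distr\<close>)
qed

lemma escal_mult:
  assumes X: "X \<in> fgmod R" and "c \<in> carrier k" "d \<in> carrier k" "y \<in> carrier (obj e X)"
  shows "escal X (c \<otimes>\<^bsub>k\<^esub> d) y = escal X c (escal X d y)"
proof -
  interpret X: left_module R X by (rule fgmod_lm[OF X])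
  show ?thesis unfolding escal_def
    by (rule e.arr_comp_apply[OF X X X scal_hom scal_hom scal_hom])
       (use assms in \<open>auto simp: scal_def Rk.central_times X.smult_assoc1 X.smult_closed\<close>)
qed

lemma escal_one:
  assumes X: "X \<in> fgmod R" and "y \<in> carrier (obj e X)" shows "escal X \<one>\<^bsub>k\<^esub> y = y"
proof -
  interpret X: left_module R X by (rule fgmod_lm[OF X])
  show ?thesis unfolding escal_def
    by (rule e.arr_id_apply[OF X scal_hom])
       (use assms in \<open>auto simp: scal_def Rk.central_one X.smult_one\<close>)
qed

definition ek :: "'r lmod \<Rightarrow> ('k, 's list) module" where
  "ek X = \<lparr>carrier = carrier (obj e X), mult = undefined, one = undefined, zero = \<zero>\<^bsub>obj e X\<^esub>,
     add = (\<lambda>x y. x \<oplus>\<^bsub>obj e X\<^esub> y), smult = escal X\<rparr>"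

lemma ek_simps [simp]:
  "carrier (ek X) = carrier (obj e X)" "\<zero>\<^bsub>ek X\<^esub> = \<zero>\<^bsub>obj e X\<^esub>" "x \<oplus>\<^bsub>ek X\<^esub> y = x \<oplus>\<^bsub>obj e X\<^esub> y"
  "c \<odot>\<^bsub>ek X\<^esub> x = escal X c x"
  by (simp_all add: ek_def)

lemma left_module_ek:
  assumes X: "X \<in> fgmod R" shows "left_module k (ek X)"
proof -
  interpret E: left_module S "obj e X" using X by auto
  have "abelian_group (ek X)"
  proof (rule abelian_groupI)
    fix x assume "x \<in> carrier (ek X)"
    then show "\<exists>y\<in>carrier (ek X). y \<oplus>\<^bsub>ek X\<^esub> x = \<zero>\<^bsub>ek X\<^esub>"
      by (intro bexI[of _ "\<ominus>\<^bsub>obj e X\<^esub> x"]) (auto simp: E.M.l_neg)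
  qed (auto simp: E.M.a_ac)
  then show ?thesis
    by (intro left_module.intro left_module_axioms.intro Rk.k.ring_axioms)
       (use X in \<open>auto simp: escal_closed escal_add escal_mult escal_one mhomD(2)[OF escal_hom]\<close>)
qed

text \<open>By adjunction \<open>e X = Hom(S, e X) = Hom(l S, X)\<close>, and evaluation at finitely many generators of \<open>l S\<close>
  embeds this into a finite power of \<open>X\<close>.\<close>

lemma noeth_ek:
  assumes X: "X \<in> fgmod R" shows "noeth_mod k (ek X)"
proof -
  let ?S = "reg S" and ?E = "obj e X"
  have Sf: "?S \<in> fgmod S" by (rule reg_fg[OF Sk.ring_A])
  have E: "?E \<in> fgmod S" using X by auto
  have lS: "obj l ?S \<in> fgmod R" and lE: "obj l ?E \<in> fgmod R" using Sf E by auto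
  note lmX = fgmod_lm[OF X] and lmE = fgmod_lm[OF E] and lmlS = fgmod_lm[OF lS]
  interpret X: left_module R X by (rule lmX)
  interpret E: left_module S ?E by (rule lmE)
  obtain B where B: "finite B" "B \<subseteq> carrier (obj l ?S)" "mspan R (obj l ?S) B = carrier (obj l ?S)"
    using lS by (auto simp: fgmod_mspan)
  let ?l = "\<lambda>y. arr l ?S ?E (from_reg S ?E y)"
  have at: "from_reg S ?E y \<in> mhom S ?S ?E" if "y \<in> carrier ?E" for y by (rule from_reg_hom[OF lmE that])
  have l: "?l y \<in> mhom R (obj l ?S) (obj l ?E)" if "y \<in> carrier ?E" for y by (rule l.arr_hom[OF Sf E at[OF that]])
  have lc: "?l y b \<in> carrier (obj l ?E)" if "y \<in> carrier ?E" "b \<in> carrier (obj l ?S)" for y b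
    by (rule mhomD(1)[OF l[OF that(1)] that(2)])
  have \<mu>c: "\<mu> X z \<in> carrier X" if "z \<in> carrier (obj l ?E)" for z by (rule mhomD(1)[OF \<mu>_hom[OF X] that])
  let ?f = "\<lambda>b. restrict (\<lambda>y. \<mu> X (?l y b)) (carrier (ek X))"
  show ?thesis
  proof (rule noeth_mod_jointly_injective[OF left_module_ek[OF X] B(1),
      of "Rk.restrict_scalars X" ?f])
    show "left_module k (Rk.restrict_scalars X)" by (rule Rk.left_module_restrict_scalars[OF lmX])
    show "noeth_mod k (Rk.restrict_scalars X)" by (rule Rk.noeth_restrict_scalars[OF X])
    fix b assume "b \<in> B"
    then have b: "b \<in> carrier (obj l ?S)" using B by auto
    show "?f b \<in> mhom k (ek X) (Rk.restrict_scalars X)"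
    proof (rule mhom_restrictI[OF left_module_ek[OF X]])
      fix x y assume "x \<in> carrier (ek X)" "y \<in> carrier (ek X)"
      then have xy: "x \<in> carrier ?E" "y \<in> carrier ?E" by simp_all
      have "?l (x \<oplus>\<^bsub>?E\<^esub> y) b = ?l x b \<oplus>\<^bsub>obj l ?E\<^esub> ?l y b"
        by (rule l.arr_add[OF Sf E at at at _ b])
           (use xy in \<open>auto simp: E.smult_r_distr\<close>)
      then show "\<mu> X (?l (x \<oplus>\<^bsub>ek X\<^esub> y) b) = \<mu> X (?l x b) \<oplus>\<^bsub>Rk.restrict_scalars X\<^esub> \<mu> X (?l y b)"
        using mhomD(2)[OF \<mu>_hom[OF X] lc[OF xy(1) b] lc[OF xy(2) b]] by simp
    next
      fix c x assume c: "c \<in> carrier k" and "x \<in> carrier (ek X)"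
      then have x: "x \<in> carrier ?E" by simp
      have cx: "escal X c x \<in> carrier ?E" by (rule escal_closed[OF X c x])
      have "?l (escal X c x) b = arr l ?E ?E (escal X c) (?l x b)"
        by (rule l.arr_comp_apply[OF Sf E E at[OF x] escal_hom[OF X c] at[OF cx] _ b])
           (use x in \<open>auto simp: mhomD(3)[OF escal_hom[OF X c]]\<close>)
      then have "\<mu> X (?l (escal X c x) b) = scal X c (\<mu> X (?l x b))"
        unfolding escal_def using \<mu>_natural[OF X X scal_hom[OF X c] lc[OF x b]] by simp
      then show "\<mu> X (?l (c \<odot>\<^bsub>ek X\<^esub> x) b) = c \<odot>\<^bsub>Rk.restrict_scalars X\<^esub> \<mu> X (?l x b)"
        using \<mu>c[OF lc[OF x b]] by (simp add: scal_def)
    qed (use lc \<mu>c b in auto)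
  next
    fix y assume "y \<in> carrier (ek X)" and z: "\<And>b. b \<in> B \<Longrightarrow> ?f b y = \<zero>\<^bsub>Rk.restrict_scalars X\<^esub>"
    then have y: "y \<in> carrier ?E" by simp
    let ?h = "compose (carrier (obj l ?S)) (\<mu> X) (?l y)"
    have h: "?h \<in> mhom R (obj l ?S) X" by (rule mhom_comp[OF lmlS l[OF y] \<mu>_hom[OF X]])
    have "?h z = \<zero>\<^bsub>X\<^esub>" if "z \<in> carrier (obj l ?S)" for z
    proof (rule mhom_zero_on_generators[OF lmlS lmX h B(2)])
      show "z \<in> mspan R (obj l ?S) B" using that B(3) by simp
      show "?h b = \<zero>\<^bsub>X\<^esub>" if "b \<in> B" for b using z[OF that] y B(2) that by (auto simp: compose_def)
    qed
    then have h0: "arr e (obj l ?S) X ?h w = \<zero>\<^bsub>?E\<^esub>" if "w \<in> carrier (obj e (obj l ?S))" for w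
      by (rule e.arr_zero[OF lS X h _ that])
    have one: "[\<one>\<^bsub>S\<^esub>] \<in> carrier ?S" by auto
    let ?w = "\<eta> ?S [\<one>\<^bsub>S\<^esub>]"
    have w: "?w \<in> carrier (obj e (obj l ?S))" by (rule mhomD(1)[OF \<eta>_hom[OF Sf] one])
    have "arr e (obj l ?S) X ?h ?w = arr e (obj l ?E) X (\<mu> X) (arr e (obj l ?S) (obj l ?E) (?l y) ?w)"
      by (rule e.arr_comp_apply[OF lS lE X l[OF y] \<mu>_hom[OF X] h _ w]) (simp add: compose_def)
    also have "arr e (obj l ?S) (obj l ?E) (?l y) ?w = \<eta> ?E (from_reg S ?E y [\<one>\<^bsub>S\<^esub>])"
      by (rule \<eta>_natural[OF Sf E at[OF y] one, symmetric])
    also have "from_reg S ?E y [\<one>\<^bsub>S\<^esub>] = y" using y by (simp add: E.smult_one)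
    also have "arr e (obj l ?E) X (\<mu> X) (\<eta> ?E y) = y" by (rule triangle_e[OF X y])
    finally show "y = \<zero>\<^bsub>ek X\<^esub>" using h0[OF w] by simp
  qed
qed

abbreviation hom_k :: "'r lmod \<Rightarrow> 's lmod \<Rightarrow> ('k, 's list \<Rightarrow> 's list) module" where
  "hom_k X Z \<equiv> hom_module S (obj e X) Z (escal X)"

lemma left_module_hom_k:
  assumes X: "X \<in> fgmod R" and Z: "Z \<in> fgmod S" shows "left_module k (hom_k X Z)"
proof (rule left_module_hom_module[OF e.obj_lm[OF X] fgmod_lm[OF Z] Rk.k.ring_axioms escal_hom[OF X] escal_add[OF X]])
  fix b c x assume *: "b \<in> carrier k" "c \<in> carrier k" "x \<in> carrier (obj e X)"
  have "escal X (b \<otimes>\<^bsub>k\<^esub> c) x = escal X (c \<otimes>\<^bsub>k\<^esub> b) x" using * by (simp add: Rk.k.m_comm)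
  then show "escal X (b \<otimes>\<^bsub>k\<^esub> c) x = escal X c (escal X b x)" using escal_mult[OF X] * by simp
qed (simp_all add: escal_one[OF X])

lemma precompose_hom_k:
  assumes X: "X \<in> fgmod R" and Y: "Y \<in> fgmod R" and Z: "Z \<in> fgmod S" and f: "f \<in> mhom R X Y"
  shows "restrict (\<lambda>\<phi>. compose (carrier (obj e X)) \<phi> (arr e X Y f)) (carrier (hom_k Y Z)) \<in> mhom k (hom_k Y Z) (hom_k X Z)"
proof (rule mhom_restrictI[OF left_module_hom_k[OF Y Z]])
  note lX = e.obj_lm[OF X] and ef = e.arr_hom[OF X Y f]
  have efc: "arr e X Y f x \<in> carrier (obj e Y)" if "x \<in> carrier (obj e X)" for x by (rule mhomD(1)[OF ef that])
  fix \<phi> assume "\<phi> \<in> carrier (hom_k Y Z)"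
  then have \<phi>: "\<phi> \<in> mhom S (obj e Y) Z" by simp
  show "compose (carrier (obj e X)) \<phi> (arr e X Y f) \<in> carrier (hom_k X Z)" using mhom_comp[OF lX ef \<phi>] by simp
  { fix \<psi> assume "\<psi> \<in> carrier (hom_k Y Z)"
    show "compose (carrier (obj e X)) (\<phi> \<oplus>\<^bsub>hom_k Y Z\<^esub> \<psi>) (arr e X Y f) =
        compose (carrier (obj e X)) \<phi> (arr e X Y f) \<oplus>\<^bsub>hom_k X Z\<^esub> compose (carrier (obj e X)) \<psi> (arr e X Y f)"
      by (rule ext) (simp add: compose_def efc restrict_def) }
  { fix c assume c: "c \<in> carrier k"
    show "compose (carrier (obj e X)) (c \<odot>\<^bsub>hom_k Y Z\<^esub> \<phi>) (arr e X Y f) =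
        c \<odot>\<^bsub>hom_k X Z\<^esub> compose (carrier (obj e X)) \<phi> (arr e X Y f)"
      by (rule ext) (simp add: compose_def efc restrict_def escal_natural[OF X Y f c] escal_closed[OF X c]) }
qed

text \<open>Evaluation at generators of \<open>e (i Y)\<close> embeds the module into finitely many copies of \<open>e (i Z)\<close>;
  that evaluation respects the scalars rests on the naturality of \<open>e (i Z) \<cong> Z\<close>.\<close>

lemma noeth_hom_k_i:
  assumes Y: "Y \<in> fgmod S" and Z: "Z \<in> fgmod S" shows "noeth_mod k (hom_k (obj i Y) Z)"
proof -
  obtain \<tau> where t: "\<And>N. N \<in> fgmod S \<Longrightarrow> \<tau> N \<in> mhom S (obj e (obj i N)) N"
    "\<And>N. N \<in> fgmod S \<Longrightarrow> bij_betw (\<tau> N) (carrier (obj e (obj i N))) (carrier N)"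
    "\<And>(M :: 's lmod) (N :: 's lmod) f x. M \<in> fgmod S \<Longrightarrow> N \<in> fgmod S \<Longrightarrow> f \<in> mhom S M N \<Longrightarrow> x \<in> carrier (obj e (obj i M)) \<Longrightarrow>
      \<tau> N (arr e (obj i M) (obj i N) (arr i M N f) x) = f (\<tau> M x)"
    by (rule ei_iso) blast
  have iY: "obj i Y \<in> fgmod R" and iZ: "obj i Z \<in> fgmod R" using Y Z by auto
  let ?Y = "obj e (obj i Y)" and ?Z = "obj e (obj i Z)"
  have eY: "?Y \<in> fgmod S" and eZ: "?Z \<in> fgmod S" using iY iZ by auto
  obtain B where B: "finite B" "B \<subseteq> carrier ?Y" "mspan S ?Y B = carrier ?Y" using eY by (auto simp: fgmod_mspan)
  obtain v where v: "v \<in> mhom S Z ?Z" "\<And>z. z \<in> carrier ?Z \<Longrightarrow> v (\<tau> Z z) = z" "\<And>z. z \<in> carrier Z \<Longrightarrow> \<tau> Z (v z) = z"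
    by (rule mhom_inverse[OF fgmod_lm[OF eZ] fgmod_lm[OF Z] t(1)[OF Z] t(2)[OF Z]]) blast
  obtain u where u: "u \<in> mhom S Y ?Y" "\<And>y. y \<in> carrier ?Y \<Longrightarrow> u (\<tau> Y y) = y" "\<And>z. z \<in> carrier Y \<Longrightarrow> \<tau> Y (u z) = z"
    by (rule mhom_inverse[OF fgmod_lm[OF eY] fgmod_lm[OF Y] t(1)[OF Y] t(2)[OF Y]]) blast
  let ?f = "\<lambda>b. restrict (\<lambda>\<phi>. v (\<phi> b)) (carrier (hom_k (obj i Y) Z))"
  show ?thesis
  proof (rule noeth_mod_jointly_injective[OF left_module_hom_k[OF iY Z] B(1), of "ek (obj i Z)" ?f])
    show "left_module k (ek (obj i Z))" "noeth_mod k (ek (obj i Z))"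
      by (rule left_module_ek[OF iZ] noeth_ek[OF iZ])+
    fix b assume "b \<in> B"
    then have b: "b \<in> carrier ?Y" using B by auto
    show "?f b \<in> mhom k (hom_k (obj i Y) Z) (ek (obj i Z))"
    proof (rule mhom_restrictI[OF left_module_hom_k[OF iY Z]])
      fix \<phi> assume "\<phi> \<in> carrier (hom_k (obj i Y) Z)"
      then have \<phi>: "\<phi> \<in> mhom S ?Y Z" by simp
      show "v (\<phi> b) \<in> carrier (ek (obj i Z))" using mhomD(1)[OF v(1) mhomD(1)[OF \<phi> b]] by simp
      { fix \<psi> assume "\<psi> \<in> carrier (hom_k (obj i Y) Z)"
        then have \<psi>: "\<psi> \<in> mhom S ?Y Z" by simp
        show "v ((\<phi> \<oplus>\<^bsub>hom_k (obj i Y) Z\<^esub> \<psi>) b) = v (\<phi> b) \<oplus>\<^bsub>ek (obj i Z)\<^esub> v (\<psi> b)"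
          using b mhomD(2)[OF v(1) mhomD(1)[OF \<phi> b] mhomD(1)[OF \<psi> b]] by simp }
      { fix c assume c: "c \<in> carrier k"
        let ?p = "compose (carrier Y) \<phi> u"
        have p: "?p \<in> mhom S Y Z" by (rule mhom_comp[OF fgmod_lm[OF Y] u(1) \<phi>])
        let ?a = "arr e (obj i Y) (obj i Z) (arr i Y Z ?p)"
        have ip: "arr i Y Z ?p \<in> mhom R (obj i Y) (obj i Z)" by (rule i.arr_hom[OF Y Z p])
        have a: "v (\<phi> x) = ?a x" if x: "x \<in> carrier ?Y" for x
        proof -
          have "\<tau> Z (?a x) = ?p (\<tau> Y x)" by (rule t(3)[OF Y Z p x])
          also have "\<dots> = \<phi> x" using u(2)[OF x] mhomD(1)[OF t(1)[OF Y] x] by (simp add: compose_def)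
          finally show ?thesis using v(2)[OF mhomD(1)[OF e.arr_hom[OF iY iZ ip] x]] by simp
        qed
        have "v (\<phi> (escal (obj i Y) c b)) = escal (obj i Z) c (v (\<phi> b))"
          using a[OF escal_closed[OF iY c b]] a[OF b] escal_natural[OF iY iZ ip c b] by simp
        then show "v ((c \<odot>\<^bsub>hom_k (obj i Y) Z\<^esub> \<phi>) b) = c \<odot>\<^bsub>ek (obj i Z)\<^esub> v (\<phi> b)"
          using b by (simp add: compose_def) }
    qed
  next
    fix \<phi> assume "\<phi> \<in> carrier (hom_k (obj i Y) Z)" and z: "\<And>b. b \<in> B \<Longrightarrow> ?f b \<phi> = \<zero>\<^bsub>ek (obj i Z)\<^esub>"
    then have \<phi>: "\<phi> \<in> mhom S ?Y Z" by simp
    have gen: "\<phi> b = \<zero>\<^bsub>Z\<^esub>" if "b \<in> B" for b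
    proof -
      have "v (\<phi> b) = \<zero>\<^bsub>?Z\<^esub>" using z[OF that] \<phi> by simp
      then show ?thesis
        using v(3)[of "\<phi> b"] that B(2) mhomD(1)[OF \<phi>] mhom_zero[OF fgmod_lm[OF eZ] fgmod_lm[OF Z] t(1)[OF Z]] by auto
    qed
    have "\<phi> x = \<zero>\<^bsub>Z\<^esub>" if "x \<in> carrier ?Y" for x
      by (rule mhom_zero_on_generators[OF fgmod_lm[OF eY] fgmod_lm[OF Z] \<phi> B(2) gen]) (use that B(3) in auto)
    then show "\<phi> = \<zero>\<^bsub>hom_k (obj i Y) Z\<^esub>"
      using extensionalityI[OF mhomD(4)[OF \<phi>], of "\<lambda>x\<in>carrier ?Y. \<zero>\<^bsub>Z\<^esub>"] by simp
  qed
qed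

lemma noeth_hom_k_quotient:
  assumes X: "X \<in> fgmod R" and Y: "Y \<in> fgmod R" and Z: "Z \<in> fgmod S" and g: "g \<in> mhom R X Y"
    and onto: "g ` carrier X = carrier Y" and n: "noeth_mod k (hom_k X Z)"
  shows "noeth_mod k (hom_k Y Z)"
proof (rule noeth_mod_injective[OF left_module_hom_k[OF Y Z] left_module_hom_k[OF X Z] n precompose_hom_k[OF X Y Z g]])
  have eo: "arr e X Y g ` carrier (obj e X) = carrier (obj e Y)" by (rule e.arr_onto[OF X Y g onto])
  show "inj_on (restrict (\<lambda>\<phi>. compose (carrier (obj e X)) \<phi> (arr e X Y g)) (carrier (hom_k Y Z))) (carrier (hom_k Y Z))"
  proof (rule inj_onI)
    fix \<phi> \<psi> assume "\<phi> \<in> carrier (hom_k Y Z)" "\<psi> \<in> carrier (hom_k Y Z)"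
      and eq: "restrict (\<lambda>\<phi>. compose (carrier (obj e X)) \<phi> (arr e X Y g)) (carrier (hom_k Y Z)) \<phi> =
        restrict (\<lambda>\<phi>. compose (carrier (obj e X)) \<phi> (arr e X Y g)) (carrier (hom_k Y Z)) \<psi>"
    then have h: "\<phi> \<in> mhom S (obj e Y) Z" "\<psi> \<in> mhom S (obj e Y) Z" by simp_all
    then have eq': "compose (carrier (obj e X)) \<phi> (arr e X Y g) = compose (carrier (obj e X)) \<psi> (arr e X Y g)"
      using eq by simp
    show "\<phi> = \<psi>"
    proof (rule mhom_eqI[OF h])
      fix y assume "y \<in> carrier (obj e Y)"
      then obtain x where x: "x \<in> carrier (obj e X)" "y = arr e X Y g x" using eo by blast
      then show "\<phi> y = \<psi> y" using fun_cong[OF eq', of x] by (simp add: compose_def)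
    qed
  qed
qed

text \<open>Left exactness of \<open>Hom(e -, Z)\<close>: a homomorphism on \<open>e Y\<close> that vanishes on \<open>e X\<close> comes from \<open>e W\<close>.\<close>

lemma noeth_hom_k_extension:
  assumes fg: "X \<in> fgmod R" "Y \<in> fgmod R" "W \<in> fgmod R" and Z: "Z \<in> fgmod S" and s: "short_exact R X f Y g W"
    and n: "noeth_mod k (hom_k X Z)" "noeth_mod k (hom_k W Z)"
  shows "noeth_mod k (hom_k Y Z)"
proof -
  note sd = short_exactD[OF s] and ed = short_exactD[OF e.preserves_exact[OF fg s]]
  let ?F = "restrict (\<lambda>\<phi>. compose (carrier (obj e X)) \<phi> (arr e X Y f)) (carrier (hom_k Y Z))"
  let ?P = "restrict (\<lambda>\<phi>. compose (carrier (obj e Y)) \<phi> (arr e Y W g)) (carrier (hom_k W Z))"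
  have F: "?F \<in> mhom k (hom_k Y Z) (hom_k X Z)" by (rule precompose_hom_k[OF fg(1,2) Z sd(1)])
  have P: "?P \<in> mhom k (hom_k W Z) (hom_k Y Z)" by (rule precompose_hom_k[OF fg(2,3) Z sd(2)])
  interpret eY: left_module S "obj e Y" using fg(2) by auto
  show ?thesis
  proof (rule noeth_on_extension[OF left_module_hom_k[OF fg(2) Z] left_module_hom_k[OF fg(1) Z] F])
    show "noeth_on k (hom_k X Z) (?F ` carrier (hom_k Y Z))"
      by (rule noeth_on_subset[OF n(1)]) (use mhomD(1)[OF F] in blast)
    have "{\<phi> \<in> carrier (hom_k Y Z). ?F \<phi> = \<zero>\<^bsub>hom_k X Z\<^esub>} \<subseteq> ?P ` carrier (hom_k W Z)"
    proof
      fix \<phi> assume \<phi>0: "\<phi> \<in> {\<phi> \<in> carrier (hom_k Y Z). ?F \<phi> = \<zero>\<^bsub>hom_k X Z\<^esub>}"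
      then have \<phi>: "\<phi> \<in> mhom S (obj e Y) Z" by simp
      have "compose (carrier (obj e X)) \<phi> (arr e X Y f) = ?F \<phi>" using \<phi> by simp
      also have "\<dots> = (\<lambda>x\<in>carrier (obj e X). \<zero>\<^bsub>Z\<^esub>)"
        using \<phi>0 unfolding mem_Collect_eq hom_module_simps(2) by (rule conjunct2)
      finally have "compose (carrier (obj e X)) \<phi> (arr e X Y f) = (\<lambda>x\<in>carrier (obj e X). \<zero>\<^bsub>Z\<^esub>)" .
      note \<phi>f0 = fun_cong[OF this]
      have \<phi>f: "\<phi> (arr e X Y f x) = \<zero>\<^bsub>Z\<^esub>" if "x \<in> carrier (obj e X)" for x
        using \<phi>f0[of x] that by (simp add: compose_def)
      let ?q = "arr e Y W g"
      have "\<exists>y\<in>carrier (obj e Y). w = ?q y" if "w \<in> carrier (obj e W)" for w using that ed(6) by blast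
      then obtain r where r: "\<And>w. w \<in> carrier (obj e W) \<Longrightarrow> r w \<in> carrier (obj e Y)"
        "\<And>w. w \<in> carrier (obj e W) \<Longrightarrow> ?q (r w) = w" by metis
      have wd: "\<phi> (r (?q y)) = \<phi> y" if y: "y \<in> carrier (obj e Y)" for y
      proof -
        have q: "?q y \<in> carrier (obj e W)" by (rule mhomD(1)[OF ed(2) y])
        interpret eW: left_module S "obj e W" using fg(3) by auto
        interpret Z: left_module S Z by (rule fgmod_lm[OF Z])
        have d: "r (?q y) \<ominus>\<^bsub>obj e Y\<^esub> y \<in> carrier (obj e Y)" using r(1)[OF q] y by simp
        have "?q (r (?q y) \<ominus>\<^bsub>obj e Y\<^esub> y) = \<zero>\<^bsub>obj e W\<^esub>"
          using r[OF q] q y by (simp add: mhom_minus[OF e.obj_lm[OF fg(2)] e.obj_lm[OF fg(3)] ed(2)])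
        then obtain x where x: "x \<in> carrier (obj e X)" "r (?q y) \<ominus>\<^bsub>obj e Y\<^esub> y = arr e X Y f x" using ed(5)[OF d] by blast
        have "\<phi> (r (?q y)) \<ominus>\<^bsub>Z\<^esub> \<phi> y = \<zero>\<^bsub>Z\<^esub>"
          using \<phi>f[OF x(1)] x(2) mhom_minus[OF e.obj_lm[OF fg(2)] fgmod_lm[OF Z] \<phi> r(1)[OF q] y] by simp
        then show ?thesis using Z.M.minus_eq_zero_iff mhomD(1)[OF \<phi>] r(1)[OF q] y by blast
      qed
      let ?\<psi> = "restrict (\<lambda>w. \<phi> (r w)) (carrier (obj e W))"
      have "?\<psi> \<in> mhom S (obj e W) Z"
      proof (rule mhom_restrictI[OF e.obj_lm[OF fg(3)]])
        fix w assume w: "w \<in> carrier (obj e W)"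
        show "\<phi> (r w) \<in> carrier Z" using mhomD(1)[OF \<phi> r(1)[OF w]] .
        { fix w' assume w': "w' \<in> carrier (obj e W)"
          have "?q (r w \<oplus>\<^bsub>obj e Y\<^esub> r w') = w \<oplus>\<^bsub>obj e W\<^esub> w'" using r w w' mhomD(2)[OF ed(2)] by simp
          then show "\<phi> (r (w \<oplus>\<^bsub>obj e W\<^esub> w')) = \<phi> (r w) \<oplus>\<^bsub>Z\<^esub> \<phi> (r w')"
            using wd[of "r w \<oplus>\<^bsub>obj e Y\<^esub> r w'"] r(1) w w' mhomD(2)[OF \<phi>] by simp }
        { fix a assume a: "a \<in> carrier S"
          have "?q (a \<odot>\<^bsub>obj e Y\<^esub> r w) = a \<odot>\<^bsub>obj e W\<^esub> w" using r w a mhomD(3)[OF ed(2)] by simp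
          then show "\<phi> (r (a \<odot>\<^bsub>obj e W\<^esub> w)) = a \<odot>\<^bsub>Z\<^esub> \<phi> (r w)"
            using wd[of "a \<odot>\<^bsub>obj e Y\<^esub> r w"] r(1) w a mhomD(3)[OF \<phi>] eY.smult_closed by simp }
      qed
      moreover have "?P ?\<psi> = \<phi>"
      proof -
        have "compose (carrier (obj e Y)) ?\<psi> ?q = \<phi>"
          by (rule extensionalityI[of _ "carrier (obj e Y)"])
             (use mhomD(4)[OF \<phi>] wd mhomD(1)[OF ed(2)] in \<open>auto simp: compose_def\<close>)
        then show ?thesis using \<open>?\<psi> \<in> mhom S (obj e W) Z\<close> by simp
      qed
      ultimately show "\<phi> \<in> ?P ` carrier (hom_k W Z)"
        by (intro image_eqI[of _ _ ?\<psi>]) (simp_all only: hom_module_simps)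
    qed
    moreover have "noeth_on k (hom_k Y Z) (?P ` carrier (hom_k W Z))"
      by (rule noeth_on_image[OF left_module_hom_k[OF fg(3) Z] left_module_hom_k[OF fg(2) Z] P
            msub_carrier[OF left_module_hom_k[OF fg(3) Z]] n(2)])
    ultimately show "noeth_on k (hom_k Y Z) {\<phi> \<in> carrier (hom_k Y Z). ?F \<phi> = \<zero>\<^bsub>hom_k X Z\<^esub>}"
      by (rule noeth_on_subset[rotated])
  qed
qed

abbreviation F :: "'s lmod \<Rightarrow> 's lmod" where
  "F N \<equiv> obj e (G (obj i N))"

lemma functor_power_obj: "obj (functor_power (induced_endofunctor i e l \<mu>) n) N = (F ^^ n) N"
  by (induction n) (simp_all add: id_functor_def comp_functor_def[of "induced_endofunctor i e l \<mu>"] F_obj)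

text \<open>The exact sequence \<open>0 \<rightarrow> G (i Y) \<rightarrow> l Y \<rightarrow> i Y \<rightarrow> 0\<close> with \<open>Y = e X\<close> and the epimorphism
  \<open>l (F Y) \<rightarrow> G (i Y)\<close> lead from \<open>F Y\<close> back to \<open>Y\<close>.\<close>

lemma noeth_hom_k_le:
  assumes Z: "Z \<in> fgmod S"
  shows "X \<in> fgmod R \<Longrightarrow> zero_module ((F ^^ n) (obj e X)) \<Longrightarrow> noeth_mod k (hom_k (obj l (obj e X)) Z)"
proof (induction n arbitrary: X)
  case 0
  let ?U = "obj l (obj e X)"
  have U: "?U \<in> fgmod R" using 0 by auto
  have "zero_module (obj e X)" using 0 by simp
  then have "zero_module (obj e ?U)" by (intro e.obj_zero[OF U] l.obj_zero[OF e.obj_fg[OF 0(1)]])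
  then have z: "x = \<zero>\<^bsub>obj e ?U\<^esub>" if "x \<in> carrier (obj e ?U)" for x using that by (auto simp: zero_module_def)
  have "carrier (hom_k ?U Z) \<subseteq> {\<zero>\<^bsub>hom_k ?U Z\<^esub>}"
  proof
    fix \<phi> assume "\<phi> \<in> carrier (hom_k ?U Z)"
    then have \<phi>: "\<phi> \<in> mhom S (obj e ?U) Z" by simp
    have "\<phi> = (\<lambda>x\<in>carrier (obj e ?U). \<zero>\<^bsub>Z\<^esub>)"
    proof (rule extensionalityI[OF mhomD(4)[OF \<phi>]])
      fix x assume x: "x \<in> carrier (obj e ?U)"
      show "\<phi> x = (\<lambda>x\<in>carrier (obj e ?U). \<zero>\<^bsub>Z\<^esub>) x"
        using x mhom_zero[OF e.obj_lm[OF U] fgmod_lm[OF Z] \<phi>] z[OF x] by simp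
    qed simp
    then show "\<phi> \<in> {\<zero>\<^bsub>hom_k ?U Z\<^esub>}" by simp
  qed
  then show ?case by (rule noeth_on_subset[OF noeth_on_zero])
next
  case (Suc n)
  let ?Y = "obj e X"
  have Y: "?Y \<in> fgmod S" using Suc.prems by auto
  let ?I = "obj i ?Y"
  have I: "?I \<in> fgmod R" and GI: "G ?I \<in> fgmod R" using Y by auto
  have fgs: "obj l (obj e (G ?I)) \<in> fgmod R" "obj l (obj e ?I) \<in> fgmod R" "obj e ?I \<in> fgmod S" "obj l ?Y \<in> fgmod R"
    using I GI Y by auto
  have "zero_module ((F ^^ n) (obj e (G ?I)))" using Suc.prems(2) by (simp add: funpow_Suc_right del: funpow.simps)
  then have "noeth_mod k (hom_k (obj l (obj e (G ?I))) Z)" by (rule Suc.IH[OF GI])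
  then have "noeth_mod k (hom_k (G ?I) Z)"
    by (rule noeth_hom_k_quotient[OF fgs(1) GI Z \<mu>_hom[OF GI] \<mu>_onto[OF GI]])
  then have n: "noeth_mod k (hom_k (obj l (obj e ?I)) Z)"
    using noeth_hom_k_extension[OF GI fgs(2) I Z G_exact[OF I]] noeth_hom_k_i[OF Y Z] by blast
  obtain f where f: "f \<in> mhom S (obj e ?I) ?Y" "bij_betw f (carrier (obj e ?I)) (carrier ?Y)"
    by (rule misoE[OF ei_miso[OF Y]])
  show ?case
    by (rule noeth_hom_k_quotient[OF fgs(2,4) Z l.arr_hom[OF fgs(3) Y f(1)] l.arr_onto[OF fgs(3) Y f(1)] n])
       (use f(2) in \<open>simp add: bij_betw_def\<close>)
qed

text \<open>Right multiplications on \<open>R\<close> act on \<open>e R\<close>. They make \<open>Z \<mapsto> Hom(e R, Z)\<close> the right adjoint of \<open>e\<close>, and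
  \<open>\<nu>\<close> is the unit of this adjunction.\<close>

definition act :: "'r \<Rightarrow> 's list \<Rightarrow> 's list" where
  "act r = arr e (reg R) (reg R) (rmult R r)"

definition T :: "'r lmod \<Rightarrow> ('r, 's list \<Rightarrow> 's list) module" where
  "T A = hom_module S (obj e (reg R)) (obj e A) act"

definition \<nu> :: "'r lmod \<Rightarrow> 'r list \<Rightarrow> 's list \<Rightarrow> 's list" where
  "\<nu> A = (\<lambda>x\<in>carrier A. arr e (reg R) A (from_reg R A x))"

lemma R_fg: "reg R \<in> fgmod R" by (rule reg_fg[OF Rk.ring_A])

lemma act_hom: "r \<in> carrier R \<Longrightarrow> act r \<in> mhom S (obj e (reg R)) (obj e (reg R))"
  unfolding act_def by (rule e.arr_hom[OF R_fg R_fg rmult_hom[OF Rk.ring_A]])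

lemma left_module_T:
  assumes A: "A \<in> fgmod R" shows "left_module R (T A)"
  unfolding T_def
proof (rule left_module_hom_module[OF e.obj_lm[OF R_fg] e.obj_lm[OF A] Rk.ring_A act_hom])
  note h = rmult_hom[OF Rk.ring_A]
  fix x assume x: "x \<in> carrier (obj e (reg R))"
  { fix b c assume b: "b \<in> carrier R" and c: "c \<in> carrier R"
    show "act (b \<oplus>\<^bsub>R\<^esub> c) x = act b x \<oplus>\<^bsub>obj e (reg R)\<^esub> act c x" unfolding act_def
      by (rule e.arr_add[OF R_fg R_fg h[OF b] h[OF c] h[OF Rk.A.a_closed[OF b c]] _ x])
         (use b c in \<open>auto simp: Rk.A.r_distr\<close>)
    show "act (b \<otimes>\<^bsub>R\<^esub> c) x = act c (act b x)" unfolding act_def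
      by (rule e.arr_comp_apply[OF R_fg R_fg R_fg h[OF b] h[OF c] h[OF Rk.A.m_closed[OF b c]] _ x])
         (use b c in \<open>auto simp: Rk.A.m_assoc\<close>) }
  show "act \<one>\<^bsub>R\<^esub> x = x" unfolding act_def
    by (rule e.arr_id_apply[OF R_fg h[OF Rk.A.one_closed] _ x]) auto
qed

lemma T_simps [simp]:
  "carrier (T A) = mhom S (obj e (reg R)) (obj e A)" "\<zero>\<^bsub>T A\<^esub> = (\<lambda>x\<in>carrier (obj e (reg R)). \<zero>\<^bsub>obj e A\<^esub>)"
  "\<phi> \<oplus>\<^bsub>T A\<^esub> \<psi> = (\<lambda>x\<in>carrier (obj e (reg R)). \<phi> x \<oplus>\<^bsub>obj e A\<^esub> \<psi> x)"
  "r \<odot>\<^bsub>T A\<^esub> \<phi> = compose (carrier (obj e (reg R))) \<phi> (act r)"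
  by (simp_all add: T_def)

text \<open>Over \<open>k\<close>, which acts through the centre of \<open>R\<close>, the module \<open>T A\<close> is noetherian because \<open>R\<close> is a
  quotient of \<open>l (e R)\<close>.\<close>

lemma T_fg:
  assumes A: "A \<in> fgmod R" and zero: "zero_functor S (functor_power (induced_endofunctor i e l \<mu>) n)"
  shows "T A \<in> fgmod R"
proof -
  have eA: "obj e A \<in> fgmod S" and eR: "obj e (reg R) \<in> fgmod S" using A R_fg by auto
  have U: "obj l (obj e (reg R)) \<in> fgmod R" using eR by auto
  have "zero_module ((F ^^ n) (obj e (reg R)))"
    using zero eR unfolding zero_functor_def functor_power_obj by blast
  then have "noeth_mod k (hom_k (obj l (obj e (reg R))) (obj e A))" by (rule noeth_hom_k_le[OF eA R_fg])
  then have n: "noeth_mod k (hom_k (reg R) (obj e A))"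
    by (rule noeth_hom_k_quotient[OF U R_fg eA \<mu>_hom[OF R_fg] \<mu>_onto[OF R_fg]])
  have lmT: "left_module k (Rk.restrict_scalars (T A))" by (rule Rk.left_module_restrict_scalars[OF left_module_T[OF A]])
  have act_eq: "act (central R c) = escal (reg R) c" if c: "c \<in> carrier k" for c
  proof -
    have "rmult R (central R c) = scal (reg R) c"
      by (rule mhom_eqI[OF rmult_hom[OF Rk.ring_A] scal_hom[OF R_fg c]])
         (use c in \<open>auto simp: scal_def Rk.central_mult\<close>)
    then show ?thesis by (simp add: act_def escal_def)
  qed
  have "restrict (\<lambda>\<phi>. \<phi>) (carrier (Rk.restrict_scalars (T A))) \<in> mhom k (Rk.restrict_scalars (T A)) (hom_k (reg R) (obj e A))"
    by (rule mhom_restrictI[OF lmT]) (simp_all add: act_eq)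
  then have "noeth_mod k (Rk.restrict_scalars (T A))"
    by (rule noeth_mod_injective[OF lmT left_module_hom_k[OF R_fg eA] n]) simp
  then have "noeth_mod R (T A)" by (rule Rk.noeth_mod_descends[OF left_module_T[OF A]])
  then obtain B where "finite B" "B \<subseteq> carrier (T A)" "mspan R (T A) B = carrier (T A)"
    by (rule noeth_onD[OF _ msub_carrier[OF left_module_T[OF A]]]) auto
  then show ?thesis using left_module_T[OF A] unfolding fgmod_mspan by blast
qed

lemma at_R_hom: "A \<in> fgmod R \<Longrightarrow> x \<in> carrier A \<Longrightarrow> from_reg R A x \<in> mhom R (reg R) A"
  by (rule from_reg_hom[OF fgmod_lm])

lemma e_at_hom: "A \<in> fgmod R \<Longrightarrow> x \<in> carrier A \<Longrightarrow> arr e (reg R) A (from_reg R A x) \<in> mhom S (obj e (reg R)) (obj e A)"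
  by (rule e.arr_hom[OF R_fg _ at_R_hom])

lemma e_at_add:
  assumes A: "A \<in> fgmod R" and x: "x \<in> carrier A" and y: "y \<in> carrier A" and w: "w \<in> carrier (obj e (reg R))"
  shows "arr e (reg R) A (from_reg R A (x \<oplus>\<^bsub>A\<^esub> y)) w = arr e (reg R) A (from_reg R A x) w \<oplus>\<^bsub>obj e A\<^esub> arr e (reg R) A (from_reg R A y) w"
proof -
  interpret A: left_module R A by (rule fgmod_lm[OF A])
  show ?thesis
    by (rule e.arr_add[OF R_fg A at_R_hom[OF A x] at_R_hom[OF A y] at_R_hom[OF A A.M.a_closed[OF x y]] _ w])
       (use x y in \<open>auto simp: A.smult_r_distr\<close>)
qed

lemma e_at_smult:
  assumes A: "A \<in> fgmod R" and r: "r \<in> carrier R" and x: "x \<in> carrier A" and w: "w \<in> carrier (obj e (reg R))"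
  shows "arr e (reg R) A (from_reg R A (r \<odot>\<^bsub>A\<^esub> x)) w = arr e (reg R) A (from_reg R A x) (act r w)"
proof -
  interpret A: left_module R A by (rule fgmod_lm[OF A])
  show ?thesis unfolding act_def
    by (rule e.arr_comp_apply[OF R_fg R_fg A rmult_hom[OF Rk.ring_A r] at_R_hom[OF A x] at_R_hom[OF A A.smult_closed[OF r x]] _ w])
       (use r x in \<open>auto simp: A.smult_assoc1\<close>)
qed

lemma e_at_natural:
  assumes A: "A \<in> fgmod R" and B: "B \<in> fgmod R" and f: "f \<in> mhom R A B" and x: "x \<in> carrier A" and w: "w \<in> carrier (obj e (reg R))"
  shows "arr e (reg R) B (from_reg R B (f x)) w = arr e A B f (arr e (reg R) A (from_reg R A x) w)"
  by (rule e.arr_comp_apply[OF R_fg A B at_R_hom[OF A x] f at_R_hom[OF B mhomD(1)[OF f x]] _ w])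
     (use x in \<open>auto simp: mhomD(3)[OF f]\<close>)

text \<open>For an \<open>S\<close>-homomorphism \<open>s\<close> defined on \<open>e L\<close>, the map \<open>x \<mapsto> s \<circ> e (from_reg x)\<close> is \<open>R\<close>-linear:
  this is the adjunction between \<open>e\<close> and coinduction. It yields \<open>\<nu>\<close> for the identity.\<close>

lemma coinduced_hom:
  assumes L: "L \<in> fgmod R" and A: "A \<in> fgmod R" and s: "s \<in> mhom S (obj e L) (obj e A)"
  shows "(\<lambda>x\<in>carrier L. compose (carrier (obj e (reg R))) s (arr e (reg R) L (from_reg R L x))) \<in> mhom R L (T A)"
proof (rule mhom_restrictI[OF fgmod_lm[OF L]])
  let ?E = "obj e (reg R)"
  have c: "arr e (reg R) L (from_reg R L x) w \<in> carrier (obj e L)" if "x \<in> carrier L" "w \<in> carrier ?E" for x w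
    by (rule mhomD(1)[OF e_at_hom[OF L that(1)] that(2)])
  fix x assume x: "x \<in> carrier L"
  show "compose (carrier ?E) s (arr e (reg R) L (from_reg R L x)) \<in> carrier (T A)"
    using mhom_comp[OF e.obj_lm[OF R_fg] e_at_hom[OF L x] s] by simp
  { fix y assume y: "y \<in> carrier L"
    show "compose (carrier ?E) s (arr e (reg R) L (from_reg R L (x \<oplus>\<^bsub>L\<^esub> y))) =
        compose (carrier ?E) s (arr e (reg R) L (from_reg R L x)) \<oplus>\<^bsub>T A\<^esub> compose (carrier ?E) s (arr e (reg R) L (from_reg R L y))"
      by (rule ext) (simp add: compose_def restrict_def e_at_add[OF L x y] c x y mhomD(2)[OF s]) }
  { fix r assume r: "r \<in> carrier R"
    show "compose (carrier ?E) s (arr e (reg R) L (from_reg R L (r \<odot>\<^bsub>L\<^esub> x))) =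
        r \<odot>\<^bsub>T A\<^esub> compose (carrier ?E) s (arr e (reg R) L (from_reg R L x))"
      by (rule ext) (simp add: compose_def restrict_def e_at_smult[OF L r x] mhomD(1)[OF act_hom[OF r]]) }
qed

lemma \<nu>_apply: "x \<in> carrier A \<Longrightarrow> \<nu> A x = arr e (reg R) A (from_reg R A x)"
  by (simp add: \<nu>_def)

lemma \<nu>_hom:
  assumes A: "A \<in> fgmod R" shows "\<nu> A \<in> mhom R A (T A)"
proof -
  have id: "mid (obj e A) \<in> mhom S (obj e A) (obj e A)" by (rule mid_mhom[OF e.obj_lm[OF A]])
  have "compose (carrier (obj e (reg R))) (mid (obj e A)) (arr e (reg R) A (from_reg R A x)) = arr e (reg R) A (from_reg R A x)"
    if x: "x \<in> carrier A" for x
    by (rule extensionalityI[of _ "carrier (obj e (reg R))"])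
       (use mhomD(1,4)[OF e_at_hom[OF A x]] in \<open>auto simp: compose_def\<close>)
  then have "\<nu> A = (\<lambda>x\<in>carrier A. compose (carrier (obj e (reg R))) (mid (obj e A)) (arr e (reg R) A (from_reg R A x)))"
    by (auto simp: \<nu>_def)
  then show ?thesis using coinduced_hom[OF A A id] by simp
qed

lemma \<nu>_inj:
  assumes A: "A \<in> fgmod R" shows "inj_on (\<nu> A) (carrier A)"
proof (rule inj_onI)
  interpret A: left_module R A by (rule fgmod_lm[OF A])
  fix x y assume xy: "x \<in> carrier A" "y \<in> carrier A" "\<nu> A x = \<nu> A y"
  have "from_reg R A x = from_reg R A y"
    by (rule e_faithfulD[OF R_fg A at_R_hom[OF A xy(1)] at_R_hom[OF A xy(2)]])
       (use xy in \<open>simp add: \<nu>_apply\<close>)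
  from fun_cong[OF this, of "[\<one>\<^bsub>R\<^esub>]"] show "x = y" using xy by (simp add: A.smult_one)
qed

end


section \<open>The cokernel of the embedding into the coinduced module\<close>

locale nilpotent_cleft = cleft k R S i l e \<eta> \<mu>
  for k :: "'k ring" and R :: "('k, 'r) module" and S :: "('k, 's) module"
    and i l :: "('s, 'r) mfunctor" and e :: "('r, 's) mfunctor"
    and \<eta> :: "'s lmod \<Rightarrow> 's list \<Rightarrow> 's list" and \<mu> :: "'r lmod \<Rightarrow> 'r list \<Rightarrow> 'r list" +
  fixes n :: nat
  assumes nilpotent: "zero_functor S (functor_power (induced_endofunctor i e l \<mu>) n)"
begin

lemma T_finite [simp]: "A \<in> fgmod R \<Longrightarrow> T A \<in> fgmod R"
  by (rule T_fg[OF _ nilpotent])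

definition is_coker :: "'r lmod \<Rightarrow> 'r lmod \<Rightarrow> (('s list \<Rightarrow> 's list) \<Rightarrow> 'r list) \<Rightarrow> bool" where
  "is_coker A Q p \<longleftrightarrow> Q \<in> fgmod R \<and> p \<in> mhom R (T A) Q \<and> p ` carrier (T A) = carrier Q \<and>
     {\<psi> \<in> carrier (T A). p \<psi> = \<zero>\<^bsub>Q\<^esub>} = \<nu> A ` carrier A"

definition Hobj :: "'r lmod \<Rightarrow> 'r lmod" where
  "Hobj A = fst (SOME (Q, p). is_coker A Q p)"

definition \<pi> :: "'r lmod \<Rightarrow> ('s list \<Rightarrow> 's list) \<Rightarrow> 'r list" where
  "\<pi> A = snd (SOME (Q, p). is_coker A Q p)"

lemma coker:
  assumes A: "A \<in> fgmod R" shows "is_coker A (Hobj A) (\<pi> A)"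
proof -
  have "msub R (T A) (\<nu> A ` carrier A)"
    by (rule msub_image[OF fgmod_lm[OF A] left_module_T[OF A] \<nu>_hom[OF A] msub_carrier[OF fgmod_lm[OF A]]])
  then obtain Q :: "'r lmod" and p where "Q \<in> fgmod R" "p \<in> mhom R (T A) Q" "p ` carrier (T A) = carrier Q"
    "{\<psi> \<in> carrier (T A). p \<psi> = \<zero>\<^bsub>Q\<^esub>} = \<nu> A ` carrier A"
    by (rule quotient_exists[OF T_finite[OF A]])
  then have "case (Q, p) of (Q, p) \<Rightarrow> is_coker A Q p" unfolding is_coker_def by blast
  then have "case (SOME (Q, p). is_coker A Q p) of (Q, p) \<Rightarrow> is_coker A Q p" by (rule someI)
  then show ?thesis by (simp add: Hobj_def \<pi>_def case_prod_unfold)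
qed

lemma H_fg [simp]: "A \<in> fgmod R \<Longrightarrow> Hobj A \<in> fgmod R"
  using coker by (simp add: is_coker_def)

lemma \<pi>_hom: "A \<in> fgmod R \<Longrightarrow> \<pi> A \<in> mhom R (T A) (Hobj A)"
  using coker by (simp add: is_coker_def)

lemma \<pi>_onto:
  assumes "A \<in> fgmod R" "q \<in> carrier (Hobj A)"
  obtains \<psi> where "\<psi> \<in> carrier (T A)" "\<pi> A \<psi> = q"
proof -
  have "\<pi> A ` carrier (T A) = carrier (Hobj A)" using coker[OF assms(1)] unfolding is_coker_def by (elim conjE)
  then have "q \<in> \<pi> A ` carrier (T A)" using assms(2) by (simp only:)
  then show ?thesis using that by blast
qed

lemma \<pi>_zero_iff:
  assumes "A \<in> fgmod R" "\<psi> \<in> carrier (T A)"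
  shows "\<pi> A \<psi> = \<zero>\<^bsub>Hobj A\<^esub> \<longleftrightarrow> (\<exists>x\<in>carrier A. \<psi> = \<nu> A x)"
  using coker[OF assms(1)] assms(2) unfolding is_coker_def by blast

lemma \<pi>_\<nu>:
  assumes A: "A \<in> fgmod R" and x: "x \<in> carrier A" shows "\<pi> A (\<nu> A x) = \<zero>\<^bsub>Hobj A\<^esub>"
  using \<pi>_zero_iff[OF A mhomD(1)[OF \<nu>_hom[OF A] x]] x by blast

definition Tarr :: "'r lmod \<Rightarrow> 'r lmod \<Rightarrow> ('r list \<Rightarrow> 'r list) \<Rightarrow> ('s list \<Rightarrow> 's list) \<Rightarrow> 's list \<Rightarrow> 's list" where
  "Tarr A B f = (\<lambda>\<psi>\<in>carrier (T A). compose (carrier (obj e (reg R))) (arr e A B f) \<psi>)"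

lemma Tarr_apply:
  assumes "\<psi> \<in> carrier (T A)" "w \<in> carrier (obj e (reg R))"
  shows "Tarr A B f \<psi> w = arr e A B f (\<psi> w)"
  using assms by (simp add: Tarr_def compose_def)

lemma T_closed: "\<psi> \<in> carrier (T A) \<Longrightarrow> w \<in> carrier (obj e (reg R)) \<Longrightarrow> \<psi> w \<in> carrier (obj e A)"
  using mhomD(1) by auto

lemma T_eqI:
  assumes "\<phi> \<in> carrier (T A)" "\<psi> \<in> carrier (T A)" "\<And>w. w \<in> carrier (obj e (reg R)) \<Longrightarrow> \<phi> w = \<psi> w"
  shows "\<phi> = \<psi>"
  using assms by (auto intro: mhom_eqI)

lemma Tarr_hom:
  assumes A: "A \<in> fgmod R" and B: "B \<in> fgmod R" and f: "f \<in> mhom R A B"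
  shows "Tarr A B f \<in> mhom R (T A) (T B)"
  unfolding Tarr_def
proof (rule mhom_restrictI[OF left_module_T[OF A]])
  let ?E = "obj e (reg R)" and ?f = "arr e A B f"
  note ef = e.arr_hom[OF A B f]
  fix \<psi> assume \<psi>: "\<psi> \<in> carrier (T A)"
  then have h: "\<psi> \<in> mhom S ?E (obj e A)" by simp
  show "compose (carrier ?E) ?f \<psi> \<in> carrier (T B)" using mhom_comp[OF e.obj_lm[OF R_fg] h ef] by simp
  { fix \<phi> assume \<phi>: "\<phi> \<in> carrier (T A)"
    show "compose (carrier ?E) ?f (\<psi> \<oplus>\<^bsub>T A\<^esub> \<phi>) = compose (carrier ?E) ?f \<psi> \<oplus>\<^bsub>T B\<^esub> compose (carrier ?E) ?f \<phi>"
      by (rule ext) (simp add: compose_def restrict_def mhomD(2)[OF ef] T_closed[OF \<psi>] T_closed[OF \<phi>]) }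
  { fix r assume r: "r \<in> carrier R"
    show "compose (carrier ?E) ?f (r \<odot>\<^bsub>T A\<^esub> \<psi>) = r \<odot>\<^bsub>T B\<^esub> compose (carrier ?E) ?f \<psi>"
      by (rule ext) (simp add: compose_def restrict_def mhomD(1)[OF act_hom[OF r]]) }
qed

lemma Tarr_\<nu>:
  assumes A: "A \<in> fgmod R" and B: "B \<in> fgmod R" and f: "f \<in> mhom R A B" and x: "x \<in> carrier A"
  shows "Tarr A B f (\<nu> A x) = \<nu> B (f x)"
proof (rule T_eqI)
  have n: "\<nu> A x \<in> carrier (T A)" by (rule mhomD(1)[OF \<nu>_hom[OF A] x])
  show "Tarr A B f (\<nu> A x) \<in> carrier (T B)" by (rule mhomD(1)[OF Tarr_hom[OF A B f] n])
  show "\<nu> B (f x) \<in> carrier (T B)" by (rule mhomD(1)[OF \<nu>_hom[OF B] mhomD(1)[OF f x]])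
  fix w assume w: "w \<in> carrier (obj e (reg R))"
  have "Tarr A B f (\<nu> A x) w = arr e A B f (\<nu> A x w)" by (rule Tarr_apply[OF n w])
  also have "\<dots> = \<nu> B (f x) w"
    unfolding \<nu>_apply[OF x] \<nu>_apply[OF mhomD(1)[OF f x]]
    by (rule e_at_natural[OF A B f x w, symmetric])
  finally show "Tarr A B f (\<nu> A x) w = \<nu> B (f x) w" .
qed

definition Harr :: "'r lmod \<Rightarrow> 'r lmod \<Rightarrow> ('r list \<Rightarrow> 'r list) \<Rightarrow> 'r list \<Rightarrow> 'r list" where
  "Harr A B f = (\<lambda>q\<in>carrier (Hobj A). \<pi> B (Tarr A B f (SOME \<psi>. \<psi> \<in> carrier (T A) \<and> \<pi> A \<psi> = q)))"

definition H :: "('r, 'r) mfunctor" where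
  "H = \<lparr>obj = Hobj, arr = Harr\<rparr>"

text \<open>The value does not depend on the chosen preimage, because \<open>T f\<close> maps the image of \<open>\<nu>\<close> into the image
  of \<open>\<nu>\<close>.\<close>

lemma Harr_\<pi>:
  assumes A: "A \<in> fgmod R" and B: "B \<in> fgmod R" and f: "f \<in> mhom R A B" and \<psi>: "\<psi> \<in> carrier (T A)"
  shows "Harr A B f (\<pi> A \<psi>) = \<pi> B (Tarr A B f \<psi>)"
proof -
  interpret HA: left_module R "Hobj A" by (rule fgmod_lm[OF H_fg[OF A]])
  interpret HB: left_module R "Hobj B" by (rule fgmod_lm[OF H_fg[OF B]])
  interpret TA: left_module R "T A" by (rule left_module_T[OF A])
  note lTA = left_module_T[OF A] and lTB = left_module_T[OF B] and lHA = fgmod_lm[OF H_fg[OF A]] and lHB = fgmod_lm[OF H_fg[OF B]]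
  define \<psi>' where "\<psi>' = (SOME \<phi>. \<phi> \<in> carrier (T A) \<and> \<pi> A \<phi> = \<pi> A \<psi>)"
  have "\<psi>' \<in> carrier (T A) \<and> \<pi> A \<psi>' = \<pi> A \<psi>" unfolding \<psi>'_def by (rule someI[of _ \<psi>]) (simp only: \<psi> simp_thms)
  then have \<psi>': "\<psi>' \<in> carrier (T A)" "\<pi> A \<psi>' = \<pi> A \<psi>" by blast+
  have q: "\<pi> A \<psi> \<in> carrier (Hobj A)" by (rule mhomD(1)[OF \<pi>_hom[OF A] \<psi>])
  have d: "\<psi>' \<ominus>\<^bsub>T A\<^esub> \<psi> \<in> carrier (T A)" by (rule TA.M.minus_closed[OF \<psi>'(1) \<psi>])
  have "\<pi> A (\<psi>' \<ominus>\<^bsub>T A\<^esub> \<psi>) = \<zero>\<^bsub>Hobj A\<^esub>"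
    unfolding mhom_minus[OF lTA lHA \<pi>_hom[OF A] \<psi>'(1) \<psi>] \<psi>'(2) by (rule HA.M.minus_self[OF q])
  then obtain x where x: "x \<in> carrier A" "\<psi>' \<ominus>\<^bsub>T A\<^esub> \<psi> = \<nu> A x" using \<pi>_zero_iff[OF A d] by blast
  note t = mhomD(1)[OF Tarr_hom[OF A B f] \<psi>'(1)] mhomD(1)[OF Tarr_hom[OF A B f] \<psi>]
  have "\<pi> B (Tarr A B f \<psi>') \<ominus>\<^bsub>Hobj B\<^esub> \<pi> B (Tarr A B f \<psi>) = \<pi> B (Tarr A B f (\<psi>' \<ominus>\<^bsub>T A\<^esub> \<psi>))"
    unfolding mhom_minus[OF lTA lTB Tarr_hom[OF A B f] \<psi>'(1) \<psi>] mhom_minus[OF lTB lHB \<pi>_hom[OF B] t] ..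
  also have "\<dots> = \<zero>\<^bsub>Hobj B\<^esub>"
    unfolding x(2) Tarr_\<nu>[OF A B f x(1)] by (rule \<pi>_\<nu>[OF B mhomD(1)[OF f x(1)]])
  finally have "\<pi> B (Tarr A B f \<psi>') = \<pi> B (Tarr A B f \<psi>)"
    using HB.M.minus_eq_zero_iff[OF mhomD(1)[OF \<pi>_hom[OF B] t(1)] mhomD(1)[OF \<pi>_hom[OF B] t(2)]] by blast
  then show ?thesis using q unfolding Harr_def \<psi>'_def[symmetric] by (simp add: \<psi>'_def)
qed

lemma Harr_hom:
  assumes A: "A \<in> fgmod R" and B: "B \<in> fgmod R" and f: "f \<in> mhom R A B"
  shows "Harr A B f \<in> mhom R (Hobj A) (Hobj B)"
proof (rule mhomI)
  interpret TA: left_module R "T A" by (rule left_module_T[OF A])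
  note t = Tarr_hom[OF A B f] and p = \<pi>_hom[OF A] and p' = \<pi>_hom[OF B]
  show "Harr A B f \<in> extensional (carrier (Hobj A))" by (simp add: Harr_def)
  fix x assume x: "x \<in> carrier (Hobj A)"
  obtain \<psi> where \<psi>: "\<psi> \<in> carrier (T A)" "\<pi> A \<psi> = x" by (rule \<pi>_onto[OF A x])
  note h = Harr_\<pi>[OF A B f]
  show "Harr A B f x \<in> carrier (Hobj B)"
    unfolding \<psi>(2)[symmetric] h[OF \<psi>(1)] by (rule mhomD(1)[OF p' mhomD(1)[OF t \<psi>(1)]])
  { fix y assume y: "y \<in> carrier (Hobj A)"
    obtain \<phi> where \<phi>: "\<phi> \<in> carrier (T A)" "\<pi> A \<phi> = y" by (rule \<pi>_onto[OF A y])
    show "Harr A B f (x \<oplus>\<^bsub>Hobj A\<^esub> y) = Harr A B f x \<oplus>\<^bsub>Hobj B\<^esub> Harr A B f y"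
      unfolding \<psi>(2)[symmetric] \<phi>(2)[symmetric] mhomD(2)[OF p \<psi>(1) \<phi>(1), symmetric]
        h[OF TA.M.a_closed[OF \<psi>(1) \<phi>(1)]] h[OF \<psi>(1)] h[OF \<phi>(1)] mhomD(2)[OF t \<psi>(1) \<phi>(1)]
        mhomD(2)[OF p' mhomD(1)[OF t \<psi>(1)] mhomD(1)[OF t \<phi>(1)]] .. }
  { fix r assume r: "r \<in> carrier R"
    show "Harr A B f (r \<odot>\<^bsub>Hobj A\<^esub> x) = r \<odot>\<^bsub>Hobj B\<^esub> Harr A B f x"
      unfolding \<psi>(2)[symmetric] mhomD(3)[OF p r \<psi>(1), symmetric]
        h[OF TA.smult_closed[OF r \<psi>(1)]] h[OF \<psi>(1)] mhomD(3)[OF t r \<psi>(1)]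
        mhomD(3)[OF p' r mhomD(1)[OF t \<psi>(1)]] .. }
qed

lemma H_functor: "is_functor R R H"
  unfolding is_functor_def
proof (intro conjI ballI)
  fix M :: "'r lmod" assume M: "M \<in> fgmod R"
  show "obj H M \<in> fgmod R" using M by (simp add: H_def)
  have m: "mid M \<in> mhom R M M" by (rule mid_mhom[OF fgmod_lm[OF M]])
  show "arr H M M (mid M) = mid (obj H M)"
    unfolding H_def mfunctor.simps
  proof (rule mhom_eqI[OF Harr_hom[OF M M m] mid_mhom[OF fgmod_lm[OF H_fg[OF M]]]])
    fix x assume x: "x \<in> carrier (Hobj M)"
    obtain \<psi> where \<psi>: "\<psi> \<in> carrier (T M)" "\<pi> M \<psi> = x" by (rule \<pi>_onto[OF M x])
    have "Tarr M M (mid M) \<psi> = \<psi>"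
      by (rule T_eqI[OF mhomD(1)[OF Tarr_hom[OF M M m] \<psi>(1)] \<psi>(1)])
         (simp only: Tarr_apply[OF \<psi>(1)] e.arr_mid[OF M] mid_apply[OF T_closed[OF \<psi>(1)]])
    then show "Harr M M (mid M) x = mid (Hobj M) x" using Harr_\<pi>[OF M M m \<psi>(1)] \<psi>(2) x by simp
  qed
  fix N :: "'r lmod" and f assume N: "N \<in> fgmod R" and f: "f \<in> mhom R M N"
  show "arr H M N f \<in> mhom R (obj H M) (obj H N)" using Harr_hom[OF M N f] by (simp add: H_def)
next
  fix L M N :: "'r lmod" and f g
  assume L: "L \<in> fgmod R" and M: "M \<in> fgmod R" and N: "N \<in> fgmod R" and f: "f \<in> mhom R L M" and g: "g \<in> mhom R M N"
  let ?h = "compose (carrier L) g f"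
  have h: "?h \<in> mhom R L N" by (rule mhom_comp[OF fgmod_lm[OF L] f g])
  show "arr H L N ?h = compose (carrier (obj H L)) (arr H M N g) (arr H L M f)"
    unfolding H_def mfunctor.simps
  proof (rule mhom_eqI[OF Harr_hom[OF L N h] mhom_comp[OF fgmod_lm[OF H_fg[OF L]] Harr_hom[OF L M f] Harr_hom[OF M N g]]])
    fix x assume x: "x \<in> carrier (Hobj L)"
    obtain \<psi> where \<psi>: "\<psi> \<in> carrier (T L)" "\<pi> L \<psi> = x" by (rule \<pi>_onto[OF L x])
    note tf = mhomD(1)[OF Tarr_hom[OF L M f] \<psi>(1)]
    have "Tarr L N ?h \<psi> = Tarr M N g (Tarr L M f \<psi>)"
    proof (rule T_eqI[OF mhomD(1)[OF Tarr_hom[OF L N h] \<psi>(1)] mhomD(1)[OF Tarr_hom[OF M N g] tf]])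
      fix w assume w: "w \<in> carrier (obj e (reg R))"
      show "Tarr L N ?h \<psi> w = Tarr M N g (Tarr L M f \<psi>) w"
        unfolding Tarr_apply[OF \<psi>(1) w] Tarr_apply[OF tf w]
        by (rule e.arr_comp_apply[OF L M N f g h _ T_closed[OF \<psi>(1) w]]) (simp add: compose_def)
    qed
    then have "Harr L N ?h x = Harr M N g (Harr L M f x)"
      unfolding \<psi>(2)[symmetric] Harr_\<pi>[OF L N h \<psi>(1)] Harr_\<pi>[OF L M f \<psi>(1)] Harr_\<pi>[OF M N g tf] by simp
    then show "Harr L N ?h x = compose (carrier (Hobj L)) (Harr M N g) (Harr L M f) x"
      using x by (simp add: compose_def)
  qed
qed

text \<open>Since \<open>e\<close> preserves projectives, coinduction is exact; the snake lemma passes exactness on to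
  the cokernels of the monomorphisms \<open>\<nu>\<close>.\<close>

lemma H_exact: "exact_functor R R H"
  unfolding exact_functor_def
proof (intro ballI allI impI)
  fix U X V :: "'r lmod" and f g
  assume U: "U \<in> fgmod R" and X: "X \<in> fgmod R" and V: "V \<in> fgmod R" and s: "short_exact R U f X g V"
  note sd = short_exactD[OF s] and ed = short_exactD[OF e.preserves_exact[OF U X V s]]
  note f = sd(1) and g = sd(2)
  let ?E = "obj e (reg R)"
  have E: "projective S ?E"
    using e_projectives reg_projective[OF Rk.ring_A] unfolding preserves_projectives_def by blast
  note lE = e.obj_lm[OF R_fg]
  interpret TX: left_module R "T X" by (rule left_module_T[OF X])
  interpret TV: left_module R "T V" by (rule left_module_T[OF V])
  interpret eX: left_module S "obj e X" by (rule e.obj_lm[OF X])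
  interpret eU: left_module S "obj e U" by (rule e.obj_lm[OF U])
  have T_onto: "\<exists>\<psi>\<in>carrier (T X). Tarr X V g \<psi> = \<phi>" if \<phi>: "\<phi> \<in> carrier (T V)" for \<phi>
  proof -
    have \<phi>': "\<phi> \<in> mhom S ?E (obj e V)" using \<phi> by simp
    obtain h where h: "h \<in> mhom S ?E (obj e X)" "\<And>x. x \<in> carrier ?E \<Longrightarrow> arr e X V g (h x) = \<phi> x"
      by (rule projective_lift[OF E e.obj_fg[OF X] e.obj_fg[OF V] ed(2,6) \<phi>']) blast
    have hT: "h \<in> carrier (T X)" using h(1) by simp
    have "Tarr X V g h = \<phi>"
      by (rule T_eqI[OF mhomD(1)[OF Tarr_hom[OF X V g] hT] \<phi>]) (simp only: Tarr_apply[OF hT] h(2))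
    then show ?thesis using hT by blast
  qed
  have T_mid: "\<exists>\<psi>\<in>carrier (T U). Tarr U X f \<psi> = \<phi>"
    if \<phi>: "\<phi> \<in> carrier (T X)" and z: "Tarr X V g \<phi> = \<zero>\<^bsub>T V\<^esub>" for \<phi>
  proof -
    have "\<exists>u\<in>carrier (obj e U). \<phi> w = arr e U X f u" if w: "w \<in> carrier ?E" for w
      by (rule ed(5)[OF T_closed[OF \<phi> w]])
         (use fun_cong[OF z, of w] w in \<open>simp only: Tarr_apply[OF \<phi> w] T_simps restrict_apply'\<close>)
    then obtain r where r: "\<And>w. w \<in> carrier ?E \<Longrightarrow> r w \<in> carrier (obj e U)" "\<And>w. w \<in> carrier ?E \<Longrightarrow> \<phi> w = arr e U X f (r w)"
      by metis
    have \<phi>': "\<phi> \<in> mhom S ?E (obj e X)" using \<phi> by simp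
    interpret E: left_module S ?E by (rule lE)
    have "restrict r (carrier ?E) \<in> mhom S ?E (obj e U)"
    proof (rule mhom_restrictI[OF lE r(1)])
      fix x y assume xy: "x \<in> carrier ?E" "y \<in> carrier ?E"
      have "arr e U X f (r (x \<oplus>\<^bsub>?E\<^esub> y)) = arr e U X f (r x \<oplus>\<^bsub>obj e U\<^esub> r y)"
        using xy r mhomD(2)[OF ed(1)] mhomD(2)[OF \<phi>'] by (metis E.M.a_closed)
      then show "r (x \<oplus>\<^bsub>?E\<^esub> y) = r x \<oplus>\<^bsub>obj e U\<^esub> r y"
        by (rule inj_onD[OF ed(3)]) (use xy r(1) in auto)
    next
      fix a x assume ax: "a \<in> carrier S" "x \<in> carrier ?E"
      have "arr e U X f (r (a \<odot>\<^bsub>?E\<^esub> x)) = arr e U X f (a \<odot>\<^bsub>obj e U\<^esub> r x)"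
        using ax r mhomD(3)[OF ed(1)] mhomD(3)[OF \<phi>'] by (metis E.smult_closed)
      then show "r (a \<odot>\<^bsub>?E\<^esub> x) = a \<odot>\<^bsub>obj e U\<^esub> r x"
        by (rule inj_onD[OF ed(3)]) (use r(1)[OF E.smult_closed[OF ax]] eU.smult_closed[OF ax(1) r(1)[OF ax(2)]] in simp_all)
    qed
    then have rT: "restrict r (carrier ?E) \<in> carrier (T U)" by simp
    have "Tarr U X f (restrict r (carrier ?E)) = \<phi>"
      by (rule T_eqI[OF mhomD(1)[OF Tarr_hom[OF U X f] rT] \<phi>])
         (simp only: Tarr_apply[OF rT] restrict_apply' r(2))
    then show ?thesis using rT by blast
  qed
  have T_comp: "Tarr X V g (Tarr U X f \<psi>) = \<zero>\<^bsub>T V\<^esub>" if \<psi>: "\<psi> \<in> carrier (T U)" for \<psi>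
  proof (rule T_eqI[OF mhomD(1)[OF Tarr_hom[OF X V g] mhomD(1)[OF Tarr_hom[OF U X f] \<psi>]] TV.M.zero_closed])
    fix w assume w: "w \<in> carrier ?E"
    have "Tarr X V g (Tarr U X f \<psi>) w = arr e X V g (arr e U X f (\<psi> w))"
      unfolding Tarr_apply[OF mhomD(1)[OF Tarr_hom[OF U X f] \<psi>] w] Tarr_apply[OF \<psi> w] ..
    also have "\<dots> = \<zero>\<^bsub>obj e V\<^esub>" by (rule ed(4)[OF T_closed[OF \<psi> w]])
    finally show "Tarr X V g (Tarr U X f \<psi>) w = \<zero>\<^bsub>T V\<^esub> w" using w by simp
  qed
  have T_inj: "\<psi> = \<phi>" if \<psi>: "\<psi> \<in> carrier (T U)" and \<phi>: "\<phi> \<in> carrier (T U)" and eq: "Tarr U X f \<psi> = Tarr U X f \<phi>" for \<psi> \<phi>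
  proof (rule T_eqI[OF \<psi> \<phi>])
    fix w assume w: "w \<in> carrier ?E"
    have "arr e U X f (\<psi> w) = arr e U X f (\<phi> w)"
      using fun_cong[OF eq, of w] unfolding Tarr_apply[OF \<psi> w] Tarr_apply[OF \<phi> w] .
    then show "\<psi> w = \<phi> w" by (rule inj_onD[OF ed(3)]) (rule T_closed[OF \<psi> w] T_closed[OF \<phi> w])+
  qed
  note lH = H_fg[THEN fgmod_lm]
  have "short_exact R (Hobj U) (Harr U X f) (Hobj X) (Harr X V g) (Hobj V)"
  proof (rule short_exactI[OF Harr_hom[OF U X f] Harr_hom[OF X V g]])
    show "inj_on (Harr U X f) (carrier (Hobj U))"
      unfolding mhom_inj_iff[OF lH[OF U] lH[OF X] Harr_hom[OF U X f]]
    proof (intro ballI impI)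
      fix q assume q: "q \<in> carrier (Hobj U)" "Harr U X f q = \<zero>\<^bsub>Hobj X\<^esub>"
      obtain \<psi> where \<psi>: "\<psi> \<in> carrier (T U)" "\<pi> U \<psi> = q" by (rule \<pi>_onto[OF U q(1)])
      note t = mhomD(1)[OF Tarr_hom[OF U X f] \<psi>(1)]
      have "\<pi> X (Tarr U X f \<psi>) = \<zero>\<^bsub>Hobj X\<^esub>" using q(2) unfolding \<psi>(2)[symmetric] Harr_\<pi>[OF U X f \<psi>(1)] .
      then obtain x where x: "x \<in> carrier X" "Tarr U X f \<psi> = \<nu> X x" using \<pi>_zero_iff[OF X t] by blast
      have "\<nu> V (g x) = \<nu> V \<zero>\<^bsub>V\<^esub>"
        using T_comp[OF \<psi>(1)] unfolding x(2) Tarr_\<nu>[OF X V g x(1)]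
        using mhom_zero[OF fgmod_lm[OF V] left_module_T[OF V] \<nu>_hom[OF V]] by simp
      then have "g x = \<zero>\<^bsub>V\<^esub>"
        by (rule inj_onD[OF \<nu>_inj[OF V]])
           (use mhomD(1)[OF g x(1)] msubD(2)[OF msub_carrier[OF fgmod_lm[OF V]]] in auto)
      then obtain u where u: "u \<in> carrier U" "x = f u" using sd(5)[OF x(1)] by blast
      have "Tarr U X f \<psi> = Tarr U X f (\<nu> U u)" using x(2) u(2) Tarr_\<nu>[OF U X f u(1)] by simp
      then have "\<psi> = \<nu> U u" by (rule T_inj[OF \<psi>(1) mhomD(1)[OF \<nu>_hom[OF U] u(1)]])
      then show "q = \<zero>\<^bsub>Hobj U\<^esub>" using \<pi>_\<nu>[OF U u(1)] \<psi>(2) by simp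
    qed
    fix q
    { assume q: "q \<in> carrier (Hobj U)"
      obtain \<psi> where \<psi>: "\<psi> \<in> carrier (T U)" "\<pi> U \<psi> = q" by (rule \<pi>_onto[OF U q])
      show "Harr X V g (Harr U X f q) = \<zero>\<^bsub>Hobj V\<^esub>"
        unfolding \<psi>(2)[symmetric] Harr_\<pi>[OF U X f \<psi>(1)] Harr_\<pi>[OF X V g mhomD(1)[OF Tarr_hom[OF U X f] \<psi>(1)]] T_comp[OF \<psi>(1)]
        by (rule mhom_zero[OF left_module_T[OF V] lH[OF V] \<pi>_hom[OF V]]) }
    { assume q: "q \<in> carrier (Hobj X)" "Harr X V g q = \<zero>\<^bsub>Hobj V\<^esub>"
      obtain \<psi> where \<psi>: "\<psi> \<in> carrier (T X)" "\<pi> X \<psi> = q" by (rule \<pi>_onto[OF X q(1)])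
      note t = mhomD(1)[OF Tarr_hom[OF X V g] \<psi>(1)]
      have "\<pi> V (Tarr X V g \<psi>) = \<zero>\<^bsub>Hobj V\<^esub>" using q(2) unfolding \<psi>(2)[symmetric] Harr_\<pi>[OF X V g \<psi>(1)] .
      then obtain v where v: "v \<in> carrier V" "Tarr X V g \<psi> = \<nu> V v" using \<pi>_zero_iff[OF V t] by blast
      then obtain x where x: "x \<in> carrier X" "v = g x" using sd(6) by blast
      have n: "\<nu> X x \<in> carrier (T X)" by (rule mhomD(1)[OF \<nu>_hom[OF X] x(1)])
      have d: "\<psi> \<ominus>\<^bsub>T X\<^esub> \<nu> X x \<in> carrier (T X)" by (rule TX.M.minus_closed[OF \<psi>(1) n])
      have "Tarr X V g (\<psi> \<ominus>\<^bsub>T X\<^esub> \<nu> X x) = \<zero>\<^bsub>T V\<^esub>"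
        unfolding mhom_minus[OF left_module_T[OF X] left_module_T[OF V] Tarr_hom[OF X V g] \<psi>(1) n]
          v(2) x(2) Tarr_\<nu>[OF X V g x(1)]
        by (rule TV.M.minus_self[OF mhomD(1)[OF \<nu>_hom[OF V] mhomD(1)[OF g x(1)]]])
      from T_mid[OF d this] obtain \<phi> where \<phi>: "\<phi> \<in> carrier (T U)" "Tarr U X f \<phi> = \<psi> \<ominus>\<^bsub>T X\<^esub> \<nu> X x" by blast
      interpret HX: left_module R "Hobj X" by (rule lH[OF X])
      have "Harr U X f (\<pi> U \<phi>) = \<pi> X \<psi> \<ominus>\<^bsub>Hobj X\<^esub> \<pi> X (\<nu> X x)"
        unfolding Harr_\<pi>[OF U X f \<phi>(1)] \<phi>(2)
        by (rule mhom_minus[OF left_module_T[OF X] lH[OF X] \<pi>_hom[OF X] \<psi>(1) n])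
      also have "\<dots> = q" unfolding \<pi>_\<nu>[OF X x(1)] \<psi>(2) by (rule HX.M.minus_zero_right[OF q(1)])
      finally show "\<exists>u\<in>carrier (Hobj U). q = Harr U X f u"
        using mhomD(1)[OF \<pi>_hom[OF U] \<phi>(1)] by (intro bexI[of _ "\<pi> U \<phi>"]) simp_all }
    { assume q: "q \<in> carrier (Hobj V)"
      obtain \<phi> where \<phi>: "\<phi> \<in> carrier (T V)" "\<pi> V \<phi> = q" by (rule \<pi>_onto[OF V q])
      obtain \<psi> where \<psi>: "\<psi> \<in> carrier (T X)" "Tarr X V g \<psi> = \<phi>" using T_onto[OF \<phi>(1)] by blast
      show "\<exists>x\<in>carrier (Hobj X). q = Harr X V g x"
        by (rule bexI[OF _ mhomD(1)[OF \<pi>_hom[OF X] \<psi>(1)]])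
           (simp only: Harr_\<pi>[OF X V g \<psi>(1)] \<psi>(2) \<phi>(2)) }
  qed
  then show "short_exact R (obj H U) (arr H U X f) (obj H X) (arr H X V g) (obj H V)" by (simp add: H_def)
qed

sublocale H: exact_mod_functor R R H
  by unfold_locales (rule H_functor H_exact Rk.left_noetherian)+


section \<open>Moving the kernel of the counit to the other side\<close>

text \<open>The retraction of \<open>e (G X) \<rightarrow> e (l (e X))\<close> extends \<open>\<nu>\<close> from \<open>G X\<close> to \<open>\<theta>\<close> on \<open>l (e X)\<close>. So the
  pushout of \<open>0 \<rightarrow> G X \<rightarrow> l (e X) \<rightarrow> X \<rightarrow> 0\<close> along \<open>\<nu>\<close> splits, and the middle term below
  is the direct sum of \<open>X\<close> and a coinduced module.\<close>

lemma shift_exact: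
  assumes X: "X \<in> fgmod R"
  obtains W :: "'r lmod" and C :: "'r lmod" and a b where "W \<in> fgmod R" "C \<in> fgmod R" "miso R W (dsum X C)"
    "short_exact R (obj l (obj e X)) a W b (obj H (G X))"
proof -
  let ?L = "obj l (obj e X)" and ?A = "G X" and ?E = "obj e (reg R)"
  have L: "?L \<in> fgmod R" and A: "?A \<in> fgmod R" using X by auto
  note lX = fgmod_lm[OF X] and lL = fgmod_lm[OF L] and lA = fgmod_lm[OF A] and lTA = left_module_T[OF A]
  note sd = short_exactD[OF G_exact[OF X]]
  interpret X: left_module R X by (rule lX)
  interpret L: left_module R ?L by (rule lL)
  interpret A: left_module R ?A by (rule lA)
  interpret TA: left_module R "T ?A" by (rule lTA)
  interpret HA: left_module R "Hobj ?A" by (rule fgmod_lm[OF H_fg[OF A]])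
  obtain s where s: "s \<in> mhom S (obj e ?L) (obj e ?A)"
    "\<And>y. y \<in> carrier (obj e ?A) \<Longrightarrow> s (arr e ?A ?L (mid ?A) y) = y"
    by (rule eG_retraction[OF X]) blast
  define \<theta> where "\<theta> = (\<lambda>x\<in>carrier ?L. compose (carrier ?E) s (arr e (reg R) ?L (from_reg R ?L x)))"
  have \<theta>: "\<theta> \<in> mhom R ?L (T ?A)" unfolding \<theta>_def by (rule coinduced_hom[OF L A s(1)])
  have \<theta>A: "\<theta> (mid ?A x) = \<nu> ?A x" if x: "x \<in> carrier ?A" for x
  proof (rule T_eqI[OF mhomD(1)[OF \<theta> mhomD(1)[OF sd(1) x]] mhomD(1)[OF \<nu>_hom[OF A] x]])
    fix w assume w: "w \<in> carrier ?E"
    have "\<theta> (mid ?A x) w = s (arr e (reg R) ?L (from_reg R ?L (mid ?A x)) w)"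
      using w mhomD(1)[OF sd(1) x] by (simp add: \<theta>_def compose_def)
    also have "\<dots> = s (arr e ?A ?L (mid ?A) (arr e (reg R) ?A (from_reg R ?A x) w))"
      unfolding e_at_natural[OF A L sd(1) x w] ..
    also have "\<dots> = \<nu> ?A x w" using s(2)[OF mhomD(1)[OF e_at_hom[OF A x] w]] by (simp add: \<nu>_apply[OF x])
    finally show "\<theta> (mid ?A x) w = \<nu> ?A x w" .
  qed
  have "\<exists>x\<in>carrier ?L. y = \<mu> X x" if "y \<in> carrier X" for y using sd(6) that by blast
  then obtain r where r: "\<And>y. y \<in> carrier X \<Longrightarrow> r y \<in> carrier ?L" "\<And>y. y \<in> carrier X \<Longrightarrow> y = \<mu> X (r y)" by metis
  have theta_eq: "\<pi> ?A (\<theta> x) = \<pi> ?A (\<theta> x')" if x: "x \<in> carrier ?L" "x' \<in> carrier ?L" and eq: "\<mu> X x = \<mu> X x'" for x x'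
  proof -
    have "\<mu> X (x \<ominus>\<^bsub>?L\<^esub> x') = \<zero>\<^bsub>X\<^esub>"
      using mhom_minus[OF lL lX sd(2) x] eq mhomD(1)[OF sd(2) x(2)] by simp
    then obtain z where z: "z \<in> carrier ?A" "x \<ominus>\<^bsub>?L\<^esub> x' = mid ?A z" using sd(5)[of "x \<ominus>\<^bsub>?L\<^esub> x'"] x by auto
    have "\<pi> ?A (\<theta> x) \<ominus>\<^bsub>Hobj ?A\<^esub> \<pi> ?A (\<theta> x') = \<pi> ?A (\<theta> (x \<ominus>\<^bsub>?L\<^esub> x'))"
      unfolding mhom_minus[OF lL lTA \<theta> x] mhom_minus[OF lTA fgmod_lm[OF H_fg[OF A]] \<pi>_hom[OF A] mhomD(1)[OF \<theta> x(1)] mhomD(1)[OF \<theta> x(2)]] ..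
    also have "\<dots> = \<zero>\<^bsub>Hobj ?A\<^esub>" unfolding z(2) \<theta>A[OF z(1)] by (rule \<pi>_\<nu>[OF A z(1)])
    finally show ?thesis
      using HA.M.minus_eq_zero_iff[OF mhomD(1)[OF \<pi>_hom[OF A] mhomD(1)[OF \<theta> x(1)]] mhomD(1)[OF \<pi>_hom[OF A] mhomD(1)[OF \<theta> x(2)]]] by blast
  qed
  let ?D = "dsum X (T ?A)"
  have D: "?D \<in> fgmod R" by (rule fgmod_dsum[OF X T_finite[OF A]])
  note lD = fgmod_lm[OF D]
  (* b uses a chosen preimage r y of the component y in X; by theta_eq the choice does not matter *)
  define a where "a = (\<lambda>x\<in>carrier ?L. (\<mu> X x, \<theta> x))"
  define b where "b = (\<lambda>p\<in>carrier ?D. \<pi> ?A (snd p) \<ominus>\<^bsub>Hobj ?A\<^esub> \<pi> ?A (\<theta> (r (fst p))))"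
  have a: "a \<in> mhom R ?L ?D" unfolding a_def
    by (rule mhom_restrictI[OF lL]) (auto simp: mhomD[OF sd(2)] mhomD[OF \<theta>] simp del: T_simps)
  note \<pi>c = mhomD(1)[OF \<pi>_hom[OF A]] and \<theta>c = mhomD(1)[OF \<theta>]
  have b: "b \<in> mhom R ?D (Hobj ?A)" unfolding b_def
  proof (rule mhom_restrictI[OF lD])
    fix p assume "p \<in> carrier ?D"
    then have p: "fst p \<in> carrier X" "snd p \<in> carrier (T ?A)" by (auto simp del: T_simps)
    note rp = r[OF p(1)]
    show "\<pi> ?A (snd p) \<ominus>\<^bsub>Hobj ?A\<^esub> \<pi> ?A (\<theta> (r (fst p))) \<in> carrier (Hobj ?A)"
      by (rule HA.M.minus_closed[OF \<pi>c[OF p(2)] \<pi>c[OF \<theta>c[OF rp(1)]]])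
    { fix q assume "q \<in> carrier ?D"
      then have q: "fst q \<in> carrier X" "snd q \<in> carrier (T ?A)" by (auto simp del: T_simps)
      note rq = r[OF q(1)]
      have pq: "fst p \<oplus>\<^bsub>X\<^esub> fst q \<in> carrier X" by (rule X.M.a_closed[OF p(1) q(1)])
      have "\<pi> ?A (\<theta> (r (fst p \<oplus>\<^bsub>X\<^esub> fst q))) = \<pi> ?A (\<theta> (r (fst p) \<oplus>\<^bsub>?L\<^esub> r (fst q)))"
        by (rule theta_eq[OF r(1)[OF pq] L.M.a_closed[OF rp(1) rq(1)]])
           (simp only: r(2)[OF pq, symmetric] mhomD(2)[OF sd(2) rp(1) rq(1)] rp(2)[symmetric] rq(2)[symmetric])
      also have "\<dots> = \<pi> ?A (\<theta> (r (fst p))) \<oplus>\<^bsub>Hobj ?A\<^esub> \<pi> ?A (\<theta> (r (fst q)))"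
        unfolding mhomD(2)[OF \<theta> rp(1) rq(1)] by (rule mhomD(2)[OF \<pi>_hom[OF A] \<theta>c[OF rp(1)] \<theta>c[OF rq(1)]])
      finally have 1: "\<pi> ?A (\<theta> (r (fst p \<oplus>\<^bsub>X\<^esub> fst q))) = \<pi> ?A (\<theta> (r (fst p))) \<oplus>\<^bsub>Hobj ?A\<^esub> \<pi> ?A (\<theta> (r (fst q)))" .
      have 2: "\<pi> ?A (snd p \<oplus>\<^bsub>T ?A\<^esub> snd q) = \<pi> ?A (snd p) \<oplus>\<^bsub>Hobj ?A\<^esub> \<pi> ?A (snd q)"
        by (rule mhomD(2)[OF \<pi>_hom[OF A] p(2) q(2)])
      show "\<pi> ?A (snd (p \<oplus>\<^bsub>?D\<^esub> q)) \<ominus>\<^bsub>Hobj ?A\<^esub> \<pi> ?A (\<theta> (r (fst (p \<oplus>\<^bsub>?D\<^esub> q)))) =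
          (\<pi> ?A (snd p) \<ominus>\<^bsub>Hobj ?A\<^esub> \<pi> ?A (\<theta> (r (fst p)))) \<oplus>\<^bsub>Hobj ?A\<^esub> (\<pi> ?A (snd q) \<ominus>\<^bsub>Hobj ?A\<^esub> \<pi> ?A (\<theta> (r (fst q))))"
        unfolding dsum_simps fst_conv snd_conv 1 2
        using \<pi>c[OF p(2)] \<pi>c[OF q(2)] \<pi>c[OF \<theta>c[OF rp(1)]] \<pi>c[OF \<theta>c[OF rq(1)]]
        by (simp add: HA.M.minus_eq HA.M.minus_add HA.M.a_ac) }
    { fix c assume c: "c \<in> carrier R"
      have cp: "c \<odot>\<^bsub>X\<^esub> fst p \<in> carrier X" by (rule X.smult_closed[OF c p(1)])
      have "\<pi> ?A (\<theta> (r (c \<odot>\<^bsub>X\<^esub> fst p))) = \<pi> ?A (\<theta> (c \<odot>\<^bsub>?L\<^esub> r (fst p)))"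
        by (rule theta_eq[OF r(1)[OF cp] L.smult_closed[OF c rp(1)]])
           (simp only: r(2)[OF cp, symmetric] mhomD(3)[OF sd(2) c rp(1)] rp(2)[symmetric])
      also have "\<dots> = c \<odot>\<^bsub>Hobj ?A\<^esub> \<pi> ?A (\<theta> (r (fst p)))"
        unfolding mhomD(3)[OF \<theta> c rp(1)] by (rule mhomD(3)[OF \<pi>_hom[OF A] c \<theta>c[OF rp(1)]])
      finally have 1: "\<pi> ?A (\<theta> (r (c \<odot>\<^bsub>X\<^esub> fst p))) = c \<odot>\<^bsub>Hobj ?A\<^esub> \<pi> ?A (\<theta> (r (fst p)))" .
      have 2: "\<pi> ?A (c \<odot>\<^bsub>T ?A\<^esub> snd p) = c \<odot>\<^bsub>Hobj ?A\<^esub> \<pi> ?A (snd p)" by (rule mhomD(3)[OF \<pi>_hom[OF A] c p(2)])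
      show "\<pi> ?A (snd (c \<odot>\<^bsub>?D\<^esub> p)) \<ominus>\<^bsub>Hobj ?A\<^esub> \<pi> ?A (\<theta> (r (fst (c \<odot>\<^bsub>?D\<^esub> p)))) =
          c \<odot>\<^bsub>Hobj ?A\<^esub> (\<pi> ?A (snd p) \<ominus>\<^bsub>Hobj ?A\<^esub> \<pi> ?A (\<theta> (r (fst p))))"
        unfolding dsum_simps fst_conv snd_conv 1 2
        using c \<pi>c[OF p(2)] \<pi>c[OF \<theta>c[OF rp(1)]]
        by (simp add: HA.M.minus_eq HA.smult_r_distr HA.smult_neg) }
  qed
  have "short_exact R ?L a ?D b (Hobj ?A)"
  proof (rule short_exactI[OF a b])
    show "inj_on a (carrier ?L)" unfolding mhom_inj_iff[OF lL lD a]
    proof (intro ballI impI)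
      fix x assume x: "x \<in> carrier ?L" "a x = \<zero>\<^bsub>?D\<^esub>"
      then have x0: "\<mu> X x = \<zero>\<^bsub>X\<^esub>" "\<theta> x = \<zero>\<^bsub>T ?A\<^esub>" by (simp_all add: a_def del: T_simps)
      obtain z where z: "z \<in> carrier ?A" "x = mid ?A z" using sd(5)[OF x(1) x0(1)] by blast
      have "\<nu> ?A z = \<nu> ?A \<zero>\<^bsub>?A\<^esub>"
        using \<theta>A[OF z(1)] x0(2) z(2) mhom_zero[OF lA lTA \<nu>_hom[OF A]] by (simp del: T_simps)
      then have "z = \<zero>\<^bsub>?A\<^esub>" by (rule inj_onD[OF \<nu>_inj[OF A]]) (use z in auto)
      then show "x = \<zero>\<^bsub>?L\<^esub>" using z(2) mhom_zero[OF lA lL sd(1)] by simp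
    qed
    show "b (a x) = \<zero>\<^bsub>Hobj ?A\<^esub>" if x: "x \<in> carrier ?L" for x
    proof -
      have ax: "a x = (\<mu> X x, \<theta> x)" "a x \<in> carrier ?D" using x mhomD(1)[OF a x] by (simp_all add: a_def)
      have m: "\<mu> X x \<in> carrier X" by (rule mhomD(1)[OF sd(2) x])
      have "\<pi> ?A (\<theta> (r (\<mu> X x))) = \<pi> ?A (\<theta> x)" by (rule theta_eq[OF r(1)[OF m] x r(2)[OF m, symmetric]])
      then have "b (a x) = \<pi> ?A (\<theta> x) \<ominus>\<^bsub>Hobj ?A\<^esub> \<pi> ?A (\<theta> x)" using ax unfolding b_def by simp
      then show ?thesis using \<pi>c[OF \<theta>c[OF x]] by simp
    qed
    show "\<exists>x\<in>carrier ?L. p = a x" if p: "p \<in> carrier ?D" "b p = \<zero>\<^bsub>Hobj ?A\<^esub>" for p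
    proof -
      have c: "fst p \<in> carrier X" "snd p \<in> carrier (T ?A)" using p(1) by (auto simp del: T_simps)
      let ?x = "r (fst p)"
      have x: "?x \<in> carrier ?L" "\<mu> X ?x = fst p" using r[OF c(1)] by simp_all
      have d: "snd p \<ominus>\<^bsub>T ?A\<^esub> \<theta> ?x \<in> carrier (T ?A)" by (rule TA.M.minus_closed[OF c(2) \<theta>c[OF x(1)]])
      have "\<pi> ?A (snd p \<ominus>\<^bsub>T ?A\<^esub> \<theta> ?x) = b p"
        unfolding mhom_minus[OF lTA fgmod_lm[OF H_fg[OF A]] \<pi>_hom[OF A] c(2) \<theta>c[OF x(1)]] using p(1) by (simp add: b_def)
      then obtain z where z: "z \<in> carrier ?A" "snd p \<ominus>\<^bsub>T ?A\<^esub> \<theta> ?x = \<nu> ?A z" using \<pi>_zero_iff[OF A d] p(2) by auto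
      have mz: "mid ?A z \<in> carrier ?L" by (rule mhomD(1)[OF sd(1) z(1)])
      have xz: "mid ?A z \<oplus>\<^bsub>?L\<^esub> ?x \<in> carrier ?L" by (rule L.M.a_closed[OF mz x(1)])
      have "\<mu> X (mid ?A z \<oplus>\<^bsub>?L\<^esub> ?x) = fst p"
        unfolding mhomD(2)[OF sd(2) mz x(1)] sd(4)[OF z(1)] x(2) by (rule X.M.l_zero[OF c(1)])
      moreover have "\<theta> (mid ?A z \<oplus>\<^bsub>?L\<^esub> ?x) = snd p"
        unfolding mhomD(2)[OF \<theta> mz x(1)] \<theta>A[OF z(1)] z(2)[symmetric]
        by (rule TA.M.minus_add_cancel[OF c(2) \<theta>c[OF x(1)]])
      ultimately have "p = a (mid ?A z \<oplus>\<^bsub>?L\<^esub> ?x)" using xz by (simp add: a_def)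
      then show ?thesis using xz by blast
    qed
    show "\<exists>p\<in>carrier ?D. v = b p" if v: "v \<in> carrier (Hobj ?A)" for v
    proof -
      obtain \<psi> where \<psi>: "\<psi> \<in> carrier (T ?A)" "\<pi> ?A \<psi> = v" by (rule \<pi>_onto[OF A v])
      have z: "\<zero>\<^bsub>X\<^esub> \<in> carrier X" by simp
      have "\<pi> ?A (\<theta> (r \<zero>\<^bsub>X\<^esub>)) = \<pi> ?A (\<theta> \<zero>\<^bsub>?L\<^esub>)"
        by (rule theta_eq[OF r(1)[OF z] L.M.zero_closed]) (simp only: r(2)[OF z, symmetric] mhom_zero[OF lL lX sd(2)])
      also have "\<dots> = \<zero>\<^bsub>Hobj ?A\<^esub>"
        unfolding mhom_zero[OF lL lTA \<theta>] by (rule mhom_zero[OF lTA fgmod_lm[OF H_fg[OF A]] \<pi>_hom[OF A]])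
      finally have "\<pi> ?A (\<theta> (r \<zero>\<^bsub>X\<^esub>)) = \<zero>\<^bsub>Hobj ?A\<^esub>" .
      then have "b (\<zero>\<^bsub>X\<^esub>, \<psi>) = v" using \<psi> v z by (simp add: b_def del: T_simps)
      moreover have "(\<zero>\<^bsub>X\<^esub>, \<psi>) \<in> carrier ?D" using \<psi>(1) by simp
      ultimately show ?thesis by blast
    qed
  qed
  then have ses: "short_exact R ?L a ?D b (obj H ?A)" by (simp add: H_def)
  obtain C :: "'r lmod" and c where C: "C \<in> fgmod R" "c \<in> mhom R (T ?A) C" "bij_betw c (carrier (T ?A)) (carrier C)"
    by (rule list_representative[OF T_finite[OF A]])
  obtain W :: "'r lmod" where W: "W \<in> fgmod R" "miso R W (dsum X C)" by (rule dsum_representative[OF X C(1)])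
  have "miso R C (T ?A)" by (rule miso_sym[OF lTA fgmod_lm[OF C(1)] misoI[OF C(2,3)]])
  then have "miso R (dsum X C) ?D" by (rule miso_dsum_cong[OF lX fgmod_lm[OF C(1)] miso_refl[OF lX]])
  then have WD: "miso R W ?D" by (rule miso_trans[OF fgmod_lm[OF W(1)] W(2)])
  have lHA: "left_module R (obj H ?A)" using A by auto
  obtain a' b' where "short_exact R ?L a' W b' (obj H ?A)"
    by (rule short_exact_iso[OF lL fgmod_lm[OF W(1)] lL lD lHA lHA miso_refl[OF lL] WD miso_refl[OF lHA] ses])
  then show ?thesis using W C(1) that by blast
qed


section \<open>Counting layers\<close>

lemma eG_F:
  assumes X: "X \<in> fgmod R" and Y: "Y \<in> fgmod S" and iso: "miso S (obj e X) Y"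
  shows "miso S (obj e (G X)) (F Y)"
proof -
  have iY: "obj i Y \<in> fgmod R" using Y by auto
  have "miso S Y (obj e (obj i Y))"
    by (rule miso_sym[OF e.obj_lm[OF iY] fgmod_lm[OF Y] ei_miso[OF Y]])
  then have "miso S (obj e X) (obj e (obj i Y))" by (rule miso_trans[OF e.obj_lm[OF X] iso])
  then show ?thesis by (rule eG_cong[OF X iY])
qed

lemma F_fg: "Y \<in> fgmod S \<Longrightarrow> F Y \<in> fgmod S"
  by auto

text \<open>The module \<open>K\<close> is built along with the induction on \<open>m\<close>: it is \<open>l N\<close> at first, and each step replaces
  it by \<open>l N \<oplus> H K\<close>. The class of all \<open>X\<close> with \<open>e X\<close> in the additive closure of the syzygies, rather than
  the class of syzygies, is used because it is closed under \<open>G\<close>: the module \<open>e (G X)\<close> is a direct summand of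
  \<open>e (l (e X))\<close>. The isomorphic copy \<open>Y\<close> of \<open>e X\<close> allows for \<open>e (G X) \<cong> F Y\<close>.\<close>

lemma layer_bound:
  assumes N: "N \<in> fgmod S" and Syz: "Syz S j \<subseteq> ext_layer S {N} (Suc d)"
  shows "\<exists>K\<in>fgmod R. \<forall>X\<in>fgmod R. \<forall>Y\<in>fgmod S. obj e X \<in> add_closure S (Syz S j) \<longrightarrow> miso S (obj e X) Y \<longrightarrow>
    zero_module ((F ^^ Suc m) Y) \<longrightarrow> X \<in> ext_layer R {K} (Suc m * Suc d)"
proof (induction m)
  have l_layer: "obj l (obj e X) \<in> ext_layer R {obj l N} (Suc d)" if "obj e X \<in> add_closure S (Syz S j)" for X
    by (rule l.obj_ext_layer) (use that ext_layer_closed_under_add[OF Syz] in blast)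
  {
    case 0
    show ?case
    proof (intro bexI[of _ "obj l N"] ballI impI)
      show "obj l N \<in> fgmod R" using N by auto
      fix X :: "'r lmod" and Y :: "'s lmod"
      assume X: "X \<in> fgmod R" and Y: "Y \<in> fgmod S" and eX: "obj e X \<in> add_closure S (Syz S j)"
        and iso: "miso S (obj e X) Y" and z: "zero_module ((F ^^ Suc 0) Y)"
      have GX: "G X \<in> fgmod R" and L: "obj l (obj e X) \<in> fgmod R" using X by auto
      have "zero_module (obj e (G X))"
        by (rule zero_module_miso[OF e.obj_lm[OF GX] fgmod_lm[OF F_fg[OF Y]] eG_F[OF X Y iso]]) (use z in simp)
      then have "zero_module (G X)" by (rule e_reflects_zero[OF GX])
      then have "inj_on (\<mu> X) (carrier (obj l (obj e X)))"
        unfolding mhom_inj_iff[OF fgmod_lm[OF L] fgmod_lm[OF X] \<mu>_hom[OF X]]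
        by (auto simp: zero_module_def G_def mker_def)
      then have "miso R (obj l (obj e X)) X"
        using \<mu>_onto[OF X] by (intro misoI[OF \<mu>_hom[OF X]]) (simp add: bij_betw_def)
      then have "miso R X (obj l (obj e X))" by (rule miso_sym[OF fgmod_lm[OF L] fgmod_lm[OF X]])
      then show "X \<in> ext_layer R {obj l N} (Suc 0 * Suc d)" using ext_layer_iso[OF X l_layer[OF eX]] by simp
    qed
  next
    case (Suc m)
    then obtain K where K: "K \<in> fgmod R" and IH: "\<And>X Y. X \<in> fgmod R \<Longrightarrow> Y \<in> fgmod S \<Longrightarrow>
        obj e X \<in> add_closure S (Syz S j) \<Longrightarrow> miso S (obj e X) Y \<Longrightarrow> zero_module ((F ^^ Suc m) Y) \<Longrightarrow>
        X \<in> ext_layer R {K} (Suc m * Suc d)" by blast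
    have lN: "obj l N \<in> fgmod R" and HK: "obj H K \<in> fgmod R" using N K by auto
    obtain K' :: "'r lmod" where K': "K' \<in> fgmod R" "miso R K' (dsum (obj l N) (obj H K))"
      by (rule dsum_representative[OF lN HK])
    have base: "K' \<in> add_closure R {K'}" using K'(1) by (auto intro: add_closure.base)
    have lN_K': "{obj l N} \<subseteq> add_closure R {K'}"
      using add_closure.summand[OF base lN HK K'(2)] by simp
    have "miso R K' (dsum (obj H K) (obj l N))"
      by (rule miso_trans[OF fgmod_lm[OF K'(1)] K'(2) miso_dsum_comm[OF fgmod_lm[OF lN] fgmod_lm[OF HK]]])
    then have HK_K': "{obj H K} \<subseteq> add_closure R {K'}"
      using add_closure.summand[OF base HK lN] by simp
    show ?case
    proof (intro bexI[OF _ K'(1)] ballI impI)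
      fix X :: "'r lmod" and Y :: "'s lmod"
      assume X: "X \<in> fgmod R" and Y: "Y \<in> fgmod S" and eX: "obj e X \<in> add_closure S (Syz S j)"
        and iso: "miso S (obj e X) Y" and z: "zero_module ((F ^^ Suc (Suc m)) Y)"
      have GX: "G X \<in> fgmod R" and L: "obj l (obj e X) \<in> fgmod R" using X by auto
      have lc: "obj l (obj e X) \<in> add_closure R (Syz R j)"
        by (rule l.obj_add_closure[OF eX])
           (auto intro!: add_closure.base l.obj_Syz[OF l_projectives])
      have "obj e (obj l (obj e X)) \<in> add_closure S (Syz S j)"
        by (rule e.obj_add_closure[OF lc])
           (auto intro!: add_closure.base e.obj_Syz[OF e_projectives])
      then have eGX: "obj e (G X) \<in> add_closure S (Syz S j)"
        by (rule add_closure.summand[OF _ e.obj_fg[OF GX] e.obj_fg[OF X] ele_decomposition[OF X]])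
      have "zero_module ((F ^^ Suc m) (F Y))" using z unfolding funpow_Suc_right[of "Suc m"] comp_apply .
      then have "G X \<in> ext_layer R {K} (Suc m * Suc d)"
        by (rule IH[OF GX F_fg[OF Y] eGX eG_F[OF X Y iso]])
      moreover have "Suc m * Suc d = Suc (d + m * Suc d)" by simp
      ultimately have "G X \<in> ext_layer R {K} (Suc (d + m * Suc d))" by (simp only:)
      from H.obj_ext_layer[OF this] have H: "obj H (G X) \<in> ext_layer R {K'} (Suc (d + m * Suc d))"
        using ext_layer_mono[OF HK_K'] by blast
      have l: "obj l (obj e X) \<in> ext_layer R {K'} (Suc d)"
        using l_layer[OF eX] ext_layer_mono[OF lN_K'] by blast
      obtain W :: "'r lmod" and C :: "'r lmod" and a b where W: "W \<in> fgmod R" "C \<in> fgmod R" "miso R W (dsum X C)"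
        "short_exact R (obj l (obj e X)) a W b (obj H (G X))"
        by (rule shift_exact[OF X])
      have "W \<in> ext_layer R {K'} (Suc d + Suc (d + m * Suc d))"
        by (rule ext_layer_add[OF Rk.left_noetherian l H W(1,4)])
      then have "W \<in> ext_layer R {K'} (Suc (d + Suc (d + m * Suc d)))" unfolding add_Suc .
      then have "X \<in> ext_layer R {K'} (Suc (d + Suc (d + m * Suc d)))"
        by (rule ext_layer_summand[OF _ X W(2,3)])
      moreover have "Suc (Suc m) * Suc d = Suc (d + Suc (d + m * Suc d))" by simp
      ultimately show "X \<in> ext_layer R {K'} (Suc (Suc m) * Suc d)" by (simp only:)
    qed
  }
qed

lemma ext_dim_R_le:
  assumes n: "n \<ge> 1"
  shows "ext_dim R (Syz R j) \<le> enat n * ext_dim S (Syz S j) + enat (n - 1)"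
proof (cases "ext_dim S (Syz S j)")
  case (enat d)
  obtain N where N: "N \<in> fgmod S" "Syz S j \<subseteq> ext_layer S {N} (d + 1)" by (rule ext_dim_attained[OF enat])
  obtain m where m: "n = Suc m" using n by (cases n) auto
  have Syz: "Syz S j \<subseteq> ext_layer S {N} (Suc d)" using N(2) by simp
  obtain K where K: "K \<in> fgmod R" and bound: "\<And>X Y. X \<in> fgmod R \<Longrightarrow> Y \<in> fgmod S \<Longrightarrow>
      obj e X \<in> add_closure S (Syz S j) \<Longrightarrow> miso S (obj e X) Y \<Longrightarrow> zero_module ((F ^^ Suc m) Y) \<Longrightarrow>
      X \<in> ext_layer R {K} (Suc m * Suc d)"
    using layer_bound[OF N(1) Syz, of m] by blast
  have "Syz R j \<subseteq> ext_layer R {K} (n * d + (n - 1) + 1)"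
  proof
    fix X assume XS: "X \<in> Syz R j"
    then have X: "X \<in> fgmod R" by (simp add: Syz_def)
    have eX: "obj e X \<in> fgmod S" using X by auto
    have "zero_module ((F ^^ Suc m) (obj e X))"
      using nilpotent eX unfolding zero_functor_def functor_power_obj m by blast
    moreover have "obj e X \<in> add_closure S (Syz S j)"
      by (rule add_closure.base[OF e.obj_Syz[OF e_projectives XS] eX])
    ultimately have "X \<in> ext_layer R {K} (Suc m * Suc d)"
      by (intro bound[OF X eX] miso_refl fgmod_lm[OF eX])
    moreover have "Suc m * Suc d = n * d + (n - 1) + 1" unfolding m by simp
    ultimately show "X \<in> ext_layer R {K} (n * d + (n - 1) + 1)" by (simp only:)
  qed
  then have "ext_dim R (Syz R j) \<le> enat (n * d + (n - 1))" by (rule ext_dim_le[OF K])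
  then show ?thesis unfolding enat by simp
next
  case infinity
  then show ?thesis using n by (simp add: imult_is_infinity)
qed

end

theorem theorem1p2:
  fixes k :: "'k ring" and R :: "('k, 'r) module" and S :: "('k, 's) module"
    and i l :: "('s, 'r) mfunctor" and e :: "('r, 's) mfunctor"
    and \<eta> :: "'s lmod \<Rightarrow> 's list \<Rightarrow> 's list" and \<mu> :: "'r lmod \<Rightarrow> 'r list \<Rightarrow> 'r list"
    and j n :: nat
  assumes "artin_algebra k R" and "artin_algebra k S"
    and "cleft_extension S R i e l \<eta> \<mu>"
    and "preserves_projectives R S e"
    and "exact_functor S R l"
    and "n \<ge> 1"
    and "zero_functor S (functor_power (induced_endofunctor i e l \<mu>) n)"
  shows "ext_dim S (Syz S j) \<le> ext_dim R (Syz R j) \<and>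
    ext_dim R (Syz R j) \<le> enat n * ext_dim S (Syz S j) + enat (n - 1)"
proof -
  interpret nilpotent_cleft k R S i l e \<eta> \<mu> n
    by unfold_locales (use assms in auto)
  show ?thesis using ext_dim_S_le_R ext_dim_R_le[OF assms(6)] by blast
qed

end
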